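(* Let $\mathfrak g$ and $\mathfrak h$ be vector spaces. Then $s^{-1}\mathcal M\oplus F$, with the brackets $l_k$ restricted from $s^{-1}L\oplus F$, is an $L_\infty$-algebra, an $L_\infty$-subalgebra of $(s^{-1}L\oplus F,\{l_k\})$. Moreover, for linear maps $\pi\in\mathrm{Hom}(\wedge^2\mathfrak g,\mathfrak g)$, $\mu\in\mathrm{Hom}(\wedge^2\mathfrak h,\mathfrak h)$, $\rho\in\mathrm{Hom}(\mathfrak g\otimes\mathfrak h,\mathfrak h)$ and $D\in\mathrm{Hom}(\mathfrak g,\mathfrak h)$, the element $(s^{-1}(\pi+\mu+\rho),D)$ is a Maurer–Cartan element of $s^{-1}\mathcal M\oplus F$ if and only if $(\pi,\mu,\rho,D)$ is a relative difference Lie algebra structure on $(\mathfrak g,\mathfrak h)$.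
   Context: For a vector space $V$, $L(V)=\bigoplus_{n\ge0}\mathrm{Hom}(\wedge^{n+1}V,V)$, elements of $\mathrm{Hom}(\wedge^{n+1}V,V)$ having degree $n$ (written $|f|$). For $f\in\mathrm{Hom}(\wedge^mV,V)$, $g\in\mathrm{Hom}(\wedge^nV,V)$, $(f\circ g)(v_1,\dots,v_{m+n-1})=\sum_{\sigma\in S(n,m-1)}\mathrm{sgn}(\sigma)f(g(v_{\sigma(1)},\dots,v_{\sigma(n)}),v_{\sigma(n+1)},\dots,v_{\sigma(m+n-1)})$ ($S(p,q)$ = $(p,q)$-shuffles), and $[f,g]_{NR}=f\circ g-(-1)^{(m-1)(n-1)}g\circ f$ (Nijenhuis–Richardson bracket), making $L(V)$ a graded Lie algebra. For vector spaces $\mathfrak g,\mathfrak h$, a multilinear $\kappa:\wedge^k\mathfrak g\otimes\wedge^l\mathfrak h\to\mathfrak g$ (resp. $\mathfrak h$) is identified with its lift $\hat\kappa(x_1+u_1,\dots,x_{k+l}+u_{k+l})=\sum_{\tau\in S(k,l)}\mathrm{sgn}(\tau)\kappa(x_{\tau(1)},\dots,x_{\tau(k)},u_{\tau(k+1)},\dots,u_{\tau(k+l)})$ in the $\mathfrak g$ (resp. $\mathfrak h$) component, giving $\mathrm{Hom}(\wedge^n(\mathfrak g\oplus\mathfrak h),\mathfrak g\oplus\mathfrak h)\cong\bigoplus_{k+l=n}(\mathrm{Hom}(\wedge^k\mathfrak g\otimes\wedge^l\mathfrak h,\mathfrak g)\oplus\mathrm{Hom}(\wedge^k\mathfrak g\otimes\wedge^l\mathfrak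 h,\mathfrak h))$. Set $L=L(\mathfrak g\oplus\mathfrak h)$, $F=\bigoplus_{n\ge0}\mathrm{Hom}(\wedge^{n+1}\mathfrak g,\mathfrak h)$, $P:L\to L$ the projection onto $F$, and $\mathcal M=\bigoplus_{k\ge0}\big(\mathrm{Hom}(\wedge^{k+1}\mathfrak g,\mathfrak g)\oplus\bigoplus_{i+j=k+1,\,j\ge1}\mathrm{Hom}(\wedge^i\mathfrak g\otimes\wedge^j\mathfrak h,\mathfrak h)\big)\subset L$ (a graded Lie subalgebra). Desuspension: $(s^{-1}W)^i=W^{i+1}$. The $L_\infty$-algebra $s^{-1}L\oplus F$ has brackets $l_1(s^{-1}f,\theta)=P(f)$, $l_2(s^{-1}f,s^{-1}g)=(-1)^{|f|}s^{-1}[f,g]_{NR}$, $l_k(s^{-1}f,\theta_1,\dots,\theta_{k-1})=P[\cdots[f,\theta_1]_{NR}\cdots,\theta_{k-1}]_{NR}$ ($k\ge2$), for $f,g\in L$, $\theta,\theta_i\in F$ homogeneous, plus those obtained by graded symmetry, all others zero. An $L_\infty$-algebra is a graded space with degree-1 graded symmetric maps $l_k$ satisfying $\sum_{i=1}^n\sum_{\sigma\in S(i,n-i)}\varepsilon(\sigma)l_{n-i+1}(l_i(x_{\sigma(1)},\dots,x_{\sigma(i)}),x_{\sigma(i+1)},\dots)=0$ for all $n$ ($\varepsilon$ the Koszul sign). A Maurer–Cartan element is a degree-0 element $\alpha$ with $\sum_{k\ge1}\frac1{k!}l_k(\alpha,\dots,\alpha)=0$ (a finite sum here). A relative difference Lie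 algebra structure $(\pi,\mu,\rho,D)$ means: $\pi$ and $\mu$ are Lie brackets on $\mathfrak g$ and $\mathfrak h$; $x\mapsto\rho(x,\cdot)$ is a Lie algebra homomorphism $\mathfrak g\to\mathrm{Der}(\mathfrak h)$ (an action); and $D$ is a relative difference operator: $D(\pi(x,y))=\rho(x)D(y)-\rho(y)D(x)+\mu(D(x),D(y))$ for all $x,y\in\mathfrak g$. *)

theory Defs
  imports Complex_Main "HOL-Library.Function_Algebras" "HOL-Library.Product_Plus"
          "HOL-Combinatorics.Permutations"
begin

text \<open>An element of a direct sum of spaces Hom(wedge^n A, B) (n ranging over naturals) is
  represented by a single function on lists: its value on lists of length n is its
  Hom(wedge^n A, B) component.\<close>

definition arity_set :: "('a list \<Rightarrow> 'b::zero) \<Rightarrow> nat set" where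
  "arity_set f = {n. \<exists>xs. length xs = n \<and> f xs \<noteq> 0}"

definition restr :: "nat \<Rightarrow> ('a list \<Rightarrow> 'b::zero) \<Rightarrow> 'a list \<Rightarrow> 'b" where
  "restr n f xs = (if length xs = n then f xs else 0)"

definition multilin :: "('k \<Rightarrow> 'a::ab_group_add \<Rightarrow> 'a) \<Rightarrow> ('k \<Rightarrow> 'b::ab_group_add \<Rightarrow> 'b)
    \<Rightarrow> nat \<Rightarrow> ('a list \<Rightarrow> 'b) \<Rightarrow> bool" where
  "multilin sa sb n f \<longleftrightarrow> (\<forall>xs i c y z. length xs = n \<and> i < n \<longrightarrow>
      f (xs[i := sa c y + z]) = sb c (f (xs[i := y])) + f (xs[i := z]))"

definition alternating :: "nat \<Rightarrow> ('a list \<Rightarrow> 'b::zero) \<Rightarrow> bool" where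
  "alternating n f \<longleftrightarrow> (\<forall>xs i j. length xs = n \<and> i < j \<and> j < n \<and> xs ! i = xs ! j \<longrightarrow> f xs = 0)"

text \<open>The direct sum of Hom(wedge^(n+1) A, B), n \<ge> 0.\<close>
definition alt_maps :: "('k \<Rightarrow> 'a::ab_group_add \<Rightarrow> 'a) \<Rightarrow> ('k \<Rightarrow> 'b::ab_group_add \<Rightarrow> 'b)
    \<Rightarrow> ('a list \<Rightarrow> 'b) set" where
  "alt_maps sa sb = {f. f [] = 0 \<and> (\<forall>n. multilin sa sb n f \<and> alternating n f) \<and> finite (arity_set f)}"

definition shuffles :: "nat \<Rightarrow> nat \<Rightarrow> (nat \<Rightarrow> nat) set" where
  "shuffles p q = {\<sigma>. \<sigma> permutes {0..<p+q} \<and> (\<forall>i j. i < j \<and> j < p \<longrightarrow> \<sigma> i < \<sigma> j)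
                     \<and> (\<forall>i j. p \<le> i \<and> i < j \<and> j < p + q \<longrightarrow> \<sigma> i < \<sigma> j)}"

definition pick :: "(nat \<Rightarrow> nat) \<Rightarrow> 'a list \<Rightarrow> nat \<Rightarrow> nat \<Rightarrow> 'a list" where
  "pick \<sigma> vs a b = map (\<lambda>i. vs ! \<sigma> i) [a..<b]"

text \<open>The composition f o g (bilinear; on homogeneous f, g it is exactly the paper's formula).\<close>
definition nr_comp :: "('k::field \<Rightarrow> 'a::ab_group_add \<Rightarrow> 'a) \<Rightarrow> ('a list \<Rightarrow> 'a) \<Rightarrow> ('a list \<Rightarrow> 'a)
    \<Rightarrow> 'a list \<Rightarrow> 'a" where
  "nr_comp sa f g vs = (let N = length vs in
     \<Sum>n\<in>{1..N}. \<Sum>\<sigma>\<in>shuffles n (N - n).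
        sa (of_int (sign \<sigma>)) (f (g (pick \<sigma> vs 0 n) # pick \<sigma> vs n N)))"

text \<open>Nijenhuis--Richardson bracket, extended bilinearly from homogeneous components
  (component of arity m = Hom(wedge^m V, V)).\<close>
definition nr_bracket :: "('k::field \<Rightarrow> 'a::ab_group_add \<Rightarrow> 'a) \<Rightarrow> ('a list \<Rightarrow> 'a) \<Rightarrow> ('a list \<Rightarrow> 'a)
    \<Rightarrow> 'a list \<Rightarrow> 'a" where
  "nr_bracket sa f g = (\<lambda>vs. \<Sum>m\<in>arity_set f. \<Sum>n\<in>arity_set g.
      nr_comp sa (restr m f) (restr n g) vs
      - sa ((-1) ^ ((m - 1) * (n - 1))) (nr_comp sa (restr n g) (restr m f) vs))"

definition scaleV :: "('k \<Rightarrow> 'g \<Rightarrow> 'g) \<Rightarrow> ('k \<Rightarrow> 'h \<Rightarrow> 'h) \<Rightarrow> 'k \<Rightarrow> 'g \<times> 'h \<Rightarrow> 'g \<times> 'h" where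
  "scaleV sg sh c v = (sg c (fst v), sh c (snd v))"

text \<open>Lift of \<kappa> : wedge^k g \<otimes> wedge^l h \<rightarrow> W to a map on (g \<oplus> h)^(k+l).\<close>
definition lift :: "('k::field \<Rightarrow> 'w::ab_group_add \<Rightarrow> 'w) \<Rightarrow> nat \<Rightarrow> nat
    \<Rightarrow> ('g list \<Rightarrow> 'h list \<Rightarrow> 'w) \<Rightarrow> ('g \<times> 'h) list \<Rightarrow> 'w" where
  "lift sw k l \<kappa> vs = (if length vs = k + l then
     (\<Sum>\<tau>\<in>shuffles k l. sw (of_int (sign \<tau>))
        (\<kappa> (map fst (pick \<tau> vs 0 k)) (map snd (pick \<tau> vs k (k + l)))))
     else 0)"

type_synonym ('g, 'h) Lmap = "('g \<times> 'h) list \<Rightarrow> 'g \<times> 'h"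
type_synonym ('g, 'h) Fmap = "'g list \<Rightarrow> 'h"
type_synonym ('g, 'h) elt = "('g, 'h) Lmap \<times> ('g, 'h) Fmap"

definition Lsp :: "('k::field \<Rightarrow> 'g::ab_group_add \<Rightarrow> 'g) \<Rightarrow> ('k \<Rightarrow> 'h::ab_group_add \<Rightarrow> 'h)
    \<Rightarrow> ('g, 'h) Lmap set" where
  "Lsp sg sh = alt_maps (scaleV sg sh) (scaleV sg sh)"

definition Fsp :: "('k::field \<Rightarrow> 'g::ab_group_add \<Rightarrow> 'g) \<Rightarrow> ('k \<Rightarrow> 'h::ab_group_add \<Rightarrow> 'h)
    \<Rightarrow> ('g, 'h) Fmap set" where
  "Fsp sg sh = alt_maps sg sh"

text \<open>Inputs split according to a set T of slots: slots in T get their h-part, the others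
  their g-part. f lies in M iff its Hom(wedge^i g \<otimes> wedge^j h, g)-components vanish for
  j \<ge> 1 and its Hom(wedge^i g, h)-components vanish.\<close>
definition split_in :: "nat set \<Rightarrow> ('g::zero \<times> 'h::zero) list \<Rightarrow> ('g \<times> 'h) list" where
  "split_in T vs = map (\<lambda>i. if i \<in> T then (0, snd (vs ! i)) else (fst (vs ! i), 0)) [0..<length vs]"

definition Msp :: "('k::field \<Rightarrow> 'g::ab_group_add \<Rightarrow> 'g) \<Rightarrow> ('k \<Rightarrow> 'h::ab_group_add \<Rightarrow> 'h)
    \<Rightarrow> ('g, 'h) Lmap set" where
  "Msp sg sh = {f \<in> Lsp sg sh. \<forall>vs T. T \<subseteq> {0..<length vs} \<longrightarrow>
       (T \<noteq> {} \<longrightarrow> fst (f (split_in T vs)) = 0) \<and> (T = {} \<longrightarrow> snd (f (split_in T vs)) = 0)}"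

definition projF :: "('g::zero, 'h::zero) Lmap \<Rightarrow> ('g, 'h) Fmap" where
  "projF f xs = snd (f (map (\<lambda>x. (x, 0)) xs))"

definition emb :: "('k::field \<Rightarrow> 'h::ab_group_add \<Rightarrow> 'h) \<Rightarrow> ('g, 'h) Fmap \<Rightarrow> ('g::zero, 'h) Lmap" where
  "emb sh \<theta> vs = (0, lift sh (length vs) 0 (\<lambda>xs us. \<theta> xs) vs)"

text \<open>A pair (f, \<theta>) stands for s^{-1} f + \<theta>.\<close>
definition scaleE :: "('k \<Rightarrow> 'g \<Rightarrow> 'g) \<Rightarrow> ('k \<Rightarrow> 'h \<Rightarrow> 'h) \<Rightarrow> 'k \<Rightarrow> ('g, 'h) elt \<Rightarrow> ('g, 'h) elt" where
  "scaleE sg sh c x = (\<lambda>vs. scaleV sg sh c (fst x vs), \<lambda>xs. sh c (snd x xs))"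

text \<open>Homogeneity of degree d: s^{-1} f with f of arity d+2 (|f| = d+1), \<theta> of arity d+1.\<close>
definition homE :: "int \<Rightarrow> ('g::zero, 'h::zero) elt \<Rightarrow> bool" where
  "homE d x \<longleftrightarrow> (\<forall>vs. fst x vs \<noteq> 0 \<longrightarrow> int (length vs) = d + 2)
              \<and> (\<forall>xs. snd x xs \<noteq> 0 \<longrightarrow> int (length xs) = d + 1)"

text \<open>Pure homogeneous pieces: tag (True, n) = s^{-1} of the arity-n part of the L-component,
  tag (False, n) = arity-n part of the F-component.\<close>
definition tags :: "('g::zero, 'h::zero) elt \<Rightarrow> (bool \<times> nat) set" where
  "tags x = {(True, n) |n. n \<in> arity_set (fst x)} \<union> {(False, n) |n. n \<in> arity_set (snd x)}"

definition piece :: "bool \<times> nat \<Rightarrow> ('g::zero, 'h::zero) elt \<Rightarrow> ('g, 'h) elt" where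
  "piece t x = (if fst t then (restr (snd t) (fst x), 0) else (0, restr (snd t) (snd x)))"

definition tagdeg :: "bool \<times> nat \<Rightarrow> int" where
  "tagdeg t = (if fst t then int (snd t) - 2 else int (snd t) - 1)"

definition psgn :: "int \<Rightarrow> 'k::ring_1" where
  "psgn d = (if even d then 1 else -1)"

text \<open>Brackets on pure homogeneous pieces (with tags c): l_1(s^{-1}f) = P f,
  l_2(s^{-1}f, s^{-1}g) = (-1)^{|f|} s^{-1}[f,g],
  l_k(s^{-1}f, \<theta>_1, ..., \<theta>_{k-1}) = P[...[f,\<theta>_1],...,\<theta>_{k-1}], extended by graded symmetry
  (Koszul sign for moving s^{-1}f to the front), all others zero.\<close>
definition lpure :: "('k::field \<Rightarrow> 'g::ab_group_add \<Rightarrow> 'g) \<Rightarrow> ('k \<Rightarrow> 'h::ab_group_add \<Rightarrow> 'h)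
    \<Rightarrow> (bool \<times> nat) list \<Rightarrow> ('g, 'h) elt list \<Rightarrow> ('g, 'h) elt" where
  "lpure sg sh c ps = (let k = length c; Ls = filter (\<lambda>i. fst (c ! i)) [0..<k] in
     if k = 1 then (if fst (c ! 0) then (0, projF (fst (ps ! 0))) else 0)
     else if k = 2 \<and> Ls = [0, 1] then
       (\<lambda>vs. scaleV sg sh (psgn (int (snd (c ! 0)) - 1))
               (nr_bracket (scaleV sg sh) (fst (ps ! 0)) (fst (ps ! 1)) vs), 0)
     else if 2 \<le> k \<and> length Ls = 1 then
       (let j = hd Ls; f = fst (ps ! j); \<theta>s = map snd (take j ps @ drop (Suc j) ps);
            e = psgn (tagdeg (c ! j) * (\<Sum>i<j. tagdeg (c ! i)))
        in (0, \<lambda>xs. sh e (projF (foldl (\<lambda>a \<theta>. nr_bracket (scaleV sg sh) a (emb sh \<theta>)) f \<theta>s) xs)))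
     else 0)"

definition lbr :: "('k::field \<Rightarrow> 'g::ab_group_add \<Rightarrow> 'g) \<Rightarrow> ('k \<Rightarrow> 'h::ab_group_add \<Rightarrow> 'h)
    \<Rightarrow> nat \<Rightarrow> ('g, 'h) elt list \<Rightarrow> ('g, 'h) elt" where
  "lbr sg sh k xs = (if length xs = k then
     (\<Sum>c\<in>{c. length c = k \<and> (\<forall>i<k. c ! i \<in> tags (xs ! i))}. lpure sg sh c (map2 piece c xs))
     else 0)"

text \<open>Koszul sign of the permutation \<sigma> of {0..<n} for elements of degrees d: the sign with
  x_\<sigma>(0) ... x_\<sigma>(n-1) = \<epsilon> x_0 ... x_(n-1) in the graded symmetric algebra.\<close>
definition koszul :: "(nat \<Rightarrow> int) \<Rightarrow> (nat \<Rightarrow> nat) \<Rightarrow> nat \<Rightarrow> 'k::comm_ring_1" where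
  "koszul d \<sigma> n = (\<Prod>p\<in>{(i, j). i < j \<and> j < n \<and> \<sigma> j < \<sigma> i}. psgn (d (\<sigma> (fst p)) * d (\<sigma> (snd p))))"

definition graded_space :: "('k::field \<Rightarrow> 'e::ab_group_add \<Rightarrow> 'e) \<Rightarrow> (int \<Rightarrow> 'e \<Rightarrow> bool) \<Rightarrow> 'e set \<Rightarrow> bool" where
  "graded_space se hom C \<longleftrightarrow> vector_space se \<and>
     0 \<in> C \<and> (\<forall>x\<in>C. \<forall>y\<in>C. x + y \<in> C) \<and> (\<forall>c. \<forall>x\<in>C. se c x \<in> C) \<and>
     (\<forall>d. hom d 0 \<and> (\<forall>x y. hom d x \<and> hom d y \<longrightarrow> hom d (x + y)) \<and> (\<forall>c x. hom d x \<longrightarrow> hom d (se c x))) \<and>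
     (\<forall>x\<in>C. \<exists>D cmp. finite D \<and> (\<forall>d\<in>D. cmp d \<in> C \<and> hom d (cmp d)) \<and> x = (\<Sum>d\<in>D. cmp d)) \<and>
     (\<forall>D cmp. finite D \<and> (\<forall>d\<in>D. cmp d \<in> C \<and> hom d (cmp d)) \<and> (\<Sum>d\<in>D. cmp d) = 0
        \<longrightarrow> (\<forall>d\<in>D. cmp d = 0))"

definition Linf_algebra :: "('k::field \<Rightarrow> 'e::ab_group_add \<Rightarrow> 'e) \<Rightarrow> (int \<Rightarrow> 'e \<Rightarrow> bool) \<Rightarrow> 'e set
    \<Rightarrow> (nat \<Rightarrow> 'e list \<Rightarrow> 'e) \<Rightarrow> bool" where
  "Linf_algebra se hom C l \<longleftrightarrow> graded_space se hom C \<and>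
     (\<forall>k xs. length xs = k \<and> set xs \<subseteq> C \<longrightarrow> l k xs \<in> C) \<and>
     (\<forall>k xs i c y z. length xs = k \<and> set xs \<subseteq> C \<and> i < k \<and> y \<in> C \<and> z \<in> C \<longrightarrow>
        l k (xs[i := se c y + z]) = se c (l k (xs[i := y])) + l k (xs[i := z])) \<and>
     (\<forall>k xs d. length xs = k \<and> (\<forall>i<k. xs ! i \<in> C \<and> hom (d i) (xs ! i)) \<longrightarrow>
        hom ((\<Sum>i<k. d i) + 1) (l k xs)) \<and>
     (\<forall>k xs d \<sigma>. length xs = k \<and> (\<forall>i<k. xs ! i \<in> C \<and> hom (d i) (xs ! i)) \<and> \<sigma> permutes {0..<k} \<longrightarrow>
        l k (map (\<lambda>i. xs ! \<sigma> i) [0..<k]) = se (koszul d \<sigma> k) (l k xs)) \<and>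
     (\<forall>n xs d. 1 \<le> n \<and> length xs = n \<and> (\<forall>i<n. xs ! i \<in> C \<and> hom (d i) (xs ! i)) \<longrightarrow>
        (\<Sum>i\<in>{1..n}. \<Sum>\<sigma>\<in>shuffles i (n - i).
           se (koszul d \<sigma> n) (l (n - i + 1) (l i (pick \<sigma> xs 0 i) # pick \<sigma> xs i n))) = 0)"

definition Linf_subalgebra :: "('k::field \<Rightarrow> 'e::ab_group_add \<Rightarrow> 'e) \<Rightarrow> (int \<Rightarrow> 'e \<Rightarrow> bool) \<Rightarrow> 'e set
    \<Rightarrow> 'e set \<Rightarrow> (nat \<Rightarrow> 'e list \<Rightarrow> 'e) \<Rightarrow> bool" where
  "Linf_subalgebra se hom S C l \<longleftrightarrow> S \<subseteq> C \<and>
     (\<forall>k xs. length xs = k \<and> set xs \<subseteq> S \<longrightarrow> l k xs \<in> S) \<and> Linf_algebra se hom S l"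

definition MC_element :: "('k::field_char_0 \<Rightarrow> 'e::ab_group_add \<Rightarrow> 'e) \<Rightarrow> (int \<Rightarrow> 'e \<Rightarrow> bool) \<Rightarrow> 'e set
    \<Rightarrow> (nat \<Rightarrow> 'e list \<Rightarrow> 'e) \<Rightarrow> 'e \<Rightarrow> bool" where
  "MC_element se hom C l \<alpha> \<longleftrightarrow> \<alpha> \<in> C \<and> hom 0 \<alpha> \<and>
     finite {k. 1 \<le> k \<and> l k (replicate k \<alpha>) \<noteq> 0} \<and>
     (\<Sum>k\<in>{k. 1 \<le> k \<and> l k (replicate k \<alpha>) \<noteq> 0}. se (inverse (fact k)) (l k (replicate k \<alpha>))) = 0"

definition bilinear_map :: "('k::field \<Rightarrow> 'a::ab_group_add \<Rightarrow> 'a) \<Rightarrow> ('k \<Rightarrow> 'b::ab_group_add \<Rightarrow> 'b)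
    \<Rightarrow> ('k \<Rightarrow> 'c::ab_group_add \<Rightarrow> 'c) \<Rightarrow> ('a \<Rightarrow> 'b \<Rightarrow> 'c) \<Rightarrow> bool" where
  "bilinear_map sa sb sc b \<longleftrightarrow> (\<forall>x. module_hom sb sc (b x)) \<and> (\<forall>y. module_hom sa sc (\<lambda>x. b x y))"

definition alt_bilinear :: "('k::field \<Rightarrow> 'a::ab_group_add \<Rightarrow> 'a) \<Rightarrow> ('k \<Rightarrow> 'c::ab_group_add \<Rightarrow> 'c)
    \<Rightarrow> ('a \<Rightarrow> 'a \<Rightarrow> 'c) \<Rightarrow> bool" where
  "alt_bilinear sa sc b \<longleftrightarrow> bilinear_map sa sa sc b \<and> (\<forall>x. b x x = 0)"

definition Lie_bracket :: "('k::field \<Rightarrow> 'a::ab_group_add \<Rightarrow> 'a) \<Rightarrow> ('a \<Rightarrow> 'a \<Rightarrow> 'a) \<Rightarrow> bool" where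
  "Lie_bracket sa b \<longleftrightarrow> alt_bilinear sa sa b \<and>
     (\<forall>x y z. b x (b y z) + b y (b z x) + b z (b x y) = 0)"

definition is_action :: "('k::field \<Rightarrow> 'g::ab_group_add \<Rightarrow> 'g) \<Rightarrow> ('k \<Rightarrow> 'h::ab_group_add \<Rightarrow> 'h)
    \<Rightarrow> ('g \<Rightarrow> 'g \<Rightarrow> 'g) \<Rightarrow> ('h \<Rightarrow> 'h \<Rightarrow> 'h) \<Rightarrow> ('g \<Rightarrow> 'h \<Rightarrow> 'h) \<Rightarrow> bool" where
  "is_action sg sh \<pi> \<mu> \<rho> \<longleftrightarrow> bilinear_map sg sh sh \<rho> \<and>
     (\<forall>x u v. \<rho> x (\<mu> u v) = \<mu> (\<rho> x u) v + \<mu> u (\<rho> x v)) \<and>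
     (\<forall>x y u. \<rho> (\<pi> x y) u = \<rho> x (\<rho> y u) - \<rho> y (\<rho> x u))"

definition rel_diff_operator :: "('g \<Rightarrow> 'g \<Rightarrow> 'g) \<Rightarrow> ('h::ab_group_add \<Rightarrow> 'h \<Rightarrow> 'h) \<Rightarrow> ('g \<Rightarrow> 'h \<Rightarrow> 'h)
    \<Rightarrow> ('g \<Rightarrow> 'h) \<Rightarrow> bool" where
  "rel_diff_operator \<pi> \<mu> \<rho> D \<longleftrightarrow>
     (\<forall>x y. D (\<pi> x y) = \<rho> x (D y) - \<rho> y (D x) + \<mu> (D x) (D y))"

definition rel_diff_Lie :: "('k::field \<Rightarrow> 'g::ab_group_add \<Rightarrow> 'g) \<Rightarrow> ('k \<Rightarrow> 'h::ab_group_add \<Rightarrow> 'h)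
    \<Rightarrow> ('g \<Rightarrow> 'g \<Rightarrow> 'g) \<Rightarrow> ('h \<Rightarrow> 'h \<Rightarrow> 'h) \<Rightarrow> ('g \<Rightarrow> 'h \<Rightarrow> 'h) \<Rightarrow> ('g \<Rightarrow> 'h) \<Rightarrow> bool" where
  "rel_diff_Lie sg sh \<pi> \<mu> \<rho> D \<longleftrightarrow> Lie_bracket sg \<pi> \<and> Lie_bracket sh \<mu> \<and>
     is_action sg sh \<pi> \<mu> \<rho> \<and> module_hom sg sh D \<and> rel_diff_operator \<pi> \<mu> \<rho> D"

definition mc_candidate :: "('k::field \<Rightarrow> 'g::ab_group_add \<Rightarrow> 'g) \<Rightarrow> ('k \<Rightarrow> 'h::ab_group_add \<Rightarrow> 'h)
    \<Rightarrow> ('g \<Rightarrow> 'g \<Rightarrow> 'g) \<Rightarrow> ('h \<Rightarrow> 'h \<Rightarrow> 'h) \<Rightarrow> ('g \<Rightarrow> 'h \<Rightarrow> 'h) \<Rightarrow> ('g \<Rightarrow> 'h) \<Rightarrow> ('g, 'h) elt" where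
  "mc_candidate sg sh \<pi> \<mu> \<rho> D =
     ((\<lambda>vs. (lift sg 2 0 (\<lambda>xs us. \<pi> (xs ! 0) (xs ! 1)) vs, 0))
      + (\<lambda>vs. (0, lift sh 0 2 (\<lambda>xs us. \<mu> (us ! 0) (us ! 1)) vs))
      + (\<lambda>vs. (0, lift sh 1 1 (\<lambda>xs us. \<rho> (xs ! 0) (us ! 0)) vs)),
      \<lambda>xs. if length xs = 1 then D (xs ! 0) else 0)"

end

theory Submission
  imports Defs
begin

text \<open>
Sums over shuffles are rewritten as sums over the splittings of a list with Koszul sign, a
sum that has a recursion on the list. In this form the Nijenhuis--Richardson composition
\<open>f \<circ> g\<close> interacts well with contraction by the first argument \<open>v\<close>,
\<open>\<iota>\<^sub>v (f \<circ> g) = f \<circ> \<iota>\<^sub>v g - (-1)\<^sup>n \<iota>\<^sub>v f \<circ> g\<close> for \<open>g\<close> of arity \<open>n\<close>, so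
that the right pre-Lie identity, and with it the graded Jacobi identity, follows by induction
on the list of arguments.

The \<open>L\<^sub>\<infinity>\<close>-identity is multilinear and graded symmetric, so it is enough to check it on
\<open>s\<^sup>-\<^sup>1 f\<^sub>1, \<dots>, s\<^sup>-\<^sup>1 f\<^sub>r, \<theta>\<^sub>1, \<dots>, \<theta>\<^sub>k\<close>, where only \<open>r = 2\<close> and the Jacobi identity
(\<open>r = 3\<close>, \<open>k = 0\<close>) have nonzero terms. For \<open>r = 2\<close> it is the Leibniz rule for the iterated
brackets with the \<open>\<theta>\<^sub>i\<close>, combined with \<open>P [f, g] = P [P f, g] + P [f, P g]\<close>, which says that
the kernel of \<open>P\<close> is a subalgebra.

A map lies in \<open>M\<close> iff it commutes with the projection of \<open>g \<oplus> h\<close> onto \<open>g\<close>, so that \<open>M\<close> is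
closed under brackets. With \<open>\<Omega> = \<pi> + \<mu> + \<rho>\<close>, the Maurer--Cartan equation reads
\<open>\<Omega> \<circ> \<Omega> = 0\<close> together with \<open>P [\<Omega>, D] + P [[\<Omega>, D], D] / 2 = 0\<close>, as the third iterated bracket
with \<open>D\<close> vanishes; these are the Lie and action axioms and the relative difference equation.
\<close>

section \<open>Signed sums over the splittings of a list\<close>

text \<open>Homogeneity is not visible in an element: zero has every degree, and a homogeneous
  element of s^{-1} L + F may have both an L-part and an F-part. Hence arities and degrees are
  carried as explicit integers (\<open>arity\<close>, the second entry of a tagged element), and the
  brackets are studied on tagged lists before the sum over tags in \<open>lbr\<close> is brought in.
  Signs are applied by \<open>pm\<close>, which needs only negation and the parity of an exponent;
  this keeps the combinatorics free of the scalar field and reduces every sign check to a parity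
  check. Alternation is replaced by the sign change under exchange of neighbours, which survives
  fixing the first argument and is equivalent in characteristic 0. Symmetry is proved for neighbours
  only; general Koszul signs follow because adjacent transpositions generate.\<close>

definition pm :: "int \<Rightarrow> 'a::ab_group_add \<Rightarrow> 'a" where
  "pm d x = (if even d then x else - x)"

lemma pm_0 [simp]: "pm 0 x = x" and pm_1 [simp]: "pm 1 x = - x" and pm_zero [simp]: "pm d 0 = 0"
  and pm_eq_0 [simp]: "pm d x = 0 \<longleftrightarrow> x = 0"
  by (auto simp: pm_def)

lemma pm_add: "pm d (x + y) = pm d x + pm d y"
  and pm_diff: "pm d (x - y) = pm d x - pm d y"
  and pm_minus: "pm d (- x) = - pm d x"
  and pm_pm: "pm d (pm e x) = pm (d + e) x"
  by (auto simp: pm_def)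

lemma pm_cong: "even (d - e) \<Longrightarrow> pm d x = pm e x"
  by (auto simp: pm_def)

lemma pm_fun: "pm d f = (\<lambda>x. pm d (f x))"
  by (auto simp: pm_def fun_eq_iff)

lemma pm_pair: "pm d (x, y) = (pm d x, pm d y)"
  by (auto simp: pm_def)

text \<open>The head \<open>x\<close> goes to one of the two blocks. In the second block it has to
  pass every entry of the first block, all of which stood behind it; this is the Koszul sign in the
  second summand. With all degrees 1 it is the signature of the shuffle.\<close>

fun ksum :: "('a \<Rightarrow> int) \<Rightarrow> 'a list \<Rightarrow> ('a list \<Rightarrow> 'a list \<Rightarrow> 'b::ab_group_add) \<Rightarrow> 'b" where
  "ksum deg [] \<Phi> = \<Phi> [] []"
| "ksum deg (x # xs) \<Phi> = ksum deg xs (\<lambda>as bs. \<Phi> (x # as) bs)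
     + ksum deg xs (\<lambda>as bs. pm (deg x * sum_list (map deg as)) (\<Phi> as (x # bs)))"

text \<open>The multiset equation is all that later arguments need to know about a splitting: it
  yields the lengths, the members and the well-formedness of both blocks.\<close>

lemma ksum_cong:
  "(\<And>as bs. mset as + mset bs = mset xs \<Longrightarrow> \<Phi> as bs = \<Psi> as bs) \<Longrightarrow> ksum deg xs \<Phi> = ksum deg xs \<Psi>"
proof (induction xs arbitrary: \<Phi> \<Psi>)
  case (Cons x xs)
  have "ksum deg xs (\<lambda>as bs. \<Phi> (x # as) bs) = ksum deg xs (\<lambda>as bs. \<Psi> (x # as) bs)"
    by (rule Cons.IH) (simp add: Cons.prems)
  moreover have "ksum deg xs (\<lambda>as bs. pm (deg x * sum_list (map deg as)) (\<Phi> as (x # bs)))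
      = ksum deg xs (\<lambda>as bs. pm (deg x * sum_list (map deg as)) (\<Psi> as (x # bs)))"
    by (rule Cons.IH) (simp add: Cons.prems)
  ultimately show ?case by simp
qed simp

lemma ksum_add: "ksum deg xs (\<lambda>as bs. \<Phi> as bs + \<Psi> as bs) = ksum deg xs \<Phi> + ksum deg xs \<Psi>"
  by (induction xs arbitrary: \<Phi> \<Psi>) (simp_all add: pm_add algebra_simps)

lemma ksum_0 [simp]: "ksum deg xs (\<lambda>as bs. 0) = 0"
  by (induction xs) simp_all

lemma ksum_minus: "ksum deg xs (\<lambda>as bs. - \<Phi> as bs) = - ksum deg xs \<Phi>"
  by (induction xs arbitrary: \<Phi>) (simp_all add: pm_minus)

lemma ksum_pm: "ksum deg xs (\<lambda>as bs. pm d (\<Phi> as bs)) = pm d (ksum deg xs \<Phi>)"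
  by (simp add: pm_def ksum_minus)

lemma ksum_diff: "ksum deg xs (\<lambda>as bs. \<Phi> as bs - \<Psi> as bs) = ksum deg xs \<Phi> - ksum deg xs \<Psi>"
  using ksum_add[of deg xs \<Phi> "\<lambda>as bs. - \<Psi> as bs"] by (simp add: ksum_minus)

lemma additive_ksum:
  assumes "\<And>x y. h (x + y) = h x + h y"
  shows "h (ksum deg xs \<Phi>) = ksum deg xs (\<lambda>as bs. h (\<Phi> as bs))"
proof -
  have "h 0 = 0" using assms[of 0 0] by simp
  then have "h (- x) = - h x" for x
    using assms[of x "- x"] by (simp add: eq_neg_iff_add_eq_0 add.commute)
  then have "h (pm d x) = pm d (h x)" for d x by (simp add: pm_def)
  then show ?thesis by (induction xs arbitrary: \<Phi>) (simp_all add: assms)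
qed

lemma ksum_zeroI:
  "(\<And>as bs. mset as + mset bs = mset xs \<Longrightarrow> \<Phi> as bs = 0) \<Longrightarrow> ksum deg xs \<Phi> = 0"
  using ksum_cong[of xs \<Phi> "\<lambda>as bs. 0"] by simp

lemma ksum_map: "ksum deg (map h xs) \<Phi> = ksum (deg \<circ> h) xs (\<lambda>as bs. \<Phi> (map h as) (map h bs))"
  by (induction xs arbitrary: \<Phi>) (simp_all add: comp_def)

text \<open>If \<open>x\<close> and \<open>y\<close> land in the same block, the symmetry of \<Phi>
  in that block gives the sign. If they are separated, the two lists have the same splittings and
  the sign comes from the splitting itself.\<close>

lemma ksum_swap:
  assumes "\<And>us vs bs. mset us + mset vs + mset bs = mset xs + mset ys \<Longrightarrow>
             \<Phi> (us @ x # y # vs) bs = pm (deg x * deg y) (\<Phi> (us @ y # x # vs) bs)"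
    and "\<And>us vs as. mset us + mset vs + mset as = mset xs + mset ys \<Longrightarrow>
             \<Phi> as (us @ x # y # vs) = pm (deg x * deg y) (\<Phi> as (us @ y # x # vs))"
  shows "ksum deg (xs @ x # y # ys) \<Phi> = pm (deg x * deg y) (ksum deg (xs @ y # x # ys) \<Phi>)"
  using assms
proof (induction xs arbitrary: \<Phi>)
  case Nil
  let ?d = "\<lambda>as. sum_list (map deg as)"
  let ?xy = "deg x * deg y"
  have 1: "ksum deg ys (\<lambda>as bs. \<Phi> (x # y # as) bs) = pm ?xy (ksum deg ys (\<lambda>as bs. \<Phi> (y # x # as) bs))"
    unfolding ksum_pm[symmetric] by (rule ksum_cong) (use Nil.prems(1)[of "[]"] in simp)
  have 2: "ksum deg ys (\<lambda>as bs. pm (deg y * ?d as) (pm (deg x * ?d as) (\<Phi> as (x # y # bs))))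
      = pm ?xy (ksum deg ys (\<lambda>as bs. pm (deg x * ?d as) (pm (deg y * ?d as) (\<Phi> as (y # x # bs)))))"
    unfolding ksum_pm[symmetric]
    by (rule ksum_cong) (use Nil.prems(2)[of "[]"] in \<open>simp add: pm_pm add.commute add.left_commute\<close>)
  \<comment> \<open>Here \<open>x\<close> goes to the second block and \<open>y\<close> to the
    first: \<open>x\<close> passes \<open>y\<close> only if it stood in front, which accounts for
    the whole factor.\<close>
  have 3: "ksum deg ys (\<lambda>as bs. pm (deg x * (deg y + ?d as)) (\<Phi> (y # as) (x # bs)))
      = pm ?xy (ksum deg ys (\<lambda>as bs. pm (deg x * ?d as) (\<Phi> (y # as) (x # bs))))"
    unfolding ksum_pm[symmetric] pm_pm by (simp add: algebra_simps)
  have 4: "ksum deg ys (\<lambda>as bs. pm (deg y * ?d as) (\<Phi> (x # as) (y # bs)))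
      = pm ?xy (ksum deg ys (\<lambda>as bs. pm (deg y * (deg x + ?d as)) (\<Phi> (x # as) (y # bs))))"
    unfolding ksum_pm[symmetric] pm_pm by (intro ksum_cong pm_cong) (simp add: algebra_simps)
  show ?case by (simp add: 1 2 3 4 pm_add add_ac)
next
  case (Cons z xs)
  have 1: "ksum deg (xs @ x # y # ys) (\<lambda>as bs. \<Phi> (z # as) bs)
      = pm (deg x * deg y) (ksum deg (xs @ y # x # ys) (\<lambda>as bs. \<Phi> (z # as) bs))"
  proof (rule Cons.IH, goal_cases)
    case (1 us vs bs) then show ?case using Cons.prems(1)[of "z # us" vs bs] by simp
  next
    case (2 us vs as) then show ?case using Cons.prems(2)[of us vs "z # as"] by simp
  qed
  let ?\<Psi> = "\<lambda>as bs. pm (deg z * sum_list (map deg as)) (\<Phi> as (z # bs))"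
  have 2: "ksum deg (xs @ x # y # ys) ?\<Psi> = pm (deg x * deg y) (ksum deg (xs @ y # x # ys) ?\<Psi>)"
  proof (rule Cons.IH, goal_cases)
    case (1 us vs bs) then show ?case using Cons.prems(1)[of us vs "z # bs"]
      by (simp add: pm_pm algebra_simps)
  next
    case (2 us vs as) then show ?case using Cons.prems(2)[of "z # us" vs "as"]
      by (simp add: pm_pm algebra_simps)
  qed
  show ?case using 1 2 by (simp add: pm_add)
qed

text \<open>The entry influences the signs only through its degree, which is the same for all three
  lists, so additivity in either block carries over.\<close>

lemma ksum_slot_add:
  assumes "\<And>us vs bs. mset us + mset vs + mset bs = mset xs + mset ys \<Longrightarrow>
             \<Phi> (us @ x # vs) bs = \<Phi> (us @ y # vs) bs + \<Phi> (us @ z # vs) bs"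
    and "\<And>us vs as. mset us + mset vs + mset as = mset xs + mset ys \<Longrightarrow>
             \<Phi> as (us @ x # vs) = \<Phi> as (us @ y # vs) + \<Phi> as (us @ z # vs)"
    and "deg y = deg x" "deg z = deg x"
  shows "ksum deg (xs @ x # ys) \<Phi> = ksum deg (xs @ y # ys) \<Phi> + ksum deg (xs @ z # ys) \<Phi>"
  using assms(1,2)
proof (induction xs arbitrary: \<Phi>)
  case Nil
  have 1: "ksum deg ys (\<lambda>as bs. \<Phi> (x # as) bs)
      = ksum deg ys (\<lambda>as bs. \<Phi> (y # as) bs) + ksum deg ys (\<lambda>as bs. \<Phi> (z # as) bs)"
    unfolding ksum_add[symmetric] by (rule ksum_cong) (use Nil.prems(1)[of "[]"] in simp)
  let ?\<Psi> = "\<lambda>w as bs. pm (deg x * sum_list (map deg as)) (\<Phi> as (w # bs))"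
  have 2: "ksum deg ys (?\<Psi> x) = ksum deg ys (?\<Psi> y) + ksum deg ys (?\<Psi> z)"
    unfolding ksum_add[symmetric] pm_add[symmetric]
    by (rule ksum_cong) (use Nil.prems(2)[of "[]"] in \<open>simp add: add.commute\<close>)
  show ?case by (simp add: 1 2 assms(3,4) algebra_simps)
next
  case (Cons w xs)
  have 1: "ksum deg (xs @ x # ys) (\<lambda>as bs. \<Phi> (w # as) bs)
      = ksum deg (xs @ y # ys) (\<lambda>as bs. \<Phi> (w # as) bs) + ksum deg (xs @ z # ys) (\<lambda>as bs. \<Phi> (w # as) bs)"
  proof (rule Cons.IH, goal_cases)
    case (1 us vs bs) then show ?case using Cons.prems(1)[of "w # us" vs bs] by simp
  next
    case (2 us vs as) then show ?case using Cons.prems(2)[of us vs "w # as"] by simp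
  qed
  let ?\<Psi> = "\<lambda>as bs. pm (deg w * sum_list (map deg as)) (\<Phi> as (w # bs))"
  have 2: "ksum deg (xs @ x # ys) ?\<Psi> = ksum deg (xs @ y # ys) ?\<Psi> + ksum deg (xs @ z # ys) ?\<Psi>"
  proof (rule Cons.IH, goal_cases)
    case (1 us vs bs) then show ?case using Cons.prems(1)[of us vs "w # bs"]
      by (simp add: pm_add assms(3,4))
  next
    case (2 us vs as) then show ?case using Cons.prems(2)[of "w # us" vs "as"]
      by (simp add: pm_add)
  qed
  show ?case using 1 2 by (simp add: algebra_simps)
qed

section \<open>Shuffles and Koszul signs\<close>

definition inversions :: "(nat \<Rightarrow> nat) \<Rightarrow> nat \<Rightarrow> (nat \<times> nat) set" where
  "inversions \<sigma> n = {(i, j). i < j \<and> j < n \<and> \<sigma> j < \<sigma> i}"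

text \<open>Recording the exponent instead of the sign makes signs additive; only its parity
  matters.\<close>

definition koszul_exp :: "(nat \<Rightarrow> int) \<Rightarrow> (nat \<Rightarrow> nat) \<Rightarrow> nat \<Rightarrow> int" where
  "koszul_exp d \<sigma> n = (\<Sum>(i, j)\<in>inversions \<sigma> n. d (\<sigma> i) * d (\<sigma> j))"

lemma finite_inversions [simp]: "finite (inversions \<sigma> n)"
  by (rule finite_subset[of _ "{..<n} \<times> {..<n}"]) (auto simp: inversions_def)

lemma prod_psgn: "finite A \<Longrightarrow> (\<Prod>x\<in>A. psgn (g x)) = psgn (\<Sum>x\<in>A. g x)"
  by (induction A rule: finite_induct) (auto simp: psgn_def)

lemma koszul_psgn: "koszul d \<sigma> n = psgn (koszul_exp d \<sigma> n)"
  unfolding koszul_def koszul_exp_def inversions_def[symmetric]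
  by (subst prod_psgn) (auto intro!: arg_cong[where f=psgn] sum.cong)

lemma (in module) scale_psgn: "scale (psgn d) x = pm d x"
  by (simp add: psgn_def pm_def)

lemma koszul_exp_id: "koszul_exp d id n = 0"
proof -
  have "inversions id n = {}" by (auto simp: inversions_def)
  then show ?thesis by (simp add: koszul_exp_def)
qed

text \<open>An adjacent transposition preserves the order of every pair of positions except
  \<open>(i, Suc i)\<close>, so the other inversions correspond bijectively with equal weights, and
  the exceptional pair is an inversion of exactly one of the two permutations.\<close>

lemma koszul_exp_adjacent:
  assumes "\<sigma> permutes {0..<n}" "Suc i < n"
  shows "even (koszul_exp d (\<sigma> \<circ> transpose i (Suc i)) n - (koszul_exp d \<sigma> n + d (\<sigma> i) * d (\<sigma> (Suc i))))"
proof -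
  let ?t = "transpose i (Suc i)" and ?p = "(i, Suc i)"
  let ?w = "\<lambda>\<sigma> (i, j). d (\<sigma> i) * d (\<sigma> j)" and ?I = "\<lambda>\<sigma>. inversions \<sigma> n"
  have mono: "?t a < ?t b" "?t b < n" if "a < b" "b < n" "(a, b) \<noteq> ?p" for a b
    using that assms(2) by (auto simp: transpose_def)
  have 1: "sum (?w (\<sigma> \<circ> ?t)) (?I (\<sigma> \<circ> ?t) - {?p}) = sum (?w \<sigma>) (?I \<sigma> - {?p})"
    by (rule sum.reindex_bij_witness[of _ "map_prod ?t ?t" "map_prod ?t ?t"])
       (auto simp: inversions_def mono, (auto simp: transpose_def split: if_splits)?)
  have 2: "sum w A = sum w (A - {?p}) + (if ?p \<in> A then w ?p else 0)" if "finite A" for w :: "_ \<Rightarrow> int" and A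
    using that by (simp add: sum.remove)
  have "\<sigma> i \<noteq> \<sigma> (Suc i)" using permutes_inj[OF assms(1)] by (metis injD n_not_Suc_n)
  then have 3: "?p \<in> ?I (\<sigma> \<circ> ?t) \<longleftrightarrow> ?p \<notin> ?I \<sigma>" using assms(2) by (auto simp: inversions_def)
  show ?thesis unfolding koszul_exp_def 2[OF finite_inversions, of _ _ n] 1 using 3
    by (auto simp: mult.commute)
qed

text \<open>Every permutation is a product of transpositions, and a transposition over a longer
  distance is conjugate, by an adjacent one, to a transposition over a distance shorter by
  one.\<close>

lemma permutes_adjacent_induct [consumes 1, case_names id adjacent]:
  assumes "\<sigma> permutes {0..<n}" and id: "Q id"
    and step: "\<And>\<sigma> i. \<sigma> permutes {0..<n} \<Longrightarrow> Suc i < n \<Longrightarrow> Q \<sigma> \<Longrightarrow> Q (\<sigma> \<circ> transpose i (Suc i))"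
  shows "Q \<sigma>"
proof -
  have tr: "Q (\<sigma> \<circ> transpose a (a + Suc k))" if "\<sigma> permutes {0..<n}" "a + Suc k < n" "Q \<sigma>" for \<sigma> a k
    using that
  proof (induction k arbitrary: \<sigma>)
    case 0
    then show ?case using step[of \<sigma> a] by (simp add: comp_def)
  next
    case (Suc k)
    let ?b = "a + Suc k"
    let ?s = "transpose ?b (Suc ?b)" and ?t = "transpose a ?b"
    have s: "?s permutes {0..<n}" "?t permutes {0..<n}" using Suc by (auto intro!: permutes_swap_id)
    have "Q ((\<sigma> \<circ> ?s) \<circ> ?t)"
      using Suc by (intro Suc.IH step permutes_compose[OF s(1)]) auto
    then have "Q (((\<sigma> \<circ> ?s) \<circ> ?t) \<circ> ?s)"
      using Suc s by (intro step permutes_compose) auto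
    moreover have "((\<sigma> \<circ> ?s) \<circ> ?t) \<circ> ?s = \<sigma> \<circ> transpose a (a + Suc (Suc k))"
      by (auto simp: fun_eq_iff transpose_def)
    ultimately show ?case by (simp only:)
  qed
  show ?thesis
  proof (induction rule: permutes_rev_induct[OF _ assms(1)])
    case (3 a b p)
    have "transpose a b = transpose b a" by (rule transpose_commute)
    moreover have "Q (p \<circ> transpose a (a + Suc (b - Suc a)))" if "a < b" using 3 that by (intro tr) auto
    moreover have "Q (p \<circ> transpose b (b + Suc (a - Suc b)))" if "b < a" using 3 that by (intro tr) auto
    ultimately show ?case using 3 by (cases "a < b") (auto simp: comp_def)
  qed (use id in \<open>auto simp: id_def\<close>)
qed

text \<open>Signature and Koszul sign with all degrees odd both change under each adjacent
  transposition.\<close>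

lemma sign_psgn:
  assumes "\<sigma> permutes {0..<n}"
  shows "of_int (sign \<sigma>) = psgn (koszul_exp (\<lambda>_. 1) \<sigma> n)"
  using assms
proof (induction \<sigma> rule: permutes_adjacent_induct)
  case (adjacent \<sigma> i)
  have "permutation \<sigma>" using adjacent(1) permutation_permutes finite_atLeastLessThan by blast
  then have "sign (\<sigma> \<circ> transpose i (Suc i)) = - sign \<sigma>"
    using sign_compose[OF _ permutation_swap_id, of \<sigma> i "Suc i"] by (simp add: sign_swap_id)
  then show ?case using koszul_exp_adjacent[OF adjacent(1,2), of "\<lambda>_. 1"] adjacent(3) by (auto simp: psgn_def comp_def)
qed (simp add: koszul_exp_id[unfolded id_def] psgn_def)

text \<open>Passes from exchange of neighbours to arbitrary permutations. The set \<open>W\<close>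
  lets the symmetry be assumed for well-formed entries only; permuting does not leave it.\<close>

lemma graded_symmetric_permute:
  assumes swap: "\<And>us x y vs. set (us @ x # y # vs) \<subseteq> W \<Longrightarrow>
      F (us @ x # y # vs) = pm (deg x * deg y) (F (us @ y # x # vs))"
    and "\<sigma> permutes {0..<length us}" "set us \<subseteq> W"
  shows "F (map (\<lambda>i. us ! \<sigma> i) [0..<length us]) = pm (koszul_exp (\<lambda>i. deg (us ! i)) \<sigma> (length us)) (F us)"
  using assms(2)
proof (induction \<sigma> rule: permutes_adjacent_induct)
  case id
  then show ?case by (simp add: koszul_exp_id[unfolded id_def] map_nth)
next
  case (adjacent \<sigma> i)
  let ?n = "length us" and ?t = "transpose i (Suc i)"
  let ?a = "map (\<lambda>j. us ! \<sigma> j) [0..<i]" and ?b = "map (\<lambda>j. us ! \<sigma> j) [Suc (Suc i)..<?n]"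
  have n: "[0..<?n] = [0..<i] @ i # Suc i # [Suc (Suc i)..<?n]"
    using adjacent(2) by (metis Suc_lessD add_0 less_imp_le upt_add_eq_append upt_conv_Cons le_add_diff_inverse zero_le)
  have l: "map (\<lambda>j. us ! \<sigma> j) [0..<?n] = ?a @ us ! \<sigma> i # us ! \<sigma> (Suc i) # ?b"
    unfolding n by simp
  have r: "map (\<lambda>j. us ! (\<sigma> \<circ> ?t) j) [0..<?n] = ?a @ us ! \<sigma> (Suc i) # us ! \<sigma> i # ?b"
    unfolding n by (auto simp: transpose_def)
  have "us ! \<sigma> j \<in> W" if "j < ?n" for j
    using permutes_in_image[OF adjacent(1), of j] that assms(3) by (auto simp: subset_iff)
  then have "set (?a @ us ! \<sigma> (Suc i) # us ! \<sigma> i # ?b) \<subseteq> W" using adjacent(2) by auto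
  from swap[OF this] have "F (map (\<lambda>j. us ! (\<sigma> \<circ> ?t) j) [0..<?n])
      = pm (deg (us ! \<sigma> (Suc i)) * deg (us ! \<sigma> i)) (F (map (\<lambda>j. us ! \<sigma> j) [0..<?n]))"
    unfolding l r .
  then show ?case unfolding adjacent(3) pm_pm
    using koszul_exp_adjacent[OF adjacent(1,2), of "\<lambda>i. deg (us ! i)"]
    by (simp only: comp_def) (rule pm_cong, simp add: algebra_simps)
qed

text \<open>The exponent of the Koszul sign of the shuffle whose first block has the values \<open>S\<close>.\<close>

definition subset_exp :: "(nat \<Rightarrow> int) \<Rightarrow> nat \<Rightarrow> nat set \<Rightarrow> int" where
  "subset_exp d n S = (\<Sum>a\<in>{..<n} - S. \<Sum>b\<in>{b\<in>S. a < b}. d a * d b)"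

section \<open>Splittings, subsets of positions and shuffles\<close>

lemma sum_list_nths:
  "S \<subseteq> {..<length xs} \<Longrightarrow> sum_list (map deg (nths xs S)) = (\<Sum>b\<in>S. deg (xs ! b) :: int)"
proof (induction xs arbitrary: S)
  case (Cons x xs)
  let ?T = "{j. Suc j \<in> S}"
  have T: "?T \<subseteq> {..<length xs}" using Cons.prems by auto
  have S: "S = (if 0 \<in> S then {0} else {}) \<union> Suc ` ?T" by (auto simp: image_iff) (metis not0_implies_Suc)+
  have fin: "finite ?T" using T finite_subset by blast
  have "(\<Sum>b\<in>S. deg ((x # xs) ! b)) = (if 0 \<in> S then deg x else 0) + (\<Sum>b\<in>Suc ` ?T. deg ((x # xs) ! b))"
    by (subst S, subst sum.union_disjoint) (use fin in auto)
  also have "(\<Sum>b\<in>Suc ` ?T. deg ((x # xs) ! b)) = (\<Sum>b\<in>?T. deg (xs ! b))"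
    by (subst sum.reindex) auto
  finally show ?case using Cons.IH[OF T] by (simp add: nths_Cons)
qed simp

text \<open>Nothing precedes position 0: if it belongs to the first block it creates no inversion,
  otherwise it forms one with every element of \<open>S\<close>. This is the recursion of
  \<open>ksum\<close>.\<close>

lemma subset_exp_Suc:
  assumes "S \<subseteq> {..<n}"
  shows "subset_exp d (Suc n) (insert 0 (Suc ` S)) = subset_exp (\<lambda>i. d (Suc i)) n S"
    and "subset_exp d (Suc n) (Suc ` S) = subset_exp (\<lambda>i. d (Suc i)) n S + d 0 * (\<Sum>b\<in>S. d (Suc b))"
proof -
  have inner: "(\<Sum>b\<in>{b. (b = 0 \<or> b \<in> Suc ` S) \<and> Suc a < b}. d (Suc a) * d b) = (\<Sum>b\<in>{b\<in>S. a < b}. d (Suc a) * d (Suc b))"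
    "(\<Sum>b\<in>{b \<in> Suc ` S. Suc a < b}. d (Suc a) * d b) = (\<Sum>b\<in>{b\<in>S. a < b}. d (Suc a) * d (Suc b))" for a
  proof -
    have "{b. (b = 0 \<or> b \<in> Suc ` S) \<and> Suc a < b} = Suc ` {b\<in>S. a < b}" "{b \<in> Suc ` S. Suc a < b} = Suc ` {b\<in>S. a < b}"
      by auto
    then show "(\<Sum>b\<in>{b. (b = 0 \<or> b \<in> Suc ` S) \<and> Suc a < b}. d (Suc a) * d b) = (\<Sum>b\<in>{b\<in>S. a < b}. d (Suc a) * d (Suc b))"
      "(\<Sum>b\<in>{b \<in> Suc ` S. Suc a < b}. d (Suc a) * d b) = (\<Sum>b\<in>{b\<in>S. a < b}. d (Suc a) * d (Suc b))"
      by (simp_all add: sum.reindex)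
  qed
  have "{..<Suc n} - insert 0 (Suc ` S) = Suc ` ({..<n} - S)"
    unfolding lessThan_Suc_eq_insert_0 by auto
  then show "subset_exp d (Suc n) (insert 0 (Suc ` S)) = subset_exp (\<lambda>i. d (Suc i)) n S"
    unfolding subset_exp_def by (simp add: sum.reindex inner)
  have "{..<Suc n} - (Suc ` S) = insert 0 (Suc ` ({..<n} - S))"
    unfolding lessThan_Suc_eq_insert_0 by auto
  then have "subset_exp d (Suc n) (Suc ` S) = (\<Sum>b\<in>{b\<in>Suc ` S. 0 < b}. d 0 * d b) + subset_exp (\<lambda>i. d (Suc i)) n S"
    unfolding subset_exp_def by (simp add: sum.reindex inner)
  also have "{b\<in>Suc ` S. 0 < b} = Suc ` S" by auto
  finally show "subset_exp d (Suc n) (Suc ` S) = subset_exp (\<lambda>i. d (Suc i)) n S + d 0 * (\<Sum>b\<in>S. d (Suc b))"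
    by (simp add: sum.reindex sum_distrib_left)
qed

text \<open>Each recursion step of \<open>ksum\<close> decides whether the first position belongs to
  \<open>S\<close>. This closed form is the bridge from the recursion to shuffles.\<close>

lemma ksum_subsets:
  "ksum deg xs \<Phi> = (\<Sum>S\<in>Pow {..<length xs}.
     pm (subset_exp (\<lambda>i. deg (xs ! i)) (length xs) S) (\<Phi> (nths xs S) (nths xs (- S))))"
proof (induction xs arbitrary: \<Phi>)
  case Nil
  then show ?case by (simp add: subset_exp_def)
next
  case (Cons x xs)
  let ?n = "length xs"
  let ?f = "\<lambda>S. pm (subset_exp (\<lambda>i. deg ((x # xs) ! i)) (Suc ?n) S) (\<Phi> (nths (x # xs) S) (nths (x # xs) (- S)))"
  have Pow: "Pow {..<Suc ?n} = (\<lambda>S. insert 0 (Suc ` S)) ` Pow {..<?n} \<union> (\<lambda>S. Suc ` S) ` Pow {..<?n}"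
  proof (intro equalityI subsetI)
    fix S assume S: "S \<in> Pow {..<Suc ?n}"
    let ?T = "{j. Suc j \<in> S}"
    have "S = (if 0 \<in> S then insert 0 (Suc ` ?T) else Suc ` ?T)"
      by (auto simp: image_iff) (metis not0_implies_Suc)+
    moreover have "?T \<in> Pow {..<?n}" using S by auto
    ultimately show "S \<in> (\<lambda>S. insert 0 (Suc ` S)) ` Pow {..<?n} \<union> (\<lambda>S. Suc ` S) ` Pow {..<?n}"
      by (metis (no_types, lifting) UnI1 UnI2 image_eqI)
  qed auto
  have shift: "{j. Suc j \<in> Suc ` S} = S" "{j. Suc j \<in> - Suc ` S} = - S" "{j. Suc j \<in> insert 0 (Suc ` S)} = S"
    "{j. Suc j \<in> - insert 0 (Suc ` S)} = - S" "{j. Suc j \<notin> Suc ` S} = - S" for S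
    by auto
  have inj: "inj_on (\<lambda>S. insert 0 (Suc ` S)) A" "inj_on (\<lambda>S. Suc ` S) A" for A
    by (rule inj_onI; metis shift)+
  have "sum ?f (Pow {..<Suc ?n}) = (\<Sum>S\<in>Pow {..<?n}. ?f (insert 0 (Suc ` S))) + (\<Sum>S\<in>Pow {..<?n}. ?f (Suc ` S))"
    unfolding Pow by (subst sum.union_disjoint) (auto simp: sum.reindex inj)
  also have "(\<Sum>S\<in>Pow {..<?n}. ?f (insert 0 (Suc ` S))) = ksum deg xs (\<lambda>as bs. \<Phi> (x # as) bs)"
    unfolding Cons.IH by (intro sum.cong refl) (auto simp: nths_Cons shift subset_exp_Suc comp_def)
  also have "(\<Sum>S\<in>Pow {..<?n}. ?f (Suc ` S)) = ksum deg xs (\<lambda>as bs. pm (deg x * sum_list (map deg as)) (\<Phi> as (x # bs)))"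
    unfolding Cons.IH by (intro sum.cong refl) (auto simp: nths_Cons shift subset_exp_Suc comp_def sum_list_nths pm_pm add_ac)
  finally show ?case by simp
qed

lemma nths_conv_map: "nths xs S = map ((!) xs) (nths [0..<length xs] S)"
  using nths_map[of "(!) xs" "[0..<length xs]" S] by (simp add: map_nth)

lemma set_nths_upt: "set (nths [0..<n] S) = S \<inter> {..<n}"
proof -
  have "{[0..<n] ! i |i. i < n \<and> i \<in> S} = {i |i. i < n \<and> i \<in> S}"
    by (metis (no_types, lifting) add_0 nth_upt)
  then show ?thesis by (auto simp: set_nths)
qed

text \<open>A strictly increasing list is determined by its set of entries; so a block of a shuffle
  is recovered from its image.\<close>

lemma increasing_image_nths:
  assumes "\<forall>i j. a \<le> i \<and> i < j \<and> j < b \<longrightarrow> \<sigma> i < \<sigma> j" and "\<sigma> ` {a..<b} = S \<inter> {..<n}"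
  shows "map \<sigma> [a..<b] = nths [0..<n] S"
proof (rule sorted_distinct_set_unique)
  show "set (map \<sigma> [a..<b]) = set (nths [0..<n] S)"
    using assms(2) by (simp add: set_nths_upt)
  show "sorted (map \<sigma> [a..<b])"
    using assms(1) by (auto simp: sorted_wrt_iff_nth_less intro!: less_imp_le)
  show "distinct (map \<sigma> [a..<b])"
    using assms(1) by (auto simp: distinct_map inj_on_def) (metis linorder_neqE_nat less_irrefl)
qed (auto intro: sorted_nths)

lemma shuffle_image:
  assumes "\<sigma> \<in> shuffles p q"
  defines "S \<equiv> \<sigma> ` {..<p}"
  shows "S \<subseteq> {..<p + q}" "card S = p" "\<sigma> ` {p..<p + q} = - S \<inter> {..<p + q}"
    "map \<sigma> [0..<p] = nths [0..<p + q] S" "map \<sigma> [p..<p + q] = nths [0..<p + q] (- S)"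
proof -
  have \<sigma>: "\<sigma> permutes {0..<p + q}" using assms by (simp add: shuffles_def)
  have im: "\<sigma> ` {0..<p + q} = {0..<p + q}" by (rule permutes_image[OF \<sigma>])
  show S: "S \<subseteq> {..<p + q}" using im by (auto simp: S_def)
  show "card S = p" unfolding S_def by (subst card_image) (auto intro: inj_on_subset[OF permutes_inj[OF \<sigma>]])
  show 1: "\<sigma> ` {p..<p + q} = - S \<inter> {..<p + q}"
  proof -
    have "{p..<p + q} = {0..<p + q} - {..<p}" by auto
    then show ?thesis using image_set_diff[OF permutes_inj[OF \<sigma>], of "{0..<p + q}" "{..<p}"] im
      by (auto simp: S_def)
  qed
  show "map \<sigma> [0..<p] = nths [0..<p + q] S"
  proof (rule increasing_image_nths)
    show "\<sigma> ` {0..<p} = S \<inter> {..<p + q}" using S unfolding S_def lessThan_atLeast0 by blast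
  qed (use assms(1) in \<open>auto simp: shuffles_def\<close>)
  show "map \<sigma> [p..<p + q] = nths [0..<p + q] (- S)"
    using assms(1) 1 by (intro increasing_image_nths) (auto simp: shuffles_def)
qed

text \<open>The inverse lists the elements of \<open>S\<close> in increasing order, followed by
  those of its complement.\<close>

lemma bij_shuffles: "bij_betw (\<lambda>\<sigma>. \<sigma> ` {..<p}) (shuffles p q) {S. S \<subseteq> {..<p + q} \<and> card S = p}"
proof (rule bij_betw_imageI)
  show "inj_on (\<lambda>\<sigma>. \<sigma> ` {..<p}) (shuffles p q)"
  proof (rule inj_onI)
    fix \<sigma> \<tau> assume *: "\<sigma> \<in> shuffles p q" "\<tau> \<in> shuffles p q" "\<sigma> ` {..<p} = \<tau> ` {..<p}"
    then have "map \<sigma> [0..<p] = map \<tau> [0..<p]" "map \<sigma> [p..<p + q] = map \<tau> [p..<p + q]"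
      using shuffle_image(4,5) by metis+
    then have "\<sigma> i = \<tau> i" if "i < p + q" for i
      using that by (cases "i < p") auto
    moreover have "\<sigma> i = \<tau> i" if "\<not> i < p + q" for i
      using * that by (auto simp: shuffles_def permutes_def)
    ultimately show "\<sigma> = \<tau>" by blast
  qed
  have "S \<in> (\<lambda>\<sigma>. \<sigma> ` {..<p}) ` shuffles p q" if S: "S \<subseteq> {..<p + q}" "card S = p" for S
  proof -
    let ?n = "p + q"
    define xs where "xs = nths [0..<?n] S"
    define ys where "ys = nths [0..<?n] (- S)"
    \<comment> \<open>Outside the range the permutation has to be the identity, as
      \<open>permutes\<close> demands.\<close>
    define \<sigma> where "\<sigma> i = (if i < ?n then (xs @ ys) ! i else i)" for i
    have set: "set xs = S" "set ys = {..<?n} - S" using S by (auto simp: xs_def ys_def set_nths_upt)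
    have d: "distinct xs" "distinct ys" "sorted xs" "sorted ys"
      by (auto simp: xs_def ys_def intro: sorted_nths)
    then have len: "length xs = p" "length ys = q"
      using S distinct_card[of xs] distinct_card[of ys] set card_Diff_subset[of S "{..<?n}"] finite_subset[OF S(1)]
      by auto
    have "bij_betw ((!) (xs @ ys)) {..<length (xs @ ys)} (set (xs @ ys))"
      using d set by (intro bij_betw_nth) auto
    moreover have "set (xs @ ys) = {..<?n}" using set S by auto
    ultimately have "bij_betw \<sigma> {0..<?n} {0..<?n}"
      using len by (subst bij_betw_cong[of _ _ "(!) (xs @ ys)"]) (auto simp: \<sigma>_def lessThan_atLeast0)
    then have "\<sigma> permutes {0..<?n}" by (rule bij_imp_permutes) (auto simp: \<sigma>_def)
    moreover have "\<sigma> i < \<sigma> j" if "i < j" "j < p" for i j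
      using that d len by (auto simp: \<sigma>_def nth_append intro!: sorted_wrt_nth_less[of "(<)"] simp: strict_sorted_iff)
    moreover have "\<sigma> i < \<sigma> j" if "p \<le> i" "i < j" "j < p + q" for i j
      using that d len by (auto simp: \<sigma>_def nth_append intro!: sorted_wrt_nth_less[of "(<)"] simp: strict_sorted_iff)
    ultimately have "\<sigma> \<in> shuffles p q" by (auto simp: shuffles_def)
    moreover have "\<sigma> ` {..<p} = S"
      using len set(1) by (auto simp: \<sigma>_def nth_append in_set_conv_nth image_iff)
    ultimately show ?thesis by blast
  qed
  then show "(\<lambda>\<sigma>. \<sigma> ` {..<p}) ` shuffles p q = {S. S \<subseteq> {..<p + q} \<and> card S = p}"
  proof (intro equalityI subsetI)
    fix S assume "S \<in> (\<lambda>\<sigma>. \<sigma> ` {..<p}) ` shuffles p q"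
    then obtain \<sigma> where "\<sigma> \<in> shuffles p q" "S = \<sigma> ` {..<p}" by blast
    then show "S \<in> {S. S \<subseteq> {..<p + q} \<and> card S = p}" using shuffle_image(1,2) by simp
  qed simp
qed

text \<open>A shuffle is monotone on each block, so an inversion \<open>(i, j)\<close> has
  \<open>i\<close> in the first block and \<open>j\<close> in the second. It corresponds to the pair
  of values \<open>(\<sigma> j, \<sigma> i)\<close>, the smaller outside the image of the first
  block and the larger inside.\<close>

lemma koszul_exp_shuffle:
  assumes "\<sigma> \<in> shuffles p q"
  shows "koszul_exp d \<sigma> (p + q) = subset_exp d (p + q) (\<sigma> ` {..<p})"
proof -
  let ?S = "\<sigma> ` {..<p}" and ?n = "p + q"
  note im = shuffle_image[OF assms]
  have \<sigma>: "\<sigma> permutes {0..<?n}" using assms by (simp add: shuffles_def)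
  note inj = injD[OF permutes_inj[OF \<sigma>]]
  have inv: "inversions \<sigma> ?n = {(i, j). i < p \<and> p \<le> j \<and> j < ?n \<and> \<sigma> j < \<sigma> i}"
  proof -
    have "i < p \<and> p \<le> j" if "i < j" "j < ?n" "\<sigma> j < \<sigma> i" for i j
    proof (rule ccontr)
      assume "\<not> (i < p \<and> p \<le> j)"
      then consider "j < p" | "p \<le> i" using \<open>i < j\<close> by linarith
      then have "\<sigma> i < \<sigma> j" using assms that(1,2) unfolding shuffles_def by cases blast+
      then show False using that(3) by simp
    qed
    then show ?thesis unfolding inversions_def by fastforce
  qed
  have "koszul_exp d \<sigma> ?n = (\<Sum>(a, b)\<in>(\<lambda>(i, j). (\<sigma> j, \<sigma> i)) ` inversions \<sigma> ?n. d a * d b)"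
    unfolding koszul_exp_def
    by (subst sum.reindex) (auto simp: inj_on_def mult.commute intro!: sum.cong dest: inj)
  also have "(\<lambda>(i, j). (\<sigma> j, \<sigma> i)) ` inversions \<sigma> ?n = (SIGMA a:{..<?n} - ?S. {b\<in>?S. a < b})"
    (is "?L = ?R")
  proof (intro equalityI subsetI)
    fix x assume "x \<in> ?L"
    then obtain i j where x: "x = (\<sigma> j, \<sigma> i)" "i < p" "p \<le> j" "j < ?n" "\<sigma> j < \<sigma> i" unfolding inv by auto
    then have "\<sigma> j \<in> - ?S \<inter> {..<?n}" unfolding im(3)[symmetric] by auto
    then show "x \<in> ?R" using x by auto
  next
    fix x assume "x \<in> ?R"
    then obtain a b where x: "x = (a, b)" "a \<in> - ?S \<inter> {..<?n}" "b \<in> ?S" "a < b" by auto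
    from x(2) obtain j where "a = \<sigma> j" "p \<le> j" "j < ?n" unfolding im(3)[symmetric] by auto
    moreover from x(3) obtain i where "b = \<sigma> i" "i < p" by auto
    ultimately show "x \<in> ?L" unfolding inv using x by force
  qed
  also have "(\<Sum>(a, b)\<in>\<dots>. d a * d b) = subset_exp d ?n ?S"
    unfolding subset_exp_def by (subst sum.Sigma) auto
  finally show ?thesis .
qed

text \<open>The length guard picks out the subsets with \<open>p\<close> elements among all those
  that \<open>ksum\<close> runs over.\<close>

lemma sum_shuffles:
  assumes "length xs = p + q"
  shows "(\<Sum>\<sigma>\<in>shuffles p q. pm (koszul_exp (\<lambda>i. deg (xs ! i)) \<sigma> (p + q)) (\<Phi> (pick \<sigma> xs 0 p) (pick \<sigma> xs p (p + q))))
    = ksum deg xs (\<lambda>as bs. if length as = p then \<Phi> as bs else 0)"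
proof -
  let ?n = "p + q"
  let ?g = "\<lambda>S. pm (subset_exp (\<lambda>i. deg (xs ! i)) ?n S) (\<Phi> (nths xs S) (nths xs (- S)))"
  have pick: "pick \<sigma> xs a b = map ((!) xs) (map \<sigma> [a..<b])" for \<sigma> a b by (simp add: pick_def)
  have "(\<Sum>\<sigma>\<in>shuffles p q. pm (koszul_exp (\<lambda>i. deg (xs ! i)) \<sigma> ?n) (\<Phi> (pick \<sigma> xs 0 p) (pick \<sigma> xs p ?n)))
    = (\<Sum>\<sigma>\<in>shuffles p q. ?g (\<sigma> ` {..<p}))"
    by (intro sum.cong refl)
       (simp add: koszul_exp_shuffle pick shuffle_image(4,5) assms nths_conv_map[of xs])
  also have "\<dots> = sum ?g {S. S \<subseteq> {..<?n} \<and> card S = p}"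
    by (rule sum.reindex_bij_betw[OF bij_shuffles])
  also have "\<dots> = (\<Sum>S\<in>Pow {..<?n}. if card S = p then ?g S else 0)"
    by (subst sum.inter_filter[symmetric]) (auto simp: Pow_def)
  also have "\<dots> = (\<Sum>S\<in>Pow {..<?n}. pm (subset_exp (\<lambda>i. deg (xs ! i)) ?n S)
       (if length (nths xs S) = p then \<Phi> (nths xs S) (nths xs (- S)) else 0))"
  proof (intro sum.cong refl)
    fix S assume "S \<in> Pow {..<?n}"
    then have "{i. i < length xs \<and> i \<in> S} = S" using assms by auto
    then show "(if card S = p then ?g S else 0) = pm (subset_exp (\<lambda>i. deg (xs ! i)) ?n S)
       (if length (nths xs S) = p then \<Phi> (nths xs S) (nths xs (- S)) else 0)"
      by (simp add: length_nths)
  qed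
  finally show ?thesis unfolding ksum_subsets assms .
qed

text \<open>The sums in the definitions start at block size 1, whereas \<open>ksum\<close> also has
  the splitting with empty first block; the second assumption makes that extra term vanish.\<close>

lemma sum_all_shuffles:
  assumes "length xs = n" "\<And>bs. set bs = set xs \<Longrightarrow> \<Phi> [] bs = 0"
  shows "(\<Sum>p\<in>{1..n}. \<Sum>\<sigma>\<in>shuffles p (n - p). pm (koszul_exp (\<lambda>i. deg (xs ! i)) \<sigma> n)
      (\<Phi> (pick \<sigma> xs 0 p) (pick \<sigma> xs p n))) = ksum deg xs \<Phi>"
proof -
  have sum: "(\<Sum>p\<in>A. ksum deg xs (\<Psi> p)) = ksum deg xs (\<lambda>as bs. \<Sum>p\<in>A. \<Psi> p as bs)" if "finite A" for A :: "nat set" and \<Psi>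
    using that by (induction A rule: finite_induct) (simp_all add: ksum_add)
  have "(\<Sum>p\<in>{1..n}. \<Sum>\<sigma>\<in>shuffles p (n - p). pm (koszul_exp (\<lambda>i. deg (xs ! i)) \<sigma> n)
      (\<Phi> (pick \<sigma> xs 0 p) (pick \<sigma> xs p n)))
    = (\<Sum>p\<in>{1..n}. ksum deg xs (\<lambda>as bs. if length as = p then \<Phi> as bs else 0))"
    using sum_shuffles[of xs _ "n - _" deg \<Phi>] assms(1) by (intro sum.cong refl) auto
  also have "\<dots> = ksum deg xs (\<lambda>as bs. \<Sum>p\<in>{1..n}. if length as = p then \<Phi> as bs else 0)"
    by (rule sum) simp
  also have "\<dots> = ksum deg xs \<Phi>"
  proof (rule ksum_cong)
    fix as bs assume *: "mset as + mset bs = mset xs"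
    then have "set bs = set xs" if "as = []" using that by (metis add_0 mset.simps(1) set_mset_mset)
    moreover have "length as \<le> n" using * assms(1) by (metis size_mset size_union le_add1)
    ultimately show "(\<Sum>p\<in>{1..n}. if length as = p then \<Phi> as bs else 0) = \<Phi> as bs"
      using assms(2) by (cases as) auto
  qed
  finally show ?thesis .
qed

section \<open>The right pre-Lie identity\<close>

text \<open>The slot is given by its context and all lengths are treated at once, so that fixing the
  first argument leads again to a map of the same kind.\<close>

definition mlin :: "('k \<Rightarrow> 'a::ab_group_add \<Rightarrow> 'a) \<Rightarrow> ('k \<Rightarrow> 'b::ab_group_add \<Rightarrow> 'b) \<Rightarrow> ('a list \<Rightarrow> 'b) \<Rightarrow> bool" where
  "mlin sa sb f \<longleftrightarrow> (\<forall>us c y z vs. f (us @ (sa c y + z) # vs) = sb c (f (us @ y # vs)) + f (us @ z # vs))"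

definition skew :: "('a list \<Rightarrow> 'b::ab_group_add) \<Rightarrow> bool" where
  "skew f \<longleftrightarrow> (\<forall>us x y vs. f (us @ x # y # vs) = - f (us @ y # x # vs))"

text \<open>Integer-valued, so that contraction lowers it by one without truncation; the zero map
  has every arity, and for negative \<open>n\<close> no other map has arity
  \<open>n\<close>.\<close>

definition arity :: "int \<Rightarrow> ('a list \<Rightarrow> 'b::zero) \<Rightarrow> bool" where
  "arity n f \<longleftrightarrow> (\<forall>vs. f vs \<noteq> 0 \<longrightarrow> int (length vs) = n)"

definition contract :: "'a \<Rightarrow> ('a list \<Rightarrow> 'b) \<Rightarrow> 'a list \<Rightarrow> 'b" where
  "contract v f = (\<lambda>vs. f (v # vs))"

text \<open>Splittings with empty first block are included, so the product also makes sense for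
  \<open>g\<close> of arity 0, which arises by contraction.\<close>

definition circ :: "('a list \<Rightarrow> 'b::ab_group_add) \<Rightarrow> ('a list \<Rightarrow> 'a) \<Rightarrow> 'a list \<Rightarrow> 'b" where
  "circ f g vs = ksum (\<lambda>_. 1) vs (\<lambda>as bs. f (g as # bs))"

lemma mlinD: "mlin sa sb f \<Longrightarrow> f (us @ (sa c y + z) # vs) = sb c (f (us @ y # vs)) + f (us @ z # vs)"
  and mlinD0: "mlin sa sb f \<Longrightarrow> f ((sa c y + z) # vs) = sb c (f (y # vs)) + f (z # vs)"
  unfolding mlin_def by (blast, metis append_Nil)

lemma skewD: "skew f \<Longrightarrow> f (us @ x # y # vs) = - f (us @ y # x # vs)"
  and skewD0: "skew f \<Longrightarrow> f (x # y # vs) = - f (y # x # vs)"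
  unfolding skew_def by (blast, metis append_Nil)

lemma mlin_contract: "mlin sa sb f \<Longrightarrow> mlin sa sb (contract v f)"
  unfolding mlin_def contract_def by (metis append_Cons)

lemma skew_contract: "skew f \<Longrightarrow> skew (contract v f)"
  unfolding skew_def contract_def by (metis append_Cons)

lemma arity_contract: "arity n f \<Longrightarrow> arity (n - 1) (contract v f)"
  unfolding arity_def contract_def by fastforce

lemma arity_pm: "arity n f \<Longrightarrow> pm (int (length vs)) (f vs) = pm n (f vs)"
  by (cases "f vs = 0") (auto simp: arity_def)

lemma (in module) scale_pm: "scale c (pm d x) = pm d (scale c x)"
  by (simp add: pm_def)

locale mlin_space = A: vector_space sa + B: vector_space sb
  for sa :: "'k::field \<Rightarrow> 'a::ab_group_add \<Rightarrow> 'a" and sb :: "'k \<Rightarrow> 'b::ab_group_add \<Rightarrow> 'b"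
begin

lemma mlin_add: "mlin sa sb f \<Longrightarrow> f (us @ (y + z) # vs) = f (us @ y # vs) + f (us @ z # vs)"
  using mlinD[of sa sb f us 1 y z vs] by simp

lemma mlin_0: "mlin sa sb f \<Longrightarrow> f (us @ 0 # vs) = 0"
  using mlin_add[of f us 0 0 vs] by simp

lemma mlin_scale: "mlin sa sb f \<Longrightarrow> f (us @ sa c y # vs) = sb c (f (us @ y # vs))"
  using mlinD[of sa sb f us c y 0 vs] mlin_0[of f us vs] by simp

lemma mlin_minus: "mlin sa sb f \<Longrightarrow> f (us @ (- y) # vs) = - f (us @ y # vs)"
  using mlin_scale[of f us "-1" y vs] by simp

lemma mlin_pm: "mlin sa sb f \<Longrightarrow> f (us @ pm d y # vs) = pm d (f (us @ y # vs))"
  by (simp add: pm_def mlin_minus)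

lemma mlin_lin: "mlin sa sb f \<Longrightarrow> mlin sa sb g \<Longrightarrow> mlin sa sb (\<lambda>vs. sb c (f vs) + g vs)"
  unfolding mlin_def by (simp add: B.scale_right_distrib B.scale_left_commute add_ac)

lemma skew_lin: "skew f \<Longrightarrow> skew g \<Longrightarrow> skew (\<lambda>vs. sb c (f vs) + g vs)"
  unfolding skew_def by (metis (no_types, lifting) B.scale_minus_right add.commute minus_add)

lemma circ_linl: "circ (\<lambda>vs. sb c (f vs) + h vs) g vs = sb c (circ f g vs) + circ h g vs"
  unfolding circ_def ksum_add
  by (subst additive_ksum[of "sb c"]) (simp_all add: B.scale_right_distrib)

end

locale mlin_space1 = mlin_space s s for s :: "'k::field \<Rightarrow> 'v::ab_group_add \<Rightarrow> 'v"
begin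

lemmas mlin_add0 = mlin_add[of _ "[]", simplified]
  and mlin_pm0 = mlin_pm[of _ "[]", simplified]
  and mlin_00 = mlin_0[of _ "[]", simplified]
  and mlin_minus0 = mlin_minus[of _ "[]", simplified]

lemma circ_linr:
  assumes "mlin s s f"
  shows "circ f (\<lambda>vs. s c (g vs) + h vs) vs = s c (circ f g vs) + circ f h vs"
  unfolding circ_def mlinD0[OF assms] ksum_add
  by (subst additive_ksum[of "s c"]) (simp_all add: A.scale_right_distrib)

lemma circ_minusr: "mlin s s f \<Longrightarrow> circ f (\<lambda>vs. - g vs) vs = - circ f g vs"
  by (simp add: circ_def mlin_minus0 ksum_minus)

lemma circ_pmr: "mlin s s f \<Longrightarrow> circ f (\<lambda>vs. pm d (g vs)) vs = pm d (circ f g vs)"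
  by (simp add: circ_def mlin_pm0 ksum_pm)

lemma circ_addr: "mlin s s f \<Longrightarrow> circ f (\<lambda>vs. g vs + h vs) vs = circ f g vs + circ f h vs"
  by (simp add: circ_def mlin_add0 ksum_add)

lemma circ_diffr: "mlin s s f \<Longrightarrow> circ f (\<lambda>vs. g vs - h vs) vs = circ f g vs - circ f h vs"
  using circ_addr[of f g "\<lambda>vs. - h vs" vs] by (simp add: circ_minusr)

lemma circ_pml: "circ (\<lambda>vs. pm d (f vs)) g vs = pm d (circ f g vs)"
  by (simp add: circ_def ksum_pm)

lemma circ_diffl: "circ (\<lambda>vs. f vs - h vs) g vs = circ f g vs - circ h g vs"
  by (simp add: circ_def ksum_diff)

text \<open>The argument \<open>v\<close> is fed either to \<open>g\<close> or directly to
  \<open>f\<close>. In the second case it has passed the arguments of \<open>g\<close> and stands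
  behind the value of \<open>g\<close>; skew symmetry of \<open>f\<close> moves it to the front at
  the cost of one more sign.\<close>

lemma circ_Cons':
  assumes f: "mlin s s f" "skew f"
  shows "circ f g (v # vs) = circ f (contract v g) vs
     - circ (contract v f) (\<lambda>as. pm (int (length as)) (g as)) vs"
proof -
  have len: "sum_list (map (\<lambda>_. 1) as) = int (length as)" for as :: "'v list"
    by (induction as) auto
  have "pm (int (length as)) (f (g as # v # bs))
      = - f (v # pm (int (length as)) (g as) # bs)" for as bs
    using skewD0[OF f(2), of "g as" v bs] mlin_pm[OF f(1), of "[v]" "int (length as)" "g as" bs]
    by (simp add: pm_minus)
  then show ?thesis
    by (simp add: circ_def contract_def len ksum_minus)
qed

lemma circ_Cons:
  assumes "mlin s s f" "skew f" "arity n g"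
  shows "circ f g (v # vs) = circ f (contract v g) vs - pm n (circ (contract v f) g vs)"
  unfolding circ_Cons'[OF assms(1,2)] arity_pm[OF assms(3)]
  by (simp add: circ_pmr mlin_contract assms)

lemma contract_circ:
  assumes "mlin s s f" "skew f" "arity n g"
  shows "contract v (circ f g) = (\<lambda>vs. circ f (contract v g) vs - pm n (circ (contract v f) g vs))"
  unfolding contract_def[of v "circ f g"] using circ_Cons[OF assms] by (simp add: fun_eq_iff)

text \<open>Contraction absorbs the entries in front of the slot into \<open>f\<close> or
  \<open>g\<close>, so only a slot in first position has to be computed. This needs
  \<open>f\<close>, \<open>g\<close> and the arity of \<open>g\<close> general in the
  induction.\<close>

lemma mlin_circ:
  assumes "mlin s s f" "skew f" "mlin s s g" "arity n g"
  shows "mlin s s (circ f g)"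
proof -
  have "circ f g (us @ (s c y + z) # vs) = s c (circ f g (us @ y # vs)) + circ f g (us @ z # vs)"
    for us c y z vs
    using assms
  proof (induction us arbitrary: f g n)
    case Nil
    have "contract (s c y + z) g = (\<lambda>vs. s c (contract y g vs) + contract z g vs)"
         "contract (s c y + z) f = (\<lambda>vs. s c (contract y f vs) + contract z f vs)"
      using Nil by (simp_all add: contract_def mlinD0 fun_eq_iff)
    then show ?case using Nil
      by (simp add: circ_Cons circ_linr circ_linl A.scale_right_diff_distrib A.scale_pm pm_add)
  next
    case (Cons u us)
    have 1: "circ f (contract u g) (us @ (s c y + z) # vs)
      = s c (circ f (contract u g) (us @ y # vs)) + circ f (contract u g) (us @ z # vs)"
      using Cons.prems by (intro Cons.IH[of _ _ "n - 1"]) (auto intro: mlin_contract arity_contract)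
    have 2: "circ (contract u f) g (us @ (s c y + z) # vs)
      = s c (circ (contract u f) g (us @ y # vs)) + circ (contract u f) g (us @ z # vs)"
      using Cons.prems by (intro Cons.IH[of _ _ "n"]) (auto intro: mlin_contract skew_contract)
    show ?case using Cons.prems
      by (simp add: circ_Cons 1 2 A.scale_right_diff_distrib A.scale_pm pm_add)
  qed
  then show ?thesis unfolding mlin_def by blast
qed

lemma skew_circ:
  assumes "mlin s s f" "skew f" "skew g" "arity n g"
  shows "skew (circ f g)"
proof -
  have "circ f g (us @ x # y # vs) = - circ f g (us @ y # x # vs)" for us x y vs
    using assms
  proof (induction us arbitrary: f g n)
    case Nil
    have 1: "contract x (contract y g) = (\<lambda>vs. - contract y (contract x g) vs)"
         "contract x (contract y f) = (\<lambda>vs. - contract y (contract x f) vs)" for x y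
      using Nil by (auto simp: contract_def intro: skewD0)
    have 2: "circ f g (x # y # vs) = circ f (contract y (contract x g)) vs
      - pm (n - 1) (circ (contract y f) (contract x g) vs) - pm n (circ (contract x f) (contract y g) vs)
      + circ (contract y (contract x f)) g vs" for x y
      using Nil arity_contract[OF Nil(4)]
      by (simp add: circ_Cons[of _ "n - 1"] circ_Cons[of _ n] mlin_contract skew_contract pm_diff pm_pm)
         (simp add: pm_def)
    \<comment> \<open>The arity of \<open>g\<close> drops after one contraction, so the two terms in
      which \<open>x\<close> and \<open>y\<close> are separated carry opposite signs and are
      exchanged up to sign by swapping \<open>x\<close> and \<open>y\<close>.\<close>
    have 3: "pm (n - 1) z = - pm n z" for z :: 'v by (simp add: pm_def)
    have 4: "circ (\<lambda>vs. - f vs) g vs = - circ f g vs" for f g :: "'v list \<Rightarrow> 'v" and vs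
      by (simp add: circ_def ksum_minus)
    show ?case
      unfolding append_Nil 2 1[of y x] 3 using Nil by (simp add: circ_minusr 4)
  next
    case (Cons u us)
    have 1: "circ f (contract u g) (us @ x # y # vs) = - circ f (contract u g) (us @ y # x # vs)"
      using Cons.prems by (intro Cons.IH[of _ _ "n - 1"]) (auto intro: skew_contract arity_contract)
    have 2: "circ (contract u f) g (us @ x # y # vs) = - circ (contract u f) g (us @ y # x # vs)"
      using Cons.prems by (intro Cons.IH[of _ _ "n"]) (auto intro: mlin_contract skew_contract)
    show ?case using Cons.prems by (simp add: circ_Cons 1 2 pm_minus)
  qed
  then show ?thesis unfolding skew_def by blast
qed

lemma arity_circ:
  assumes "mlin s s f" "arity m f" "arity n g"
  shows "arity (m + n - 1) (circ f g)"
  unfolding arity_def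
proof (intro allI impI, rule ccontr)
  fix vs assume *: "circ f g vs \<noteq> 0" "int (length vs) \<noteq> m + n - 1"
  have "circ f g vs = 0" unfolding circ_def
  proof (rule ksum_zeroI)
    fix as bs assume "mset as + mset bs = mset vs"
    then have "length vs = length as + length bs" by (metis size_mset size_union)
    then have "int (length as) \<noteq> n \<or> int (length (g as # bs)) \<noteq> m" using *(2) by auto
    then show "f (g as # bs) = 0"
    proof
      assume "int (length as) \<noteq> n"
      then have "g as = 0" using assms(3) by (auto simp: arity_def)
      then show ?thesis using assms(1) by (simp add: mlin_00)
    qed (use assms(2) in \<open>auto simp: arity_def\<close>)
  qed
  with * show False by simp
qed

lemma circ_Nil: "circ f g [] = f [g []]"
  by (simp add: circ_def)

definition assoc :: "('v list \<Rightarrow> 'v) \<Rightarrow> ('v list \<Rightarrow> 'v) \<Rightarrow> ('v list \<Rightarrow> 'v) \<Rightarrow> 'v list \<Rightarrow> 'v" where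
  "assoc f g h vs = circ (circ f g) h vs - circ f (circ g h) vs"

text \<open>Contraction acts on both bracketings of the triple product with the same signs, since
  \<open>circ g h\<close> has arity \<open>n + p - 1\<close> and the shift by one is compensated by
  the sign in \<open>circ_Cons\<close>. So the associator itself satisfies a recursion.\<close>

lemma assoc_Cons:
  assumes "mlin s s f" "skew f" "mlin s s g" "skew g" "arity n g" "mlin s s h" "skew h" "arity p h"
  shows "assoc f g h (v # vs) = assoc f g (contract v h) vs - pm p (assoc f (contract v g) h vs)
    + pm (n + p) (assoc (contract v f) g h vs)"
proof -
  note c = mlin_circ[OF assms(1-3,5)] skew_circ[OF assms(1,2,4,5)] arity_circ[OF assms(3,5,8)]
    mlin_contract skew_contract
  have 1: "circ (circ f g) h (v # vs) = circ (circ f g) (contract v h) vs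
     - pm p (circ (circ f (contract v g)) h vs) + pm (n + p) (circ (circ (contract v f) g) h vs)"
    using assms c
    by (simp add: circ_Cons[of _ p] contract_circ[of f n g] circ_diffl circ_pml pm_diff pm_pm add.commute)
  have 2: "circ f (circ g h) (v # vs) = circ f (circ g (contract v h)) vs
     - pm p (circ f (circ (contract v g) h) vs) + pm (n + p) (circ (contract v f) (circ g h) vs)"
    using assms c
    by (simp add: circ_Cons[of _ "n + p - 1"] contract_circ[of g p h] circ_diffr circ_pmr pm_diff pm_pm add.commute)
       (simp add: pm_def)
  show ?thesis unfolding assoc_def 1 2 by (simp add: pm_diff algebra_simps)
qed

text \<open>Contracting with the first argument turns the right pre-Lie identity in total arity \<open>N\<close> into
  three instances of it in total arity \<open>N - 1\<close>; arity \<open>0\<close> has to be allowed for this to close up.\<close>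

lemma pre_Lie:
  assumes "mlin s s f" "skew f" "mlin s s g" "skew g" "arity n g" "mlin s s h" "skew h" "arity p h"
  shows "assoc f g h vs = pm ((n - 1) * (p - 1)) (assoc f h g vs)"
  using assms
proof (induction vs arbitrary: f g h n p)
  case Nil
  have "circ f g [h []] = f (g [h []] # []) - pm n (f [h [], g []])"
    using Nil by (simp add: circ_Cons circ_Nil contract_def)
  moreover have "circ f h [g []] = f (h [g []] # []) - pm p (f [g [], h []])"
    using Nil by (simp add: circ_Cons circ_Nil contract_def)
  moreover have "f [h [], g []] = - f [g [], h []]"
    by (rule skewD0) (rule Nil)
  \<comment> \<open>The only term left on the empty list is \<open>f [h [], g []]\<close>, up to
    sign. It can be nonzero only for \<open>n = p = 0\<close>, where the exponent
    \<open>(n - 1) * (p - 1)\<close> is 1 and agrees with the skew symmetry of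
    \<open>f\<close>.\<close>
  moreover have "g [] = 0 \<or> n = 0" "h [] = 0 \<or> p = 0"
    using Nil unfolding arity_def by fastforce+
  ultimately show ?case
    using mlin_0[OF Nil(1), of "[]"] mlin_0[OF Nil(1), of "[_]"]
    by (auto simp: assoc_def circ_Nil pm_minus)
next
  case (Cons v vs)
  note p = mlin_contract skew_contract arity_contract
  have 1: "assoc f g (contract v h) vs = pm ((n - 1) * (p - 2)) (assoc f (contract v h) g vs)"
    using Cons.IH[of f g n "contract v h" "p - 1"] Cons.prems by (simp add: p)
  have 2: "assoc f (contract v g) h vs = pm ((n - 2) * (p - 1)) (assoc f h (contract v g) vs)"
    using Cons.IH[of f "contract v g" "n - 1" h p] Cons.prems by (simp add: p)
  have 3: "assoc (contract v f) g h vs = pm ((n - 1) * (p - 1)) (assoc (contract v f) h g vs)"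
    using Cons.IH[of "contract v f" g n h p] Cons.prems by (simp add: p)
  have 4: "pm ((n - 1) * (p - 2)) x = - pm ((n - 1) * (p - 1) + n) x"
    "pm (p + (n - 2) * (p - 1)) x = - pm ((n - 1) * (p - 1)) x" for x :: 'v
    by (auto simp: pm_def)
  show ?case
    using Cons.prems
    by (simp add: assoc_Cons[of f g n h p] assoc_Cons[of f h p g n] 1 2 3 pm_diff pm_add pm_pm 4 add_ac)
qed

text \<open>The degrees are parameters instead of being read off from \<open>f\<close> and
  \<open>g\<close>, so that zero maps need no separate treatment.\<close>

definition brk :: "int \<Rightarrow> int \<Rightarrow> ('v list \<Rightarrow> 'v) \<Rightarrow> ('v list \<Rightarrow> 'v) \<Rightarrow> 'v list \<Rightarrow> 'v" where
  "brk d e f g = (\<lambda>vs. circ f g vs - pm (d * e) (circ g f vs))"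

text \<open>The usual derivation from a pre-Lie product: expanding the brackets leaves compositions
  nested to the right, which cancel, and associators, which cancel in pairs by their graded
  symmetry.\<close>

lemma brk_jacobi:
  assumes f: "mlin s s f" "skew f" "arity (d + 1) f" and g: "mlin s s g" "skew g" "arity (e + 1) g"
    and h: "mlin s s h" "skew h" "arity (k + 1) h"
  shows "brk (d + e) k (brk d e f g) h
    = brk d (e + k) f (brk e k g h) + pm (e * k) (brk (d + k) e (brk d k f h) g)"
proof
  fix vs
  note l = circ_diffl circ_diffr circ_pml circ_pmr pm_diff pm_pm
  have 1: "assoc f g h vs = pm (e * k) (assoc f h g vs)" "assoc g f h vs = pm (d * k) (assoc g h f vs)"
    "assoc h f g vs = pm (d * e) (assoc h g f vs)"
    using pre_Lie[OF f(1,2) g h, of vs] pre_Lie[OF g(1,2) f h, of vs] pre_Lie[OF h(1,2) f g, of vs]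
    by simp_all
  \<comment> \<open>Every composition nested to the left becomes one nested to the right plus one of
    three chosen associators, those ending in \<open>h g\<close>, \<open>h f\<close> and
    \<open>g f\<close>.\<close>
  have 2: "circ (circ f g) h vs = circ f (circ g h) vs + pm (e * k) (assoc f h g vs)"
    "circ (circ g f) h vs = circ g (circ f h) vs + pm (d * k) (assoc g h f vs)"
    "circ (circ h f) g vs = circ h (circ f g) vs + pm (d * e) (assoc h g f vs)"
    "circ (circ f h) g vs = circ f (circ h g) vs + assoc f h g vs"
    "circ (circ g h) f vs = circ g (circ h f) vs + assoc g h f vs"
    "circ (circ h g) f vs = circ h (circ g f) vs + assoc h g f vs"
    using 1 unfolding assoc_def by (simp_all add: algebra_simps)
  show "brk (d + e) k (brk d e f g) h vs
    = (brk d (e + k) f (brk e k g h) + pm (e * k) (brk (d + k) e (brk d k f h) g)) vs"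
    unfolding brk_def plus_fun_apply pm_fun using f g h
    apply (simp add: l)
    apply (simp add: 2 pm_add pm_pm)
    apply (cases "even d"; cases "even e"; cases "even k"; simp add: pm_def)
    done
qed

end

section \<open>The \<open>L\<^sub>\<infinity>\<close>-identities from V-data\<close>

text \<open>\<open>(True, d, f, 0)\<close> stands for \<open>s\<^sup>-\<^sup>1 f\<close> and \<open>(False, d, 0, \<theta>)\<close> for \<open>\<theta>\<close>. The degree \<open>d\<close> is the one in
  \<open>s\<^sup>-\<^sup>1 L \<oplus> F\<close>, so that \<open>f\<close> has degree \<open>d + 1\<close> in \<open>L\<close>.\<close>

type_synonym ('a, 'b) tagged = "bool \<times> int \<times> 'a \<times> 'b"

abbreviation isL :: "('a, 'b) tagged \<Rightarrow> bool" where "isL u \<equiv> fst u"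
abbreviation dg :: "('a, 'b) tagged \<Rightarrow> int" where "dg u \<equiv> fst (snd u)"
abbreviation vL :: "('a, 'b) tagged \<Rightarrow> 'a" where "vL u \<equiv> fst (snd (snd u))"
abbreviation vF :: "('a, 'b) tagged \<Rightarrow> 'b" where "vF u \<equiv> snd (snd (snd u))"
abbreviation dgs :: "('a, 'b) tagged list \<Rightarrow> int" where "dgs us \<equiv> sum_list (map (\<lambda>u. fst (snd u)) us)"
abbreviation noL :: "('a, 'b) tagged list \<Rightarrow> bool" where "noL us \<equiv> (\<forall>u\<in>set us. \<not> isL u)"

lemma one_filterE:
  assumes "length (filter p us) = 1"
  obtains as t bs where "us = as @ t # bs" "p t" "\<forall>u\<in>set as. \<not> p u" "\<forall>u\<in>set bs. \<not> p u"
proof -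
  obtain t where "filter p us = [t]" using assms by (auto simp: length_Suc_conv)
  then obtain as bs where "us = as @ t # bs" "\<forall>u\<in>set as. \<not> p u" "p t" "[] = filter p bs"
    unfolding filter_eq_Cons_iff by blast
  then show ?thesis using that[of as t bs] filter_empty_conv[of p bs] by simp
qed

text \<open>Voronov's V-data with vanishing curvature: \<open>G\<close> is the grading of the Lie algebra \<open>L\<close>, and the
  abelian subalgebra \<open>F\<close> is given abstractly, graded by \<open>H\<close>, embedded by \<open>\<iota>\<close> and projected to by \<open>P\<close>.
  The assumption \<open>P_br\<close> expresses that the kernel of \<open>P\<close> is a subalgebra.\<close>

locale vdata = A: vector_space sA + B: vector_space sB
  for sA :: "'k::field \<Rightarrow> 'a::ab_group_add \<Rightarrow> 'a" and sB :: "'k \<Rightarrow> 'b::ab_group_add \<Rightarrow> 'b" +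
  fixes G :: "int \<Rightarrow> 'a set" and H :: "int \<Rightarrow> 'b set"
    and br :: "'a \<Rightarrow> 'a \<Rightarrow> 'a" and P :: "'a \<Rightarrow> 'b" and \<iota> :: "'b \<Rightarrow> 'a"
  assumes G_0: "0 \<in> G d" and G_lin: "x \<in> G d \<Longrightarrow> y \<in> G d \<Longrightarrow> sA c x + y \<in> G d"
    and H_0: "0 \<in> H d" and H_lin: "\<theta> \<in> H d \<Longrightarrow> \<eta> \<in> H d \<Longrightarrow> sB c \<theta> + \<eta> \<in> H d"
    and br_G: "x \<in> G m \<Longrightarrow> y \<in> G n \<Longrightarrow> br x y \<in> G (m + n)"
    and br_lin: "x \<in> G m \<Longrightarrow> y \<in> G m \<Longrightarrow> z \<in> G n \<Longrightarrow> br (sA c x + y) z = sA c (br x z) + br y z"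
    and br_skew: "x \<in> G m \<Longrightarrow> y \<in> G n \<Longrightarrow> br x y = - pm (m * n) (br y x)"
    and jacobi: "x \<in> G l \<Longrightarrow> y \<in> G m \<Longrightarrow> z \<in> G n \<Longrightarrow>
      br (br x y) z = br x (br y z) + pm (m * n) (br (br x z) y)"
    and P_H: "x \<in> G d \<Longrightarrow> P x \<in> H d"
    and P_lin: "x \<in> G d \<Longrightarrow> y \<in> G d \<Longrightarrow> P (sA c x + y) = sB c (P x) + P y"
    and \<iota>_G: "\<theta> \<in> H d \<Longrightarrow> \<iota> \<theta> \<in> G d"
    and \<iota>_lin: "\<theta> \<in> H d \<Longrightarrow> \<eta> \<in> H d \<Longrightarrow> \<iota> (sB c \<theta> + \<eta>) = sA c (\<iota> \<theta>) + \<iota> \<eta>"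
    and \<iota>_abelian: "\<theta> \<in> H m \<Longrightarrow> \<eta> \<in> H n \<Longrightarrow> br (\<iota> \<theta>) (\<iota> \<eta>) = 0"
    and P_br: "x \<in> G m \<Longrightarrow> y \<in> G n \<Longrightarrow> P (br x y) = P (br (\<iota> (P x)) y) + P (br x (\<iota> (P y)))"
begin

section \<open>Linearity of the bracket, the projection and the embedding\<close>

lemma G_scale: "x \<in> G d \<Longrightarrow> sA c x \<in> G d"
  and G_add: "x \<in> G d \<Longrightarrow> y \<in> G d \<Longrightarrow> x + y \<in> G d"
  using G_lin[of x d 0 c] G_lin[of x d y 1] G_0 by auto

lemma H_scale: "x \<in> H d \<Longrightarrow> sB c x \<in> H d"
  and H_add: "x \<in> H d \<Longrightarrow> y \<in> H d \<Longrightarrow> x + y \<in> H d"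
  using H_lin[of x d 0 c] H_lin[of x d y 1] H_0 by auto

lemma pm_scale: "pm d x = sA (if even d then 1 else -1) x"
  and pm_scaleB: "pm d y = sB (if even d then 1 else -1) y"
  by (simp_all add: pm_def)

lemma G_pm: "x \<in> G d \<Longrightarrow> pm e x \<in> G d"
  by (simp only: pm_scale G_scale)

lemma H_pm: "x \<in> H d \<Longrightarrow> pm e x \<in> H d"
  by (simp only: pm_scaleB H_scale)

lemma br_0: "z \<in> G n \<Longrightarrow> br 0 z = 0"
  using br_lin[of 0 0 0 z n 1] G_0 by simp

lemma br_scale: "x \<in> G m \<Longrightarrow> z \<in> G n \<Longrightarrow> br (sA c x) z = sA c (br x z)"
  using br_lin[of x m 0 z n c] G_0 br_0 by simp

lemma br_pm: "x \<in> G m \<Longrightarrow> z \<in> G n \<Longrightarrow> br (pm e x) z = pm e (br x z)"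
  unfolding pm_scale by (rule br_scale)

lemma br_0r: "z \<in> G n \<Longrightarrow> br z 0 = 0"
  using br_skew[of z n 0 0] br_0[of z n] G_0 by simp

lemma br_linr: "x \<in> G m \<Longrightarrow> y \<in> G m \<Longrightarrow> z \<in> G n \<Longrightarrow> br z (sA c x + y) = sA c (br z x) + br z y"
  by (simp add: br_skew[of z n _ m] G_lin br_lin pm_add A.scale_pm A.scale_minus_right)

lemma P_0: "P 0 = 0" using P_lin[of 0 0 0 1] G_0 by simp
lemma P_add: "x \<in> G d \<Longrightarrow> y \<in> G d \<Longrightarrow> P (x + y) = P x + P y"
  using P_lin[of x d y 1] by simp

lemma P_pm: "x \<in> G d \<Longrightarrow> P (pm e x) = pm e (P x)"
  unfolding pm_scale pm_scaleB using P_lin[of x d 0 _] G_0 P_0 by simp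

definition scaleP :: "'k \<Rightarrow> 'a \<times> 'b \<Rightarrow> 'a \<times> 'b" where
  "scaleP c x = (sA c (fst x), sB c (snd x))"

definition tagged_ok :: "('a, 'b) tagged \<Rightarrow> bool" where
  "tagged_ok u \<longleftrightarrow> (if isL u then vL u \<in> G (dg u + 1) \<and> vF u = 0 else vL u = 0 \<and> vF u \<in> H (dg u))"

abbreviation wfs :: "('a, 'b) tagged list \<Rightarrow> bool" where "wfs us \<equiv> (\<forall>u\<in>set us. tagged_ok u)"
abbreviation Fwf :: "('a, 'b) tagged list \<Rightarrow> bool" where "Fwf us \<equiv> (\<forall>u\<in>set us. \<not> isL u \<and> tagged_ok u)"

lemma Fwf_G: "\<not> isL u \<Longrightarrow> tagged_ok u \<Longrightarrow> \<iota> (vF u) \<in> G (dg u)"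
  by (simp add: tagged_ok_def \<iota>_G)

section \<open>Iterated brackets with elements of F and the operations built from them\<close>

definition ad :: "'a \<Rightarrow> ('a, 'b) tagged list \<Rightarrow> 'a" where
  "ad = foldl (\<lambda>x u. br x (\<iota> (vF u)))"

lemma ad_Nil [simp]: "ad f [] = f"
  and ad_Cons [simp]: "ad f (u # us) = ad (br f (\<iota> (vF u))) us"
  and ad_append [simp]: "ad f (us @ vs) = ad (ad f us) vs"
  by (simp_all add: ad_def)

lemma ad_G: "f \<in> G d \<Longrightarrow> Fwf us \<Longrightarrow> ad f us \<in> G (d + dgs us)"
proof (induction us arbitrary: f d)
  case (Cons u us)
  then have "br f (\<iota> (vF u)) \<in> G (d + dg u)" by (intro br_G Fwf_G) auto
  from Cons.IH[OF this] Cons.prems show ?case by (simp add: add_ac)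
qed simp

lemma ad_lin: "f \<in> G d \<Longrightarrow> g \<in> G d \<Longrightarrow> Fwf us \<Longrightarrow> ad (sA c f + g) us = sA c (ad f us) + ad g us"
proof (induction us arbitrary: f g d)
  case (Cons u us)
  then have "br f (\<iota> (vF u)) \<in> G (d + dg u)" "br g (\<iota> (vF u)) \<in> G (d + dg u)"
    by (auto intro!: br_G Fwf_G)
  from Cons.IH[OF this] Cons.prems show ?case by (simp add: br_lin[of f d g _ "dg u"] Fwf_G)
qed simp

lemma ad_0: "Fwf us \<Longrightarrow> ad 0 us = 0"
  using ad_lin[of 0 0 0 us 1] G_0 by simp

lemma ad_add: "f \<in> G d \<Longrightarrow> g \<in> G d \<Longrightarrow> Fwf us \<Longrightarrow> ad (f + g) us = ad f us + ad g us"
  using ad_lin[of f d g us 1] by simp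

lemma ad_pm: "f \<in> G d \<Longrightarrow> Fwf us \<Longrightarrow> ad (pm e f) us = pm e (ad f us)"
  unfolding pm_scale using ad_lin[of f d 0 us] ad_0[of us] G_0 by simp

text \<open>As F is abelian, one term of the Jacobi identity drops out: bracketing with elements of
  F gives operators that commute in the graded sense.\<close>

lemma br_comm:
  assumes "f \<in> G d" "\<theta> \<in> H m" "\<eta> \<in> H n"
  shows "br (br f (\<iota> \<theta>)) (\<iota> \<eta>) = pm (m * n) (br (br f (\<iota> \<eta>)) (\<iota> \<theta>))"
  using jacobi[of f d "\<iota> \<theta>" m "\<iota> \<eta>" n] assms by (simp add: \<iota>_G \<iota>_abelian[of _ m _ n] br_0r)

lemma ad_swap:
  assumes "f \<in> G d" "Fwf us" "Fwf [u, v]" "Fwf vs"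
  shows "ad f (us @ u # v # vs) = pm (dg u * dg v) (ad f (us @ v # u # vs))"
proof -
  have 1: "ad f us \<in> G (d + dgs us)" using assms by (simp add: ad_G)
  have "br (br (ad f us) (\<iota> (vF v))) (\<iota> (vF u)) \<in> G (d + dgs us + dg v + dg u)"
    using assms 1 by (intro br_G) (auto simp: tagged_ok_def \<iota>_G)
  then show ?thesis using assms br_comm[OF 1, of "vF u" "dg u" "vF v" "dg v"]
    by (simp add: ad_pm tagged_ok_def)
qed

lemma ad_slot:
  assumes "f \<in> G d" "Fwf us" "Fwf vs" "\<theta> \<in> H e" "\<eta> \<in> H e"
  shows "ad f (us @ (False, e, 0, sB c \<theta> + \<eta>) # vs)
    = sA c (ad f (us @ (False, e, 0, \<theta>) # vs)) + ad f (us @ (False, e, 0, \<eta>) # vs)"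
proof -
  have 1: "ad f us \<in> G (d + dgs us)" using assms by (simp add: ad_G)
  have "br (ad f us) (\<iota> \<theta>) \<in> G (d + dgs us + e)" "br (ad f us) (\<iota> \<eta>) \<in> G (d + dgs us + e)"
    using assms 1 by (auto intro!: br_G \<iota>_G)
  then show ?thesis using assms 1
    by (simp add: \<iota>_lin[of _ e] br_linr[of _ e _ _ "d + dgs us"] \<iota>_G ad_lin[of _ "d + dgs us + e"])
qed

text \<open>All brackets in one formula: \<open>t\<close> is the first L-entry, and the sign is that
  of moving it in front of the F-entries \<open>as\<close>. The unary bracket is the case of an
  empty iterated bracket. If a second L-entry is present, only the binary bracket survives; then
  \<open>bs\<close> is a singleton, and \<open>dg t + 1\<close> is the degree of \<open>vL t\<close>
  in L.\<close>

definition lab :: "('a, 'b) tagged list \<Rightarrow> 'a \<times> 'b" where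
  "lab us = (case dropWhile (\<lambda>u. \<not> isL u) us of [] \<Rightarrow> 0 | t # bs \<Rightarrow>
     let as = takeWhile (\<lambda>u. \<not> isL u) us in
     if noL bs then (0, pm (dg t * dgs as) (P (ad (vL t) (as @ bs))))
     else if length us = 2 then (pm (dg t + 1) (br (vL t) (vL (hd bs))), 0) else 0)"

lemma lab_none: "noL us \<Longrightarrow> lab us = 0"
proof -
  assume "noL us"
  then have "dropWhile (\<lambda>u. \<not> isL u) us = []" by (simp only: dropWhile_eq_Nil_conv)
  then show ?thesis by (simp only: lab_def list.case)
qed

lemma lab_one:
  assumes "noL as" "noL bs" "isL t"
  shows "lab (as @ t # bs) = (0, pm (dg t * dgs as) (P (ad (vL t) (as @ bs))))"
proof -
  have "dropWhile (\<lambda>u. \<not> isL u) (as @ t # bs) = t # bs" "takeWhile (\<lambda>u. \<not> isL u) (as @ t # bs) = as"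
    using assms by (simp_all add: dropWhile_append3 takeWhile_tail)
  then show ?thesis using assms by (simp add: lab_def del: ad_append)
qed

lemma lab_LL: "isL u \<Longrightarrow> isL v \<Longrightarrow> lab [u, v] = (pm (dg u + 1) (br (vL u) (vL v)), 0)"
  by (simp add: lab_def)

lemma filter_isL_split:
  obtains "filter isL us = []" "noL us" | as t bs where "us = as @ t # bs" "noL as" "isL t"
    "takeWhile (\<lambda>u. \<not> isL u) us = as" "dropWhile (\<lambda>u. \<not> isL u) us = t # bs"
    "length (filter isL us) = Suc (length (filter isL bs))"
proof (cases "filter isL us = []")
  case True then show ?thesis using that(1) by (simp add: filter_empty_conv)
next
  case False
  then obtain t ts where "filter isL us = t # ts" by (cases "filter isL us") auto
  then obtain as bs where *: "us = as @ t # bs" "noL as" "isL t" "ts = filter isL bs"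
    by (auto simp: filter_eq_Cons_iff)
  then show ?thesis using that(2)[OF *(1-3)]
    by (simp add: dropWhile_append3 takeWhile_tail filter_empty_conv)
qed

lemma lab_many: "2 \<le> length (filter isL us) \<Longrightarrow> length us \<noteq> 2 \<Longrightarrow> lab us = 0"
proof (cases us rule: filter_isL_split)
  case (2 as t bs)
  assume *: "2 \<le> length (filter isL us)" "length us \<noteq> 2"
  then have "filter isL bs \<noteq> []" using 2(6) by auto
  then have "\<not> noL bs" by (simp add: filter_empty_conv)
  then show ?thesis unfolding lab_def 2(4,5) using *(2) by (simp only: list.case Let_def if_False)
qed simp

text \<open>The only shape of arguments whose bracket lies in s^{-1} L; it decides the tag of the
  output.\<close>

definition isLL :: "('a, 'b) tagged list \<Rightarrow> bool" where
  "isLL us \<longleftrightarrow> length us = 2 \<and> (\<forall>u\<in>set us. isL u)"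

text \<open>Only the second and third shapes carry a bracket that may be nonzero.\<close>

lemma lab_cases:
  obtains "noL us" | as t bs where "us = as @ t # bs" "noL as" "noL bs" "isL t"
  | u v where "us = [u, v]" "isL u" "isL v"
  | "2 \<le> length (filter isL us)" "length us \<noteq> 2"
proof -
  consider "length (filter isL us) = 0" | "length (filter isL us) = 1"
    | "2 \<le> length (filter isL us)" "length us = 2" | "2 \<le> length (filter isL us)" "length us \<noteq> 2"
    by linarith
  then show ?thesis
  proof cases
    case 1 then show ?thesis using that(1) by (simp add: filter_empty_conv)
  next
    case 2 then show ?thesis using that(2) by (elim one_filterE)
  next
    case 3
    then obtain u v where "us = [u, v]" by (metis (no_types, lifting) One_nat_def Suc_1 length_0_conv length_Suc_conv)
    with 3 show ?thesis using that(3)[of u v] by (auto split: if_splits)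
  qed (use that in blast)
qed

text \<open>All brackets have degree 1. For two L-entries, desuspension matters: the degrees
  \<open>dg u + 1\<close> and \<open>dg v + 1\<close> in L add up to one more than the degree of the
  output.\<close>

lemma lab_wf: "wfs us \<Longrightarrow> tagged_ok (isLL us, dgs us + 1, lab us)"
proof (cases us rule: lab_cases)
  case 1
  then have "\<not> isLL us" by (cases us) (auto simp: isLL_def)
  then show ?thesis using 1 by (simp add: lab_none tagged_ok_def H_0)
next
  assume w: "wfs us"
  case (2 as t bs)
  have "\<not> isLL us" using 2 by (cases as; cases bs) (auto simp: isLL_def)
  moreover have "ad (vL t) (as @ bs) \<in> G (dg t + 1 + dgs (as @ bs))"
    using 2 w by (intro ad_G) (auto simp: tagged_ok_def)
  ultimately show ?thesis using 2 P_H H_pm by (fastforce simp: lab_one tagged_ok_def algebra_simps simp del: ad_append)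
next
  assume w: "wfs us"
  case (3 u v)
  then have "br (vL u) (vL v) \<in> G ((dg u + 1) + (dg v + 1))"
    using w by (intro br_G) (auto simp: tagged_ok_def)
  then show ?thesis using 3 by (auto simp: isLL_def tagged_ok_def lab_LL algebra_simps intro: G_pm)
next
  case 4
  then show ?thesis by (simp add: lab_many tagged_ok_def isLL_def H_0)
qed

text \<open>With a single L-entry the varied slot is that entry itself, or an F-entry behind it, or
  one in front of it; in the last two cases linearity is that of the iterated bracket in one of its
  F-arguments.\<close>

lemma lab_slot:
  assumes "wfs as" "wfs bs" "tagged_ok (b, d, y)" "tagged_ok (b, d, z)"
  shows "lab (as @ (b, d, scaleP c y + z) # bs) = scaleP c (lab (as @ (b, d, y) # bs)) + lab (as @ (b, d, z) # bs)"
    (is "lab ?us = _")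
proof (cases ?us rule: lab_cases)
  case 1
  then show ?thesis by (simp add: lab_none scaleP_def zero_prod_def)
next
  case (2 a1 t b1)
  have "length (filter isL ?us) = 1" using 2 unfolding 2(1) by (simp add: filter_empty_conv)
  then consider "b" "noL as" "noL bs" | a1 t a2 where "\<not> b" "as = a1 @ t # a2" "noL a1" "noL a2" "isL t" "noL bs"
    | b1 t b2 where "\<not> b" "bs = b1 @ t # b2" "noL b1" "noL b2" "isL t" "noL as"
  proof -
    have "length (filter isL as) + (if b then 1 else 0) + length (filter isL bs) = 1"
      using \<open>length (filter isL ?us) = 1\<close> by (cases b) auto
    then consider "b" "filter isL as = []" "filter isL bs = []"
      | "\<not> b" "length (filter isL as) = 1" "filter isL bs = []"
      | "\<not> b" "length (filter isL bs) = 1" "filter isL as = []"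
      by (cases b; cases "filter isL as"; cases "filter isL bs") auto
    then show thesis
    proof cases
      case 1 then show thesis using that(1) by (simp add: filter_empty_conv)
    next
      case 2 then show thesis using that(2) by (elim one_filterE) (simp add: filter_empty_conv)
    next
      case 3 then show thesis using that(3) by (elim one_filterE) (simp add: filter_empty_conv)
    qed
  qed
  then show ?thesis
  proof cases
    case 1
    then have y: "fst y \<in> G (d + 1)" "fst z \<in> G (d + 1)" using assms by (auto simp: tagged_ok_def)
    have F: "Fwf (as @ bs)" using assms 1 by auto
    have "ad (fst y) (as @ bs) \<in> G (d + 1 + dgs (as @ bs))" "ad (fst z) (as @ bs) \<in> G (d + 1 + dgs (as @ bs))"
      by (rule ad_G[OF y(1) F] ad_G[OF y(2) F])+
    then show ?thesis using 1 ad_lin[OF y F, of c] P_lin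
      by (simp add: lab_one scaleP_def pm_add B.scale_pm del: ad_append)
  next
    case (2 a1 t a2)
    then have y: "snd y \<in> H d" "snd z \<in> H d" "fst y = 0" "fst z = 0" "vL t \<in> G (dg t + 1)" "Fwf (a1 @ a2)" "Fwf bs"
      using assms by (auto simp: tagged_ok_def)
    have l: "lab (as @ (b, d, w) # bs) = (0, pm (dg t * dgs a1) (P (ad (vL t) ((a1 @ a2) @ (False, d, w) # bs))))" for w
      using 2 lab_one[of a1 "a2 @ (False, d, w) # bs" t] by (simp add: ball_Un)
    have "ad (vL t) ((a1 @ a2) @ (False, d, 0, \<theta>) # bs) \<in> G (dg t + 1 + dgs ((a1 @ a2) @ (False, d, 0::'a, \<theta>) # bs))"
      if "\<theta> \<in> H d" for \<theta>
    proof -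
      have "tagged_ok (False, d, 0, \<theta>)" using that by (simp add: tagged_ok_def)
      then show ?thesis using y by (intro ad_G) auto
    qed
    from this[OF y(1)] this[OF y(2)]
    show ?thesis using y ad_slot[OF y(5-7,1,2), of c] P_lin
      by (cases y; cases z) (simp add: l scaleP_def pm_add B.scale_pm del: ad_append)
  next
    case (3 b1 t b2)
    then have y: "snd y \<in> H d" "snd z \<in> H d" "fst y = 0" "fst z = 0" "vL t \<in> G (dg t + 1)" "Fwf as" "Fwf (b1 @ b2)"
      using assms by (auto simp: tagged_ok_def)
    \<comment> \<open>The L-entry has to pass the varied slot, so the degree \<open>d\<close> of
      that slot enters the sign; it is the same for all values put there.\<close>
    have l: "lab (as @ (b, d, w) # bs) = (0, pm (dg t * (dgs as + d + dgs b1)) (P (ad (vL t) (as @ (False, d, w) # (b1 @ b2)))))" for w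
      using 3 lab_one[of "as @ (False, d, w) # b1" b2 t] by (simp add: ball_Un algebra_simps)
    have "ad (vL t) (as @ (False, d, 0, \<theta>) # (b1 @ b2)) \<in> G (dg t + 1 + dgs (as @ (False, d, 0::'a, \<theta>) # (b1 @ b2)))"
      if "\<theta> \<in> H d" for \<theta>
    proof -
      have "tagged_ok (False, d, 0, \<theta>)" using that by (simp add: tagged_ok_def)
      then show ?thesis using y by (intro ad_G) auto
    qed
    from this[OF y(1)] this[OF y(2)]
    show ?thesis using y ad_slot[OF y(5-7,1,2), of c] P_lin
      by (cases y; cases z) (simp add: l scaleP_def pm_add B.scale_pm del: ad_append)
  qed
next
  case (3 u v)
  then consider t where "as = []" "bs = [t]" "isL t" "b" | t where "as = [t]" "bs = []" "isL t" "b"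
    by (cases as; cases bs) auto
  then show ?thesis
  proof cases
    case 1
    then have "fst y \<in> G (d + 1)" "fst z \<in> G (d + 1)" "snd y = 0" "snd z = 0" "vL t \<in> G (dg t + 1)"
      using assms by (auto simp: tagged_ok_def)
    then show ?thesis using 1
      by (simp add: lab_LL scaleP_def br_lin[of _ "d + 1" _ _ "dg t + 1"] pm_add A.scale_pm)
  next
    case 2
    then have "fst y \<in> G (d + 1)" "fst z \<in> G (d + 1)" "snd y = 0" "snd z = 0" "vL t \<in> G (dg t + 1)"
      using assms by (auto simp: tagged_ok_def)
    then show ?thesis using 2
      by (simp add: lab_LL scaleP_def br_linr[of _ "d + 1" _ _ "dg t + 1"] pm_add A.scale_pm)
  qed
next
  case 4
  then have "2 \<le> length (filter isL (as @ (b, d, w) # bs))" "length (as @ (b, d, w) # bs) \<noteq> 2" for w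
    by auto
  then show ?thesis by (simp add: lab_many scaleP_def zero_prod_def)
qed

lemma lab_zero: "wfs as \<Longrightarrow> wfs bs \<Longrightarrow> lab (as @ (b, d, 0) # bs) = 0"
proof -
  assume "wfs as" "wfs bs"
  moreover have "tagged_ok (b, d, 0)" using G_0 H_0 by (simp add: tagged_ok_def)
  moreover have "scaleP 1 0 + 0 = (0 :: 'a \<times> 'b)" by (simp add: scaleP_def zero_prod_def)
  moreover have "scaleP 1 w = w" for w by (simp add: scaleP_def)
  ultimately show ?thesis using lab_slot[of as bs b d 0 0 1] by simp
qed

lemma lab_scale:
  "wfs as \<Longrightarrow> wfs bs \<Longrightarrow> tagged_ok (b, d, y) \<Longrightarrow> lab (as @ (b, d, scaleP c y) # bs) = scaleP c (lab (as @ (b, d, y) # bs))"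
  using lab_slot[of as bs b d y 0 c] lab_zero[of as bs b d] G_0[of "d + 1"] H_0[of d] by (simp add: tagged_ok_def)

lemma pm_scaleP: "pm d x = scaleP (if even d then 1 else -1) x"
  by (cases x) (simp add: pm_def scaleP_def)

lemma lab_pm:
  "wfs as \<Longrightarrow> wfs bs \<Longrightarrow> tagged_ok (b, d, y) \<Longrightarrow> lab (as @ (b, d, pm e y) # bs) = pm e (lab (as @ (b, d, y) # bs))"
  unfolding pm_scaleP by (rule lab_scale)

text \<open>An L-entry passing an F-entry changes only the sign of moving it to the front; two
  F-entries are exchanged by \<open>ad_swap\<close>; two L-entries by the skew symmetry of the
  bracket.\<close>

lemma lab_swap:
  assumes "wfs (as @ x # y # bs)"
  shows "lab (as @ x # y # bs) = pm (dg x * dg y) (lab (as @ y # x # bs))" (is "lab ?us = _")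
proof (cases ?us rule: lab_cases)
  case 1
  then show ?thesis by (simp add: lab_none)
next
  case (2 a1 t b1)
  have "length (filter isL ?us) = 1" using 2 unfolding 2(1) by (simp add: filter_empty_conv)
  then have "length (filter isL as) + (if isL x then 1 else 0) + (if isL y then 1 else 0)
      + length (filter isL bs) = 1"
    by auto
  then consider "isL x" "\<not> isL y" "filter isL as = []" "filter isL bs = []"
    | "isL y" "\<not> isL x" "filter isL as = []" "filter isL bs = []"
    | "\<not> isL x" "\<not> isL y" "length (filter isL as) = 1" "filter isL bs = []"
    | "\<not> isL x" "\<not> isL y" "length (filter isL bs) = 1" "filter isL as = []"
    by (cases "isL x"; cases "isL y"; cases "filter isL as"; cases "filter isL bs") auto
  then show ?thesis
  proof cases
    case 1
    then show ?thesis using lab_one[of as "y # bs" x] lab_one[of "as @ [y]" bs x]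
      by (simp add: filter_empty_conv pm_pair pm_pm algebra_simps)
         (rule pm_cong, simp)
  next
    case 2
    then show ?thesis using lab_one[of as "x # bs" y] lab_one[of "as @ [x]" bs y]
      by (simp add: filter_empty_conv pm_pair pm_pm algebra_simps)
  next
    case 3
    then obtain a1 t a2 where *: "as = a1 @ t # a2" "noL a1" "noL a2" "isL t" by (elim one_filterE)
    have b: "noL bs" using 3 by (simp add: filter_empty_conv)
    have t: "vL t \<in> G (dg t + 1)" using * assms by (simp add: tagged_ok_def)
    have "ad (vL t) ((a1 @ a2) @ y # x # bs) \<in> G (dg t + 1 + dgs ((a1 @ a2) @ y # x # bs))"
      by (rule ad_G[OF t]) (use 3 * b assms in auto)
    then have "P (ad (vL t) ((a1 @ a2) @ x # y # bs)) = pm (dg x * dg y) (P (ad (vL t) ((a1 @ a2) @ y # x # bs)))"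
      using ad_swap[OF t, of "a1 @ a2" x y bs] 3 * b assms by (simp add: P_pm ball_Un del: ad_append ad_Cons)
    then show ?thesis
      using lab_one[of a1 "a2 @ x # y # bs" t] lab_one[of a1 "a2 @ y # x # bs" t] 3 * b
      by (simp add: pm_pair pm_pm add.commute ball_Un del: ad_append ad_Cons)
  next
    case 4
    then obtain b1 t b2 where *: "bs = b1 @ t # b2" "noL b1" "noL b2" "isL t" by (elim one_filterE)
    have b: "noL as" using 4 by (simp add: filter_empty_conv)
    have t: "vL t \<in> G (dg t + 1)" using * assms by (simp add: tagged_ok_def)
    have "ad (vL t) (as @ y # x # (b1 @ b2)) \<in> G (dg t + 1 + dgs (as @ y # x # (b1 @ b2)))"
      by (rule ad_G[OF t]) (use 4 * b assms in auto)
    then have "P (ad (vL t) (as @ x # y # (b1 @ b2))) = pm (dg x * dg y) (P (ad (vL t) (as @ y # x # (b1 @ b2))))"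
      using ad_swap[OF t, of as x y "b1 @ b2"] 4 * b assms by (simp add: P_pm ball_Un del: ad_append ad_Cons)
    then show ?thesis
      using lab_one[of "as @ x # y # b1" b2 t] lab_one[of "as @ y # x # b1" b2 t] 4 * b
      by (simp add: pm_pair pm_pm add_ac ball_Un del: ad_append ad_Cons)
  qed
next
  case (3 u v)
  then have "as = []" "bs = []" "isL x" "isL y" by (cases as; auto)+
  moreover have "br (vL x) (vL y) = - pm ((dg x + 1) * (dg y + 1)) (br (vL y) (vL x))"
    using calculation assms by (intro br_skew) (auto simp: tagged_ok_def)
  \<comment> \<open>The sign of the binary bracket turns graded skew symmetry in L into graded
    symmetry after desuspension: with \<open>d = dg x\<close> and \<open>e = dg y\<close>, the
    exponents \<open>d + (d + 1) * (e + 1)\<close> and \<open>d * e + e + 1\<close> have the same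
    parity.\<close>
  ultimately show ?thesis
    by (simp add: lab_LL pm_pair pm_minus pm_pm) (auto simp: pm_def)
next
  case 4
  then have *: "2 \<le> length (filter isL (as @ y # x # bs))" "length (as @ y # x # bs) \<noteq> 2" by auto
  show ?thesis unfolding lab_many[OF 4] lab_many[OF *] by simp
qed

section \<open>The Leibniz rule for iterated brackets\<close>

definition split_ad :: "'a \<Rightarrow> 'a \<Rightarrow> ('a, 'b) tagged list \<Rightarrow> 'b" where
  "split_ad f g us = ksum dg us (\<lambda>as bs. P (ad (br g (\<iota> (P (ad f as)))) bs))"

lemma set_of_split: "mset as + mset bs = mset us \<Longrightarrow> set us = set as \<union> set bs"
  by (metis set_mset_mset set_mset_union)

text \<open>If \<open>u\<close> falls into the first block it is bracketed with \<open>f\<close>.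
  Otherwise \<open>br_comm\<close> moves it next to \<open>g\<close>, past an element of degree
  \<open>d + dgs as\<close>; the summand \<open>dgs as\<close> cancels against the sign of the
  splitting.\<close>

lemma split_ad_Cons:
  assumes f: "f \<in> G d" and g: "g \<in> G e" and us: "Fwf (u # us)"
  shows "split_ad f g (u # us) = split_ad (br f (\<iota> (vF u))) g us + pm (dg u * d) (split_ad f (br g (\<iota> (vF u))) us)"
proof -
  have "pm (dg u * dgs as) (P (ad (br g (\<iota> (P (ad f as)))) (u # bs)))
      = pm (dg u * d) (P (ad (br (br g (\<iota> (vF u))) (\<iota> (P (ad f as)))) bs))"
    if *: "mset as + mset bs = mset us" for as bs
  proof -
    have F: "Fwf as" "Fwf bs" "vF u \<in> H (dg u)" using us set_of_split[OF *] by (auto simp: tagged_ok_def)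
    then have 1: "P (ad f as) \<in> H (d + dgs as)" using f by (intro P_H ad_G)
    have 2: "br (br g (\<iota> (vF u))) (\<iota> (P (ad f as))) \<in> G (e + dg u + (d + dgs as))"
      using g 1 F by (intro br_G \<iota>_G)
    then have "ad (br (br g (\<iota> (vF u))) (\<iota> (P (ad f as)))) bs \<in> G (e + dg u + (d + dgs as) + dgs bs)"
      using F(2) by (rule ad_G)
    then show ?thesis using br_comm[OF g 1 F(3)] ad_pm[OF 2 F(2)]
      by (simp add: P_pm pm_pm) (rule pm_cong, simp add: algebra_simps)
  qed
  then show ?thesis unfolding split_ad_def ksum.simps ksum_pm[symmetric]
    by (auto intro!: arg_cong2[where f="(+)"] ksum_cong)
qed

text \<open>Induction on \<open>us\<close>, starting from \<open>P_br\<close>: a bracket with an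
  element of F distributes over \<open>br f g\<close> by \<open>jacobi\<close>, and
  \<open>split_ad_Cons\<close> shows that the right side distributes in the same way. Each term on
  the right has P applied to an inner iterated bracket, as in a composite of two of the
  brackets.\<close>

lemma P_ad_br:
  assumes "f \<in> G d" "g \<in> G e" "Fwf us"
  shows "P (ad (br f g) us) = split_ad g f us - pm (d * e) (split_ad f g us)"
  using assms
proof (induction us arbitrary: f g d e)
  case Nil
  \<comment> \<open>In \<open>P_br\<close> the term with \<open>P f\<close> has it on the left, in
    \<open>split_ad\<close> it stands on the right.\<close>
  have "br (\<iota> (P f)) g = - pm (d * e) (br g (\<iota> (P f)))"
    using Nil by (intro br_skew \<iota>_G P_H)
  moreover have "br g (\<iota> (P f)) \<in> G (e + d)" using Nil by (intro br_G \<iota>_G P_H)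
  moreover have "- x = pm 1 x" for x :: 'a by simp
  ultimately have "P (br (\<iota> (P f)) g) = - pm (d * e) (P (br g (\<iota> (P f))))"
    by (simp add: P_pm pm_pm del: pm_1) (auto simp: pm_def)
  then show ?case using P_br[of f d g e] Nil by (simp add: split_ad_def)
next
  case (Cons u us)
  let ?\<theta> = "\<iota> (vF u)" and ?k = "dg u"
  have F: "?\<theta> \<in> G ?k" "Fwf us" using Cons.prems by (auto simp: tagged_ok_def \<iota>_G)
  have G: "br f ?\<theta> \<in> G (d + ?k)" "br g ?\<theta> \<in> G (e + ?k)" using Cons.prems F by (auto intro: br_G)
  have G': "br f (br g ?\<theta>) \<in> G (d + e + ?k)" "br (br f ?\<theta>) g \<in> G (d + e + ?k)"
    using br_G[OF Cons.prems(1) G(2)] br_G[OF G(1) Cons.prems(2)] by (simp_all add: add_ac)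
  have "P (ad (br f g) (u # us)) = P (ad (br f (br g ?\<theta>)) us) + pm (e * ?k) (P (ad (br (br f ?\<theta>) g) us))"
    using jacobi[OF Cons.prems(1,2) F(1)] F(2) G' ad_G[OF G'(1) F(2)] ad_G[OF G'(2) F(2)]
    by (simp add: ad_add[of _ "d + e + ?k"] G_pm P_add[of _ "d + e + ?k + dgs us"] ad_pm P_pm)
  also have "\<dots> = split_ad g f (u # us) - pm (d * e) (split_ad f g (u # us))"
    unfolding Cons.IH[OF Cons.prems(1) G(2) F(2)] Cons.IH[OF G(1) Cons.prems(2) F(2)]
      split_ad_Cons[OF Cons.prems(1,2,3)] split_ad_Cons[OF Cons.prems(2,1,3)] pm_diff pm_add pm_pm
    by (cases "even d"; cases "even e"; cases "even ?k"; simp add: pm_def)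
  finally show ?case .
qed

section \<open>The Jacobi sum on tagged arguments\<close>

definition inner :: "('a, 'b) tagged list \<Rightarrow> ('a, 'b) tagged" where
  "inner us = (isLL us, dgs us + 1, lab us)"

text \<open>For well-formed lists the splitting with empty first block contributes zero, as its
  inner bracket is zero.\<close>

definition Jac :: "('a, 'b) tagged list \<Rightarrow> 'a \<times> 'b" where
  "Jac us = ksum dg us (\<lambda>as bs. lab (inner as # bs))"

text \<open>Neighbours in the same block are exchanged by the symmetry of the inner or the outer
  bracket; \<open>ksum_swap\<close> deals with separated ones.\<close>

lemma Jac_swap:
  assumes "wfs (xs @ x # y # ys)"
  shows "Jac (xs @ x # y # ys) = pm (dg x * dg y) (Jac (xs @ y # x # ys))"
  unfolding Jac_def
proof (rule ksum_swap, goal_cases)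
  case (1 us vs bs)
  then have "set us \<union> set vs \<union> set bs = set xs \<union> set ys"
    by (metis set_mset_mset set_mset_union)
  then have w: "wfs (us @ x # y # vs)" "wfs (us @ y # x # vs)" "wfs bs" using assms by auto
  have "isLL (us @ x # y # vs) = isLL (us @ y # x # vs)" "dgs (us @ x # y # vs) = dgs (us @ y # x # vs)"
    by (auto simp: isLL_def)
  then show ?case unfolding inner_def lab_swap[OF w(1)]
    using lab_pm[of "[]", OF _ w(3) lab_wf[OF w(2)]] by (simp add: add_ac)
next
  case (2 us vs as)
  then have "set us \<union> set vs \<union> set as = set xs \<union> set ys"
    by (metis set_mset_mset set_mset_union)
  then have w: "wfs (us @ x # y # vs)" "wfs as" using assms by auto
  show ?case using lab_swap[of "inner as # us" x y vs] w lab_wf[OF w(2)] by (simp add: inner_def)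
qed

text \<open>Sorting by exchanges of neighbours: an entry failing \<open>p\<close> is moved back to
  its place past the entries satisfying \<open>p\<close>. The prefix \<open>us\<close> holds what is
  already in place.\<close>

lemma bring_to_front:
  assumes "\<And>us x y vs. set (us @ x # y # vs) \<subseteq> W \<Longrightarrow> Z (us @ y # x # vs) \<Longrightarrow> Z (us @ x # y # vs)"
  shows "set (us @ xs) \<subseteq> W \<Longrightarrow> Z (us @ filter p xs @ filter (\<lambda>x. \<not> p x) xs) \<Longrightarrow> Z (us @ xs)"
proof (induction xs arbitrary: us)
  case (Cons x xs)
  have "Z ((us @ [x]) @ filter p xs @ filter (\<lambda>x. \<not> p x) xs)"
  proof (cases "p x")
    case False
    have "Z (us @ x # ys @ zs)" if "set (us @ x # ys @ zs) \<subseteq> W" "Z (us @ ys @ x # zs)" for us ys zs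
      using that
    proof (induction ys arbitrary: us)
      case (Cons y ys)
      then have "Z ((us @ [y]) @ x # ys @ zs)" by (intro Cons.IH) auto
      then show ?case using assms[of us x y "ys @ zs"] Cons.prems by simp
    qed simp
    from this[of us "filter p xs" "filter (\<lambda>x. \<not> p x) xs"] show ?thesis using False Cons.prems by auto
  qed (use Cons.prems in simp)
  then show ?case using Cons.IH[of "us @ [x]"] Cons.prems by simp
qed simp

lemma ksum_Nil_left: "ksum deg us (\<lambda>as bs. if as = [] then \<Phi> bs else 0) = \<Phi> us"
proof (induction us arbitrary: \<Phi>)
  case (Cons u us)
  have "ksum deg us (\<lambda>as bs. pm (deg u * sum_list (map deg as)) (if as = [] then \<Phi> (u # bs) else 0))
      = ksum deg us (\<lambda>as bs. if as = [] then \<Phi> (u # bs) else 0)"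
    by (rule ksum_cong) simp
  then show ?case using Cons.IH[of "\<lambda>bs. \<Phi> (u # bs)"] by simp
qed simp

text \<open>Four sums, by the blocks of \<open>f\<close> and \<open>g\<close>. Both inside: only the
  binary bracket survives, without further entries. One inside and one outside: the two
  \<open>split_ad\<close> terms. Both outside: the inner bracket has no L-entry and is zero. The
  total vanishes by \<open>P_ad_br\<close>.\<close>

lemma Jac_two:
  assumes "isL f" "isL g" "Fwf us" "tagged_ok f" "tagged_ok g"
  shows "Jac (f # g # us) = 0"
proof -
  let ?\<Phi> = "\<lambda>as bs. lab (inner as # bs)"
  have f: "vL f \<in> G (dg f + 1)" and g: "vL g \<in> G (dg g + 1)" using assms by (auto simp: tagged_ok_def)
  have fg: "br (vL f) (vL g) \<in> G (dg f + 1 + (dg g + 1))" using f g by (rule br_G)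
  have F: "Fwf as" "Fwf bs" if "mset as + mset bs = mset us" for as bs
    using set_of_split[OF that] assms(3) by auto
  have 1: "ksum dg us (\<lambda>as bs. ?\<Phi> (f # g # as) bs) = (0, pm (dg f + 1) (P (ad (br (vL f) (vL g)) us)))"
  proof -
    have "?\<Phi> (f # g # as) bs = (if as = [] then ?\<Phi> [f, g] bs else 0)" if "mset as + mset bs = mset us" for as bs
    proof (cases as)
      case (Cons a as')
      then have "lab (f # g # as) = 0" "\<not> isLL (f # g # as)"
        using assms by (simp_all add: lab_many isLL_def)
      then show ?thesis using Cons F(2)[OF that] by (simp add: inner_def lab_none)
    qed simp
    then have "ksum dg us (\<lambda>as bs. ?\<Phi> (f # g # as) bs)
        = ksum dg us (\<lambda>as bs. if as = [] then ?\<Phi> [f, g] bs else 0)"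
      by (rule ksum_cong)
    also have "\<dots> = ?\<Phi> [f, g] us" by (rule ksum_Nil_left)
    also have "inner [f, g] = (True, dg f + dg g + 1, pm (dg f + 1) (br (vL f) (vL g)), 0)"
      using assms by (simp add: inner_def isLL_def lab_LL)
    also have "lab (\<dots> # us) = (0, pm (dg f + 1) (P (ad (br (vL f) (vL g)) us)))"
      using lab_one[of "[]" us "(True, dg f + dg g + 1, pm (dg f + 1) (br (vL f) (vL g)), 0)"] assms
      by (simp add: ad_pm[OF fg] P_pm[OF ad_G[OF fg]])
    finally show ?thesis .
  qed
  \<comment> \<open>The inner bracket is an F-entry of degree \<open>dg f + 1 + dgs as\<close>,
    which the L-entry of the second block has to pass.\<close>
  have split_ad: "?\<Phi> (f # as) (g # bs) = (0, pm (dg g * (dg f + 1 + dgs as)) (P (ad (br (vL g) (\<iota> (P (ad (vL f) as)))) bs)))"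
    if "isL f" "isL g" "noL as" "noL bs" for f g :: "('a, 'b) tagged" and as bs
  proof -
    have "inner (f # as) = (False, dg f + dgs as + 1, 0, P (ad (vL f) as))"
      using that lab_one[of "[]" as f] by (cases as) (auto simp: inner_def isLL_def)
    then show ?thesis using lab_one[of "[inner (f # as)]" bs g] that by (simp add: algebra_simps)
  qed
  have P0: "ksum dg us (\<lambda>as bs. (0, \<Psi> as bs)) = (0, ksum dg us \<Psi>)" for \<Psi> :: "_ \<Rightarrow> _ \<Rightarrow> 'b"
    by (rule additive_ksum[symmetric]) simp
  have 2: "ksum dg us (\<lambda>as bs. pm (dg g * dgs as) (?\<Phi> (f # as) (g # bs)))
      = (0, pm (dg g * (dg f + 1)) (split_ad (vL f) (vL g) us))"
    unfolding split_ad_def ksum_pm[symmetric] P0[symmetric]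
  proof (rule ksum_cong)
    fix as bs assume "mset as + mset bs = mset us"
    note F = F[OF this]
    have "noL as" "noL bs" using F by auto
    from split_ad[OF assms(1,2) this] show "pm (dg g * dgs as) (?\<Phi> (f # as) (g # bs))
        = (0, pm (dg g * (dg f + 1)) (P (ad (br (vL g) (\<iota> (P (ad (vL f) as)))) bs)))" by (simp add: pm_pair pm_pm) (rule pm_cong, simp add: algebra_simps)
  qed
  have 3: "ksum dg us (\<lambda>as bs. pm (dg f * (dg g + dgs as)) (?\<Phi> (g # as) (f # bs)))
      = (0, pm (dg f) (split_ad (vL g) (vL f) us))"
    unfolding split_ad_def ksum_pm[symmetric] P0[symmetric]
  proof (rule ksum_cong)
    fix as bs assume "mset as + mset bs = mset us"
    note F = F[OF this]
    have "noL as" "noL bs" using F by auto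
    from split_ad[OF assms(2,1) this] show "pm (dg f * (dg g + dgs as)) (?\<Phi> (g # as) (f # bs))
        = (0, pm (dg f) (P (ad (br (vL f) (\<iota> (P (ad (vL g) as)))) bs)))" by (simp add: pm_pair pm_pm) (rule pm_cong, simp add: algebra_simps)
  qed
  have 4: "ksum dg us (\<lambda>as bs. pm (dg g * dgs as) (pm (dg f * dgs as) (?\<Phi> as (f # g # bs)))) = 0"
  proof (rule ksum_zeroI)
    fix as bs assume *: "mset as + mset bs = mset us"
    have "lab as = 0" "wfs (f # g # bs)" using F[OF *] assms by (simp_all add: lab_none)
    then show "pm (dg g * dgs as) (pm (dg f * dgs as) (?\<Phi> as (f # g # bs))) = 0"
      using lab_zero[of "[]" "f # g # bs"] by (simp add: inner_def)
  qed
  have "Jac (f # g # us) = (0, pm (dg f + 1) (P (ad (br (vL f) (vL g)) us))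
      + pm (dg g * (dg f + 1)) (split_ad (vL f) (vL g) us) + pm (dg f) (split_ad (vL g) (vL f) us))"
    by (simp add: Jac_def 1 2 3 4)
  also have "\<dots> = 0"
    unfolding P_ad_br[OF f g assms(3)] zero_prod_def
    by (cases "even (dg f)"; cases "even (dg g)"; simp add: pm_def)
  finally show ?thesis .
qed

text \<open>Only the three splittings into two inner and one outer entry survive: a unary inner
  bracket is an F-entry and meets two L-entries in a list of length three, where the bracket is
  zero.\<close>

lemma Jac_three:
  assumes L: "isL f" "isL g" "isL h" and w: "tagged_ok f" "tagged_ok g" "tagged_ok h"
  shows "Jac [f, g, h] = 0"
proof -
  have f: "vL f \<in> G (dg f + 1)" and g: "vL g \<in> G (dg g + 1)" and h: "vL h \<in> G (dg h + 1)"
    using assms by (auto simp: tagged_ok_def)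
  have G: "br (vL f) (vL g) \<in> G (dg f + 1 + (dg g + 1))" "br (vL f) (vL h) \<in> G (dg f + 1 + (dg h + 1))"
    "br (vL g) (vL h) \<in> G (dg g + 1 + (dg h + 1))" by (rule br_G[OF f g] br_G[OF f h] br_G[OF g h])+
  have 2: "lab (inner [u, v] # [t]) = (pm (dg v + 1) (br (br (vL u) (vL v)) (vL t)), 0)"
    if "isL u" "isL v" "isL t" "br (vL u) (vL v) \<in> G m" "vL t \<in> G n" for u v t m n
    using that by (simp add: inner_def isLL_def lab_LL br_pm pm_pm) (rule pm_cong, simp)
  have 3: "lab [inner [f, g, h]] = 0"
    using L lab_many[of "[f, g, h]"] by (simp add: inner_def isLL_def lab_none)
  have 1: "lab (inner us # [u, v]) = 0" if "isL u" "isL v" for us u v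
    using that by (intro lab_many) auto
  have 0: "lab (inner us # [u, v, t]) = 0" if "isL u" "isL v" for us u v t
    using that by (intro lab_many) auto
  have "br (vL f) (br (vL g) (vL h)) = - pm ((dg f + 1) * (dg g + dg h)) (br (br (vL g) (vL h)) (vL f))"
    using br_skew[OF f G(3)] by simp (rule pm_cong, simp add: algebra_simps)
  with jacobi[OF f g h]
  have J: "br (br (vL f) (vL g)) (vL h) = - pm ((dg f + 1) * (dg g + dg h)) (br (br (vL g) (vL h)) (vL f))
     + pm ((dg g + 1) * (dg h + 1)) (br (br (vL f) (vL h)) (vL g))" by simp
  show ?thesis unfolding Jac_def
    using L apply (simp add: 0 1 3 2[OF _ _ _ G(1) h] 2[OF _ _ _ G(2) g] 2[OF _ _ _ G(3) f] pm_pair)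
    unfolding J zero_prod_def pm_pm pm_add pm_minus
    by (cases "even (dg f)"; cases "even (dg g)"; cases "even (dg h)"; simp add: pm_def)
qed

text \<open>Once the L-entries are moved to the front, their number decides. With none or a single
  one, each composite contains a bracket without L-entries; the cases with content are
  \<open>Jac_two\<close> and \<open>Jac_three\<close>; otherwise some bracket has too many
  L-entries.\<close>

lemma Jac_0:
  assumes "wfs us"
  shows "Jac us = 0"
proof -
  let ?Ls = "filter isL us" and ?Fs = "filter (\<lambda>u. \<not> isL u) us"
  have w: "wfs ?Ls" "Fwf ?Fs" "\<forall>u\<in>set ?Ls. isL u" using assms by auto
  have cnt: "length (filter isL as) + length (filter isL bs) = length ?Ls"
    "length as + length bs = length ?Ls + length ?Fs" "wfs as" "wfs bs"
    if "mset as + mset bs = mset (?Ls @ ?Fs)" for as bs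
  proof -
    have *: "mset (as @ bs) = mset us" using that by simp
    then have "mset (filter isL (as @ bs)) = mset ?Ls" "size (mset (as @ bs)) = size (mset us)"
      "set_mset (mset (as @ bs)) = set_mset (mset us)"
      by (metis mset_filter, simp_all only:)
    from arg_cong[OF this(1), of size, unfolded size_mset] this(2,3)
    show "length (filter isL as) + length (filter isL bs) = length ?Ls"
      "length as + length bs = length ?Ls + length ?Fs" "wfs as" "wfs bs"
      using sum_length_filter_compl[of isL us] assms by auto
  qed
  consider "?Ls = []" | f where "?Ls = [f]" | f g where "?Ls = [f, g]" | f g h where "?Ls = [f, g, h]" "?Fs = []"
    | "3 \<le> length ?Ls" "length ?Ls + length ?Fs \<noteq> 3"
  proof -
    have *: "length xs = 3 \<Longrightarrow> \<exists>a b c. xs = [a, b, c]" for xs :: "('a, 'b) tagged list"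
      by (auto simp: numeral_3_eq_3 length_Suc_conv)
    show ?thesis
    proof (cases "length ?Ls \<le> 2")
      case True
      then show ?thesis using that(1-3) by (cases ?Ls rule: remdups_adj.cases) (auto simp: Suc_le_eq)
    next
      case False
      show ?thesis
      proof (cases "length ?Ls = 3")
        case True
        then show ?thesis using *[OF True] that(4,5) by (cases ?Fs) (blast, simp)
      next
        case False
        then show ?thesis using \<open>\<not> length ?Ls \<le> 2\<close> that(5)[OF _] by (cases "length ?Ls + length ?Fs = 3") auto
      qed
    qed
  qed
  then have "Jac (?Ls @ ?Fs) = 0"
  proof cases
    case 1
    have "lab (inner as # bs) = 0" if "mset as + mset bs = mset (?Ls @ ?Fs)" for as bs
    proof -
      have "noL as" "noL bs" using cnt(1)[OF that] 1 by (simp_all add: filter_empty_conv)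
      then show ?thesis by (cases as) (auto simp: inner_def isLL_def intro!: lab_none)
    qed
    then show ?thesis unfolding Jac_def by (rule ksum_zeroI)
  next
    case (2 f)
    have "lab (inner as # bs) = 0" if *: "mset as + mset bs = mset (?Ls @ ?Fs)" for as bs
    proof -
      have "length (filter isL as) + length (filter isL bs) = 1" using cnt(1)[OF *] 2 by simp
      then consider "noL as" | "length (filter isL as) = 1" "noL bs"
        by (cases "filter isL as"; cases "filter isL bs") (auto simp: filter_empty_conv)
      then show ?thesis
      proof cases
        case 1 then show ?thesis using lab_zero[of "[]" bs] cnt(4)[OF *] by (simp add: inner_def lab_none)
      next
        case 2
        then have "\<not> isLL as" by (auto simp: isLL_def length_Suc_conv numeral_2_eq_2)
        then show ?thesis using 2 by (auto simp: inner_def intro!: lab_none)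
      qed
    qed
    then show ?thesis unfolding Jac_def by (rule ksum_zeroI)
  next
    case (3 f g)
    have "tagged_ok f" "tagged_ok g" "isL f" "isL g" using w(1,3) unfolding 3 by auto
    then show ?thesis unfolding 3 using Jac_two[OF _ _ w(2), of f g] by (simp only: append.simps)
  next
    case (4 f g h)
    have "tagged_ok f" "tagged_ok g" "tagged_ok h" "isL f" "isL g" "isL h" using w(1,3) unfolding 4(1) by auto
    then show ?thesis unfolding 4 using Jac_three[of f g h] by (simp only: append.simps)
  next
    case 5
    have "lab (inner as # bs) = 0" if *: "mset as + mset bs = mset (?Ls @ ?Fs)" for as bs
    proof -
      note c = cnt[OF *]
      \<comment> \<open>The four ways in which a term dies: no L-entry inside; two outside; a binary
        inner bracket that is an L-entry and meets another one in a list of length other than two;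
        two or more inside a list of length other than two.\<close>
      consider "noL as" | "2 \<le> length (filter isL bs)" | "isLL as" "length bs \<noteq> 1" "filter isL bs \<noteq> []"
        | "2 \<le> length (filter isL as)" "length as \<noteq> 2"
      proof -
        have f: "length (filter isL as) \<le> length as" "length (filter isL bs) \<le> length bs"
          by (rule length_filter_le)+
        consider "length (filter isL as) = 0" | "2 \<le> length (filter isL bs)"
          | "length as \<noteq> 2" "2 \<le> length (filter isL as)"
          | "length as = 2" "length (filter isL as) = 2" "length (filter isL bs) = 1"
          using c 5(1) f by linarith
        then show thesis
        proof cases
          case 4
          then have "isLL as" unfolding isLL_def using filter_id_conv length_filter_less by (metis less_irrefl)
          moreover have "length bs \<noteq> 1" using c 5(2) 4(1) by simp
          moreover have "filter isL bs \<noteq> []" using 4(3) by auto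
          ultimately show thesis by (rule that(3))
        qed (use that in \<open>auto simp: filter_empty_conv\<close>)
      qed
      then show ?thesis
      proof cases
        case 1 then show ?thesis using lab_zero[of "[]" bs] c(4) by (simp add: inner_def lab_none)
      next
        case 2
        then have "length bs \<noteq> 1" using length_filter_le[of isL bs] by linarith
        then show ?thesis using 2 by (intro lab_many) auto
      next
        case 3
        then show ?thesis by (intro lab_many) (auto simp: inner_def Suc_le_eq)
      next
        case 4 then show ?thesis using lab_zero[of "[]" bs] c(4) by (simp add: inner_def lab_many)
      qed
    qed
    then show ?thesis unfolding Jac_def by (rule ksum_zeroI)
  qed
  then have "Jac ([] @ filter isL us @ filter (\<lambda>u. \<not> isL u) us) = 0" by simp
  moreover have "Jac (us @ x # y # vs) = 0"
    if "set (us @ x # y # vs) \<subseteq> {u. tagged_ok u}" "Jac (us @ y # x # vs) = 0" for us vs x y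
    using that Jac_swap[of us x y vs] by auto
  ultimately have "Jac ([] @ us) = 0"
    using bring_to_front[where W = "{u. tagged_ok u}" and p = isL and Z = "\<lambda>us. Jac us = 0" and us = "[]" and xs = us]
      assms by (metis (no_types, lifting) append_Nil mem_Collect_eq subsetI)
  then show ?thesis by simp
qed

end

section \<open>The Nijenhuis--Richardson V-data\<close>

lemma vector_space_fun:
  assumes "vector_space s"
  shows "vector_space (\<lambda>c f x. s c (f x))"
proof -
  interpret vector_space s by fact
  show ?thesis
    by unfold_locales (auto simp: fun_eq_iff scale_right_distrib scale_left_distrib)
qed

section \<open>Alternating versus skew maps\<close>

context mlin_space
begin

lemma multilin_iff_mlin: "(\<forall>n. multilin sa sb n f) \<longleftrightarrow> mlin sa sb f"
proof
  assume *: "\<forall>n. multilin sa sb n f"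
  show "mlin sa sb f" unfolding mlin_def
  proof (intro allI)
    fix us c y z vs
    show "f (us @ (sa c y + z) # vs) = sb c (f (us @ y # vs)) + f (us @ z # vs)"
      using *[unfolded multilin_def, rule_format, of "us @ y # vs" "Suc (length us + length vs)" "length us" c y z]
      by simp
  qed
next
  assume *: "mlin sa sb f"
  show "\<forall>n. multilin sa sb n f" unfolding multilin_def
    by (auto simp: upd_conv_take_nth_drop mlinD[OF *])
qed

lemma skew_if_alternating:
  assumes f: "mlin sa sb f" and alt: "\<And>n. alternating n f"
  shows "skew f"
  unfolding skew_def
proof (intro allI)
  fix us x y vs
  have z: "f (us @ w # w # vs) = 0" for w
    using alt[of "length (us @ w # w # vs)", unfolded alternating_def, rule_format,
        of "us @ w # w # vs" "length us" "Suc (length us)"]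
    by (simp add: nth_append)
  have "f ((us @ [w]) @ (x + y) # vs) = f ((us @ [w]) @ x # vs) + f ((us @ [w]) @ y # vs)" for w
    by (rule mlin_add[OF f])
  then show "f (us @ x # y # vs) = - f (us @ y # x # vs)"
    using z[of "x + y"] z[of x] z[of y] by (simp add: mlin_add[OF f] eq_neg_iff_add_eq_0 add_ac)
qed

end

lemma (in vector_space) eq_minus_self_imp_0:
  fixes x :: 'b
  assumes "(2 :: 'a) \<noteq> 0" and "x = - x"
  shows "x = 0"
proof -
  have "scale 2 x = x + x" using scale_left_distrib[of 1 1 x] by simp
  also have "\<dots> = 0" using assms(2) by (simp add: eq_neg_iff_add_eq_0)
  finally show ?thesis using assms(1) by simp
qed

locale mlin_space_char0 = mlin_space sa sb
  for sa :: "'k::field_char_0 \<Rightarrow> 'a::ab_group_add \<Rightarrow> 'a" and sb :: "'k \<Rightarrow> 'b::ab_group_add \<Rightarrow> 'b"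
begin

text \<open>Exchanges of neighbours bring two equal entries together; there the value equals its own
  negative, hence is zero since 2 is invertible.\<close>

lemma alternating_if_skew:
  fixes f :: "'a list \<Rightarrow> 'b"
  assumes f: "skew f"
  shows "alternating n f"
  unfolding alternating_def
proof (intro allI impI)
  fix xs :: "'a list" and i j assume *: "length xs = n \<and> i < j \<and> j < n \<and> xs ! i = xs ! j"
  have z: "f (us @ x # ms @ x # vs) = 0" for us ms vs x
  proof (induction ms arbitrary: us)
    case Nil
    show ?case using skewD[OF f, of us x x vs] B.eq_minus_self_imp_0 by simp
  next
    case (Cons m ms)
    then show ?case using skewD[OF f, of us x m "ms @ x # vs"] Cons.IH[of "us @ [m]"] by simp
  qed
  have "xs = take j xs @ xs ! j # drop (Suc j) xs" using * by (simp add: id_take_nth_drop)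
  also have "take j xs = take i (take j xs) @ take j xs ! i # drop (Suc i) (take j xs)"
    using * by (intro id_take_nth_drop) simp
  finally have "xs = take i (take j xs) @ xs ! j # drop (Suc i) (take j xs) @ xs ! j # drop (Suc j) xs"
    using * by simp
  then show "f xs = 0" using z by metis
qed

lemma alt_maps_iff:
  "f \<in> alt_maps sa sb \<longleftrightarrow> f [] = 0 \<and> mlin sa sb f \<and> skew f \<and> finite (arity_set f)"
  unfolding alt_maps_def using multilin_iff_mlin[of f] skew_if_alternating[of f] alternating_if_skew[of f]
  by auto

end

section \<open>Bracket, embedding and projection on the direct sum\<close>

locale two_spaces = g: vector_space sg + h: vector_space sh
  for sg :: "'k::field_char_0 \<Rightarrow> 'g::ab_group_add \<Rightarrow> 'g" and sh :: "'k \<Rightarrow> 'h::ab_group_add \<Rightarrow> 'h"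
begin

abbreviation sV where "sV \<equiv> scaleV sg sh"

lemma vector_space_sV: "vector_space sV"
  by unfold_locales (auto simp: scaleV_def g.scale_right_distrib g.scale_left_distrib
      h.scale_right_distrib h.scale_left_distrib)

sublocale V: mlin_space1 sV
  unfolding mlin_space1_def mlin_space_def using vector_space_sV by simp

sublocale VV: mlin_space_char0 sV sV
  unfolding mlin_space_char0_def mlin_space_def using vector_space_sV by simp

sublocale F: mlin_space_char0 sg sh
  unfolding mlin_space_char0_def mlin_space_def using g.vector_space_axioms h.vector_space_axioms by simp

lemma Lsp_iff: "f \<in> Lsp sg sh \<longleftrightarrow> f [] = 0 \<and> mlin sV sV f \<and> skew f \<and> finite (arity_set f)"
  unfolding Lsp_def by (rule VV.alt_maps_iff)

lemma Fsp_iff: "\<theta> \<in> Fsp sg sh \<longleftrightarrow> \<theta> [] = 0 \<and> mlin sg sh \<theta> \<and> skew \<theta> \<and> finite (arity_set \<theta>)"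
  unfolding Fsp_def by (rule F.alt_maps_iff)

lemma arity_set_arity: "arity n f \<Longrightarrow> arity_set f \<subseteq> {nat n}"
  unfolding arity_set_def arity_def by auto

text \<open>The definition sums over first blocks of size at least 1; the condition on
  \<open>g []\<close> removes the additional term of \<open>circ\<close>.\<close>

lemma nr_comp_circ:
  assumes "mlin sV sV f" "g [] = 0"
  shows "nr_comp sV f g vs = circ f g vs"
proof -
  have "sV (of_int (sign \<sigma>)) x = pm (koszul_exp (\<lambda>_. 1) \<sigma> (length vs)) x"
    if "\<sigma> \<in> shuffles p (length vs - p)" "p \<in> {1..length vs}" for \<sigma> p x
    using that by (subst sign_psgn[of _ "length vs"]) (auto simp: shuffles_def V.A.scale_psgn)
  then have "nr_comp sV f g vs = (\<Sum>p\<in>{1..length vs}. \<Sum>\<sigma>\<in>shuffles p (length vs - p).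
      pm (koszul_exp (\<lambda>_. 1) \<sigma> (length vs)) (f (g (pick \<sigma> vs 0 p) # pick \<sigma> vs p (length vs))))"
    unfolding nr_comp_def Let_def by (intro sum.cong refl) auto
  then show ?thesis
    unfolding circ_def
    using sum_all_shuffles[of vs "length vs" "\<lambda>as bs. f (g as # bs)" "\<lambda>_. 1"] assms
    by (simp add: V.mlin_00)
qed

lemma nr_bracket_brk:
  assumes f: "mlin sV sV f" "f [] = 0" "arity (d + 1) f" and g: "mlin sV sV g" "g [] = 0" "arity (e + 1) g"
  shows "nr_bracket sV f g = V.brk d e f g"
proof -
  have r: "restr (nat n) f = f" if "arity n f" for n and f :: "('g \<times> 'h) list \<Rightarrow> 'g \<times> 'h"
    using that by (auto simp: restr_def arity_def fun_eq_iff)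
  have a: "arity_set f = (if f = (\<lambda>_. 0) then {} else {nat n})" if "arity n f"
    for n and f :: "('g \<times> 'h) list \<Rightarrow> 'g \<times> 'h"
    using that by (auto simp: arity_set_def arity_def fun_eq_iff) (metis nat_int)
  show ?thesis
  proof (cases "f = (\<lambda>_. 0) \<or> g = (\<lambda>_. 0)")
    case True
    then show ?thesis
      using f(1) g(1) by (auto simp: nr_bracket_def V.brk_def a[OF f(3)] a[OF g(3)] circ_def V.mlin_00)
  next
    case False
    \<comment> \<open>A nonzero map vanishing on the empty list has arity at least 1, so the
      truncated subtractions \<open>m - 1\<close> and \<open>n - 1\<close> in the exponent are the
      true degrees.\<close>
    then have "0 \<le> d" "0 \<le> e"
      using f(2,3) g(2,3) by (auto simp: arity_def fun_eq_iff) (metis length_0_conv of_nat_0_eq_iff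
       of_nat_0_le_iff zle_add1_eq_le linorder_not_less order_le_less)+
    then have "(nat (d + 1) - 1) * (nat (e + 1) - 1) = nat (d * e)" "0 \<le> d * e"
      by (simp_all add: nat_mult_distrib nat_add_distrib)
    moreover have "(- 1) ^ nat k = (psgn k :: 'k)" if "0 \<le> k" for k
      using that by (simp add: psgn_def even_nat_iff minus_one_power_iff)
    ultimately show ?thesis using False
      by (simp add: nr_bracket_def V.brk_def a[OF f(3)] a[OF g(3)] r[OF f(3)] r[OF g(3)]
          nr_comp_circ f g V.A.scale_psgn)
  qed
qed

lemma shuffles_right_0: "shuffles n 0 = {id}"
proof -
  have "\<sigma> = id" if "\<sigma> \<in> shuffles n 0" for \<sigma>
  proof -
    have "\<sigma> ` {..<n} = {..<n}" using that permutes_image[of \<sigma> "{0..<n}"] by (simp add: shuffles_def lessThan_atLeast0)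
    then have "map \<sigma> [0..<n] = [0..<n]"
      using shuffle_image(4)[OF that] by (simp add: nths_all)
    then have "\<sigma> i = i" if "i < n" for i using that by (simp add: list_eq_iff_nth_eq)
    moreover have "\<sigma> i = i" if "\<not> i < n" for i
      using \<open>\<sigma> \<in> shuffles n 0\<close> that by (auto simp: shuffles_def permutes_def)
    ultimately show ?thesis by (auto simp: fun_eq_iff)
  qed
  moreover have "id \<in> shuffles n 0" by (auto simp: shuffles_def permutes_id)
  ultimately show ?thesis by blast
qed

lemma emb_eq: "emb sh \<theta> vs = (0, \<theta> (map fst vs))"
  by (simp add: emb_def lift_def shuffles_right_0 pick_def map_nth comp_def)

definition Gsp :: "int \<Rightarrow> ('g, 'h) Lmap set" where
  "Gsp d = {f. f [] = 0 \<and> mlin sV sV f \<and> skew f \<and> arity (d + 1) f}"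

definition Hsp :: "int \<Rightarrow> ('g, 'h) Fmap set" where
  "Hsp d = {\<theta>. \<theta> [] = 0 \<and> mlin sg sh \<theta> \<and> skew \<theta> \<and> arity (d + 1) \<theta>}"

abbreviation sL where "sL \<equiv> \<lambda>c f vs. sV c (f vs)"
abbreviation sF where "sF \<equiv> \<lambda>c \<theta> xs. sh c (\<theta> xs)"

lemma Gsp_Lsp: "f \<in> Gsp d \<longleftrightarrow> f \<in> Lsp sg sh \<and> arity (d + 1) f"
  using arity_set_arity[of "d + 1" f] finite_subset by (auto simp: Gsp_def Lsp_iff)

lemma Hsp_Fsp: "\<theta> \<in> Hsp d \<longleftrightarrow> \<theta> \<in> Fsp sg sh \<and> arity (d + 1) \<theta>"
  using arity_set_arity[of "d + 1" \<theta>] finite_subset by (auto simp: Hsp_def Fsp_iff)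

lemma brk_Gsp: "f \<in> Gsp d \<Longrightarrow> g \<in> Gsp e \<Longrightarrow> nr_bracket sV f g = V.brk d e f g"
  by (intro nr_bracket_brk) (auto simp: Gsp_def)

lemma arity_lin: "arity n f \<Longrightarrow> arity n g \<Longrightarrow> s c 0 = 0 \<Longrightarrow> arity n (\<lambda>vs. s c (f vs) + g vs)"
  for f g :: "_ \<Rightarrow> 'c::ab_group_add"
  unfolding arity_def by (metis add.right_neutral)

lemma Gsp_lin: "f \<in> Gsp d \<Longrightarrow> g \<in> Gsp d \<Longrightarrow> sL c f + g \<in> Gsp d"
  by (auto simp: Gsp_def plus_fun_def V.mlin_lin V.skew_lin arity_lin[where s=sV])

lemma Hsp_lin: "f \<in> Hsp d \<Longrightarrow> g \<in> Hsp d \<Longrightarrow> sF c f + g \<in> Hsp d"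
  by (auto simp: Hsp_def plus_fun_def F.mlin_lin F.skew_lin arity_lin[where s=sh])

lemma brk_Gsp_closed:
  assumes "f \<in> Gsp d" "g \<in> Gsp e"
  shows "nr_bracket sV f g \<in> Gsp (d + e)"
proof -
  \<comment> \<open>A scalar multiple plus a map is the shape that the closure lemmas for linear
    combinations accept.\<close>
  have "V.brk d e f g = (\<lambda>vs. sV (- (if even (d * e) then 1 else -1)) (circ g f vs) + circ f g vs)"
    by (auto simp: V.brk_def fun_eq_iff pm_def)
  then obtain k where e: "V.brk d e f g = (\<lambda>vs. sV k (circ g f vs) + circ f g vs)" by blast
  have "circ f g [] = 0" "circ g f [] = 0" using assms by (simp_all add: circ_def Gsp_def V.mlin_00)
  moreover have "arity (d + e + 1) (circ f g)" "arity (d + e + 1) (circ g f)"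
    using assms V.arity_circ[of f "d + 1" "e + 1" g] V.arity_circ[of g "e + 1" "d + 1" f]
    by (auto simp: Gsp_def algebra_simps)
  ultimately show ?thesis unfolding brk_Gsp[OF assms] unfolding e using assms
    by (auto simp: Gsp_def intro!: V.mlin_lin V.skew_lin V.mlin_circ V.skew_circ arity_lin[where s=sV])
qed

lemma projF_Hsp: "f \<in> Gsp d \<Longrightarrow> projF f \<in> Hsp d"
proof -
  assume f: "f \<in> Gsp d"
  have lin: "(sg c y + z, 0) = sV c (y, 0) + (z, 0)" for c y z by (simp add: scaleV_def)
  have "mlin sg sh (projF f)" using f
    by (auto simp: mlin_def projF_def lin Gsp_def) (simp add: mlinD scaleV_def)
  moreover have "skew (projF f)" unfolding skew_def
  proof (intro allI)
    fix us x y vs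
    have "f (map (\<lambda>x. (x, 0)) us @ (x, 0) # (y, 0) # map (\<lambda>x. (x, 0)) vs)
      = - f (map (\<lambda>x. (x, 0)) us @ (y, 0) # (x, 0) # map (\<lambda>x. (x, 0)) vs)"
      by (rule skewD) (use f in \<open>simp add: Gsp_def\<close>)
    then show "projF f (us @ x # y # vs) = - projF f (us @ y # x # vs)" by (simp add: projF_def)
  qed
  moreover have "arity (d + 1) (projF f)" unfolding arity_def projF_def
  proof (intro allI impI)
    fix xs assume "snd (f (map (\<lambda>x. (x, 0)) xs)) \<noteq> 0"
    then have "f (map (\<lambda>x. (x, 0)) xs) \<noteq> 0" by auto
    then show "int (length xs) = d + 1" using f by (fastforce simp: Gsp_def arity_def)
  qed
  ultimately show ?thesis using f by (simp add: Hsp_def Gsp_def projF_def)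
qed

lemma emb_Gsp: "\<theta> \<in> Hsp d \<Longrightarrow> emb sh \<theta> \<in> Gsp d"
proof -
  assume \<theta>: "\<theta> \<in> Hsp d"
  have "mlin sV sV (emb sh \<theta>)" using \<theta> by (auto simp: mlin_def emb_eq scaleV_def Hsp_def)
  moreover have "skew (emb sh \<theta>)" unfolding skew_def
  proof (intro allI)
    fix us vs :: "('g \<times> 'h) list" and x y :: "'g \<times> 'h"
    have "\<theta> (map fst us @ fst x # fst y # map fst vs) = - \<theta> (map fst us @ fst y # fst x # map fst vs)"
      by (rule skewD) (use \<theta> in \<open>simp add: Hsp_def\<close>)
    then show "emb sh \<theta> (us @ x # y # vs) = - emb sh \<theta> (us @ y # x # vs)" by (simp add: emb_eq)
  qed
  moreover have "arity (d + 1) (emb sh \<theta>)"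
    using \<theta> by (fastforce simp: arity_def emb_eq Hsp_def zero_prod_def)
  ultimately show ?thesis using \<theta> by (simp add: Gsp_def Hsp_def emb_eq zero_prod_def)
qed

text \<open>The value of \<open>y\<close> on g-arguments is split into its two components. The
  h-component is what the embedding of \<open>projF y\<close> keeps; with the g-component all
  arguments of \<open>x\<close> lie in g, so only \<open>projF x\<close> is seen.\<close>

lemma projF_circ:
  assumes x: "mlin sV sV x"
  shows "projF (circ x y) = projF (circ (emb sh (projF x)) y) + projF (circ x (emb sh (projF y)))"
proof
  fix xs
  let ?i = "map (\<lambda>x. (x, 0)) :: 'g list \<Rightarrow> ('g \<times> 'h) list"
  have sndk: "snd (ksum deg xs \<Phi>) = ksum deg xs (\<lambda>as bs. snd (\<Phi> as bs))" for deg and xs :: "'g list" and \<Phi> :: "_ \<Rightarrow> _ \<Rightarrow> 'g \<times> 'h"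
    by (rule additive_ksum) simp
  have c: "projF (circ x y) xs = ksum (\<lambda>_. 1) xs (\<lambda>as bs. snd (x (y (?i as) # ?i bs)))" for x y
    by (simp add: projF_def circ_def ksum_map sndk comp_def)
  have i: "map fst (?i bs) = bs" for bs by (simp add: comp_def)
  have "snd (x (y (?i as) # ?i bs)) = snd (emb sh (projF x) (y (?i as) # ?i bs)) + snd (x (emb sh (projF y) (?i as) # ?i bs))" for as bs
  proof -
    have "y (?i as) = (fst (y (?i as)), 0) + (0, snd (y (?i as)))" by simp
    then have "x (y (?i as) # ?i bs) = x ((fst (y (?i as)), 0) # ?i bs) + x ((0, snd (y (?i as))) # ?i bs)"
      using V.mlin_add0[OF x] by metis
    then show ?thesis by (simp add: emb_eq projF_def i del: map_map)
  qed
  then show "projF (circ x y) xs = (projF (circ (emb sh (projF x)) y) + projF (circ x (emb sh (projF y)))) xs"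
    by (simp add: c ksum_add)
qed

lemma projF_brk: "projF (V.brk d e f g) xs = projF (circ f g) xs - pm (d * e) (projF (circ g f) xs)"
  by (simp add: projF_def V.brk_def pm_def)

lemma projF_br:
  assumes f: "f \<in> Gsp d" and g: "g \<in> Gsp e"
  shows "projF (nr_bracket sV f g) = projF (nr_bracket sV (emb sh (projF f)) g) + projF (nr_bracket sV f (emb sh (projF g)))"
proof -
  have "mlin sV sV f" "mlin sV sV g" using f g by (auto simp: Gsp_def)
  note p = projF_circ[OF this(1), of g] projF_circ[OF this(2), of f]
  have P: "emb sh (projF f) \<in> Gsp d" "emb sh (projF g) \<in> Gsp e" using f g by (auto intro: emb_Gsp projF_Hsp)
  show ?thesis unfolding brk_Gsp[OF f g] brk_Gsp[OF P(1) g] brk_Gsp[OF f P(2)]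
    by (auto simp: fun_eq_iff projF_brk p pm_add)
qed

sublocale vdata sL sF Gsp Hsp "nr_bracket sV" projF "emb sh"
proof (intro vdata.intro vdata_axioms.intro)
  show "vector_space sL" "vector_space sF"
    using vector_space_fun[OF vector_space_sV] vector_space_fun[OF h.vector_space_axioms] by auto
next
  fix d show "0 \<in> Gsp d" "0 \<in> Hsp d"
    by (simp_all add: Gsp_def Hsp_def mlin_def skew_def arity_def)
next
  fix f g d c assume "f \<in> Gsp d" "g \<in> Gsp d"
  then show "sL c f + g \<in> Gsp d" by (rule Gsp_lin)
next
  fix f g d c assume "f \<in> Hsp d" "g \<in> Hsp d"
  then show "sF c f + g \<in> Hsp d" by (rule Hsp_lin)
next
  fix f g d e assume "f \<in> Gsp d" "g \<in> Gsp e"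
  then show "nr_bracket sV f g \<in> Gsp (d + e)" by (rule brk_Gsp_closed)
next
  fix x y z m n c assume x: "x \<in> Gsp m" "y \<in> Gsp m" and z: "z \<in> Gsp n"
  have "circ z (\<lambda>vs. sV c (x vs) + y vs) vs = sV c (circ z x vs) + circ z y vs" for vs
    using z by (intro V.circ_linr) (simp add: Gsp_def)
  then show "nr_bracket sV (sL c x + y) z = sL c (nr_bracket sV x z) + nr_bracket sV y z"
    unfolding brk_Gsp[OF Gsp_lin[OF x] z] brk_Gsp[OF x(1) z] brk_Gsp[OF x(2) z]
    by (auto simp: fun_eq_iff V.brk_def plus_fun_def V.circ_linl pm_add V.A.scale_pm V.A.scale_right_diff_distrib)
next
  fix x y m n assume x: "x \<in> Gsp m" and y: "y \<in> Gsp n"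
  show "nr_bracket sV x y = - pm (m * n) (nr_bracket sV y x)"
    unfolding brk_Gsp[OF x y] brk_Gsp[OF y x] by (auto simp: V.brk_def fun_eq_iff pm_def)
next
  fix x y z l m n assume x: "x \<in> Gsp l" and y: "y \<in> Gsp m" and z: "z \<in> Gsp n"
  note c = brk_Gsp_closed[OF x y] brk_Gsp_closed[OF y z] brk_Gsp_closed[OF x z]
  show "nr_bracket sV (nr_bracket sV x y) z
      = nr_bracket sV x (nr_bracket sV y z) + pm (m * n) (nr_bracket sV (nr_bracket sV x z) y)"
    unfolding brk_Gsp[OF c(1) z] brk_Gsp[OF x c(2)] brk_Gsp[OF c(3) y]
    unfolding brk_Gsp[OF x y] brk_Gsp[OF y z] brk_Gsp[OF x z]
    by (rule V.brk_jacobi) (use x y z in \<open>auto simp: Gsp_def\<close>)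
next
  fix x d assume "x \<in> Gsp d" then show "projF x \<in> Hsp d" by (rule projF_Hsp)
next
  fix x y d c show "projF (sL c x + y) = sF c (projF x) + projF y"
    by (simp add: projF_def fun_eq_iff scaleV_def)
next
  fix \<theta> d assume "\<theta> \<in> Hsp d" then show "emb sh \<theta> \<in> Gsp d" by (rule emb_Gsp)
next
  fix \<theta> \<eta> d c show "emb sh (sF c \<theta> + \<eta>) = sL c (emb sh \<theta>) + emb sh \<eta>"
    by (simp add: emb_eq fun_eq_iff scaleV_def)
next
  fix \<theta> \<eta> m n assume *: "\<theta> \<in> Hsp m" "\<eta> \<in> Hsp n"
  \<comment> \<open>The inner map takes values in h, the outer one depends only on
    g-components.\<close>
  have "circ (emb sh \<theta>) (emb sh \<eta>) vs = 0" if "\<theta> \<in> Hsp m" for \<theta> \<eta> m vs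
    using that unfolding circ_def by (intro ksum_zeroI) (simp add: emb_eq Hsp_def F.mlin_0[of _ "[]", simplified] zero_prod_def)
  then show "nr_bracket sV (emb sh \<theta>) (emb sh \<eta>) = 0"
    unfolding brk_Gsp[OF emb_Gsp emb_Gsp, OF *] using * by (simp add: V.brk_def fun_eq_iff)
next
  fix x y m n assume "x \<in> Gsp m" "y \<in> Gsp n"
  then show "projF (nr_bracket sV x y) = projF (nr_bracket sV (emb sh (projF x)) y)
      + projF (nr_bracket sV x (emb sh (projF y)))"
    by (rule projF_br)
qed

end

section \<open>The brackets on \<open>s\<^sup>-\<^sup>1 L \<oplus> F\<close>\<close>

lemma koszul_exp_cong:
  assumes "\<sigma> permutes {0..<n}" "\<And>i. i < n \<Longrightarrow> d i = e i"
  shows "koszul_exp d \<sigma> n = koszul_exp e \<sigma> n"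
proof -
  have "\<sigma> i < n" if "i < n" for i using permutes_in_image[OF assms(1), of i] that by simp
  then show ?thesis unfolding koszul_exp_def using assms(2)
    by (intro sum.cong refl) (auto simp: inversions_def)
qed

context two_spaces
begin

abbreviation sE where "sE \<equiv> scaleE sg sh"
abbreviation LF where "LF \<equiv> Lsp sg sh \<times> Fsp sg sh"

lemma sE_scaleP: "sE = scaleP"
  by (auto simp: scaleE_def scaleP_def fun_eq_iff)

lemma vector_space_sE: "vector_space sE"
  by unfold_locales
    (auto simp: scaleE_def fun_eq_iff prod_eq_iff A.scale_right_distrib[unfolded fun_eq_iff, simplified] V.A.scale_right_distrib
      V.A.scale_left_distrib h.scale_right_distrib h.scale_left_distrib)

sublocale E: vector_space sE by (rule vector_space_sE)

text \<open>The definition of the brackets locates L-entries by their indices, \<open>lab\<close> by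
  splitting the list; the shapes in \<open>lab_cases\<close> match the branches of the
  definition.\<close>

lemma lpure_lab:
  assumes "length c = length ps"
  shows "lpure sg sh c ps = lab (map2 (\<lambda>t x. (fst t, tagdeg t, x)) c ps)" (is "_ = lab ?us")
proof -
  define k where "k = length c"
  define Ls where "Ls = filter (\<lambda>i. fst (c ! i)) [0..<k]"
  have us: "?us = map (\<lambda>i. (fst (c ! i), tagdeg (c ! i), ps ! i)) [0..<k]"
    using assms by (intro nth_equalityI) (auto simp: k_def)
  have k: "length ?us = k" using assms by (simp add: k_def)
  have fil: "filter isL ?us = map (\<lambda>i. (fst (c ! i), tagdeg (c ! i), ps ! i)) Ls"
    unfolding us Ls_def by (simp add: filter_map comp_def)
  have L: "lpure sg sh c ps = (if k = 1 then (if fst (c ! 0) then (0, projF (fst (ps ! 0))) else 0)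
     else if k = 2 \<and> Ls = [0, 1] then
       (pm (int (snd (c ! 0)) - 1) (nr_bracket sV (fst (ps ! 0)) (fst (ps ! 1))), 0)
     else if 2 \<le> k \<and> length Ls = 1 then
       (0, pm (tagdeg (c ! hd Ls) * (\<Sum>i<hd Ls. tagdeg (c ! i)))
          (projF (foldl (\<lambda>a \<theta>. nr_bracket sV a (emb sh \<theta>)) (fst (ps ! hd Ls))
             (map snd (take (hd Ls) ps @ drop (Suc (hd Ls)) ps)))))
     else 0)"
  proof -
    have "(\<lambda>vs. sV (psgn d) (F vs)) = pm d F" for d and F :: "('g, 'h) Lmap" by (simp add: V.A.scale_psgn fun_eq_iff pm_fun[of d F])
    moreover have "(\<lambda>xs. sh (psgn d) (F xs)) = pm d F" for d and F :: "('g, 'h) Fmap" by (simp add: h.scale_psgn fun_eq_iff pm_fun[of d F])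
    ultimately show ?thesis
      unfolding lpure_def Let_def k_def[symmetric] Ls_def[symmetric] by (simp only:)
  qed
  show ?thesis
  proof (cases ?us rule: lab_cases)
    case 1
    then have "filter isL ?us = []" by (simp add: filter_empty_conv)
    then have "Ls = []" using fil by simp
    moreover have "\<not> fst (c ! 0)" if "k = 1"
      using \<open>Ls = []\<close> that by (auto simp: Ls_def filter_empty_conv)
    ultimately show ?thesis unfolding L lab_none[OF 1] by simp
  next
    case (2 as t bs)
    let ?j = "length as"
    have j: "?j < k" using arg_cong[OF 2(1), of length] k by simp
    have i: "(as @ t # bs) ! i = (fst (c ! i), tagdeg (c ! i), ps ! i)" if "i < k" for i
      unfolding 2(1)[symmetric] us using that by simp
    have lbs: "k = ?j + Suc (length bs)" using arg_cong[OF 2(1), of length] k by simp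
    have t: "t = (True, tagdeg (c ! ?j), ps ! ?j)" using i[OF j] 2(4) by simp
    have "fst (c ! i) \<longleftrightarrow> i = ?j" if "i < k" for i
    proof -
      have "fst (c ! i) \<longleftrightarrow> isL ((as @ t # bs) ! i)" using i[OF that] by simp
      also have "\<dots> \<longleftrightarrow> i = ?j"
        using 2(2-4) that lbs by (cases i ?j rule: linorder_cases) (auto simp: nth_append nth_Cons')
      finally show ?thesis .
    qed
    then have "Ls = filter (\<lambda>i. i = ?j) [0..<k]" unfolding Ls_def by (intro filter_cong) auto
    also have "[0..<k] = [0..<?j] @ ?j # [Suc ?j..<k]"
      using j by (metis le_add_same_cancel1 less_imp_le upt_conv_Cons upt_add_eq_append le_add_diff_inverse zero_le add_0)
    finally have Ls: "Ls = [?j]" by (simp add: filter_empty_conv)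
    have "map vF (as @ bs) = map snd (take ?j ps @ drop (Suc ?j) ps)"
    proof -
      have "map (\<lambda>u. snd (snd u)) (as @ t # bs) = ps"
        unfolding 2(1)[symmetric] using assms by (simp add: comp_def case_prod_unfold)
      then have "map (\<lambda>u. snd (snd u)) as = take ?j ps" "map (\<lambda>u. snd (snd u)) bs = drop (Suc ?j) ps" by auto
      then show ?thesis by (simp flip: \<open>map _ as = _\<close> \<open>map _ bs = _\<close> add: comp_def)
    qed
    moreover have "ad (vL t) (as @ bs) = foldl (\<lambda>a \<theta>. nr_bracket sV a (emb sh \<theta>)) (vL t) (map vF (as @ bs))"
      by (simp only: ad_def foldl_map)
    moreover have "dgs as = (\<Sum>i<?j. tagdeg (c ! i))"
    proof -
      have "dg (as ! i) = tagdeg (c ! i)" if "i < ?j" for i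
        using i[of i] that j by (simp add: nth_append)
      then show ?thesis unfolding sum_list_sum_nth by (auto simp: atLeast0LessThan intro!: sum.cong)
    qed
    ultimately have "lab ?us = (0, pm (tagdeg (c ! ?j) * (\<Sum>i<?j. tagdeg (c ! i)))
          (projF (foldl (\<lambda>a \<theta>. nr_bracket sV a (emb sh \<theta>)) (fst (ps ! ?j))
             (map snd (take ?j ps @ drop (Suc ?j) ps)))))"
      unfolding 2(1) lab_one[OF 2(2-4)] by (simp add: t del: ad_append)
    moreover have "length ps = k" using assms k_def by simp
    \<comment> \<open>For \<open>k = 1\<close> both blocks are empty, so the iterated bracket is the
      L-entry itself and the sign is trivial.\<close>
    ultimately show ?thesis unfolding L Ls using j Ls
      by (cases "k = 1") (auto simp: Ls_def split: if_splits)
  next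
    case (3 u v)
    then have "k = 2" using k by simp
    then obtain c0 c1 p0 p1 where c: "c = [c0, c1]" "ps = [p0, p1]" using assms
      by (auto simp: k_def length_Suc_conv numeral_2_eq_2)
    have "Ls = [0, 1]" "fst c0" "fst c1" using 3 \<open>k = 2\<close> by (auto simp: Ls_def c upt_rec)
    then show ?thesis unfolding L using \<open>k = 2\<close> by (simp add: c lab_LL tagdeg_def algebra_simps)
  next
    case 4
    then have "2 \<le> length Ls" "k \<noteq> 2" using fil k by auto
    moreover have "length Ls \<le> k" unfolding Ls_def by (metis length_filter_le length_upt minus_nat.diff_0)
    ultimately show ?thesis unfolding L lab_many[OF 4] by auto
  qed
qed

section \<open>Decomposition of arguments into pure pieces\<close>

definition tag_piece :: "bool \<times> nat \<Rightarrow> ('g, 'h) elt \<Rightarrow> (('g, 'h) Lmap, ('g, 'h) Fmap) tagged" where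
  "tag_piece t x = (fst t, tagdeg t, piece t x)"

lemma restr_mlin: "mlin sa sb f \<Longrightarrow> (\<And>c. sb c 0 = 0) \<Longrightarrow> mlin sa sb (restr n f)"
  by (auto simp: mlin_def restr_def)

lemma restr_skew: "skew f \<Longrightarrow> skew (restr n f)"
proof -
  assume f: "skew f"
  have "restr n f (us @ x # y # vs) = - restr n f (us @ y # x # vs)" for us x y vs
    using skewD[OF f, of us x y vs] by (simp add: restr_def)
  then show ?thesis unfolding skew_def by blast
qed

lemma restr_arity: "arity (int n) (restr n f)"
  by (auto simp: arity_def restr_def)

lemma restr_Gsp: "f \<in> Lsp sg sh \<Longrightarrow> restr n f \<in> Gsp (int n - 1)"
  using restr_arity[of n f] by (auto simp: Gsp_def Lsp_iff restr_mlin restr_skew, simp add: restr_def)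

lemma restr_Hsp: "f \<in> Fsp sg sh \<Longrightarrow> restr n f \<in> Hsp (int n - 1)"
  using restr_arity[of n f] by (auto simp: Hsp_def Fsp_iff restr_mlin restr_skew, simp add: restr_def)

lemma tagged_ok_tag_piece: "x \<in> LF \<Longrightarrow> tagged_ok (tag_piece t x)"
  using restr_Gsp[of "fst x" "snd t"] restr_Hsp[of "snd x" "snd t"]
  by (auto simp: tagged_ok_def tag_piece_def piece_def tagdeg_def)

lemma wfs_tag_piece: "set xs \<subseteq> LF \<Longrightarrow> wfs (map2 tag_piece c xs)"
  by (auto simp: tagged_ok_tag_piece dest!: set_zip_rightD)

lemma piece_0: "t \<notin> tags x \<Longrightarrow> piece t x = 0"
  by (cases t; cases "fst t") (auto simp: tags_def piece_def arity_set_def restr_def fun_eq_iff zero_prod_def)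

lemma lab_zero_in: "wfs us \<Longrightarrow> u \<in> set us \<Longrightarrow> snd (snd u) = 0 \<Longrightarrow> lab us = 0"
proof -
  assume *: "wfs us" "u \<in> set us" "snd (snd u) = 0"
  then obtain as bs where us: "us = as @ u # bs" by (meson split_list)
  have "u = (isL u, dg u, 0)" using *(3) by (simp add: prod_eq_iff)
  then show ?thesis using lab_zero[of as bs "isL u" "dg u"] *(1) us by simp
qed

lemma lbr_lab:
  assumes "length xs = k"
  shows "lbr sg sh k xs = (\<Sum>c | length c = k \<and> (\<forall>i<k. c ! i \<in> tags (xs ! i)). lab (map2 tag_piece c xs))"
proof -
  have "map2 (\<lambda>t x. (fst t, tagdeg t, x)) c (map2 piece c xs) = map2 tag_piece c xs" for c
    by (intro nth_equalityI) (auto simp: tag_piece_def)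
  then show ?thesis unfolding lbr_def using assms
    by (auto intro!: sum.cong simp: lpure_lab)
qed

text \<open>Tags outside \<open>tags x\<close> give the zero piece and hence zero brackets.
  Enlarging the index set lets brackets of different arguments be compared term by term.\<close>

lemma lbr_superset:
  assumes "length xs = k" "set xs \<subseteq> LF" "finite A" "\<And>x. x \<in> set xs \<Longrightarrow> tags x \<subseteq> A"
  shows "lbr sg sh k xs = (\<Sum>c | set c \<subseteq> A \<and> length c = k. lab (map2 tag_piece c xs))"
  unfolding lbr_lab[OF assms(1)]
proof (rule sum.mono_neutral_left)
  show "finite {c. set c \<subseteq> A \<and> length c = k}" by (rule finite_lists_length_eq[OF assms(3)])
  show "{c. length c = k \<and> (\<forall>i<k. c ! i \<in> tags (xs ! i))} \<subseteq> {c. set c \<subseteq> A \<and> length c = k}"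
  proof (intro subsetI CollectI conjI)
    fix c t assume c: "c \<in> {c. length c = k \<and> (\<forall>i<k. c ! i \<in> tags (xs ! i))}" and "t \<in> set c"
    then obtain i where i: "i < k" "t = c ! i" by (auto simp: in_set_conv_nth)
    then show "t \<in> A" using assms(4)[of "xs ! i"] c assms(1) by auto
  qed auto
  show "\<forall>c\<in>{c. set c \<subseteq> A \<and> length c = k} - {c. length c = k \<and> (\<forall>i<k. c ! i \<in> tags (xs ! i))}. lab (map2 tag_piece c xs) = 0"
  proof
    fix c assume "c \<in> {c. set c \<subseteq> A \<and> length c = k} - {c. length c = k \<and> (\<forall>i<k. c ! i \<in> tags (xs ! i))}"
    then obtain i where i: "i < k" "c ! i \<notin> tags (xs ! i)" "length c = k" by auto
    then have "tag_piece (c ! i) (xs ! i) \<in> set (map2 tag_piece c xs)"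
      using assms(1) nth_mem[of i "map2 tag_piece c xs"] by simp
    then show "lab (map2 tag_piece c xs) = 0"
      using wfs_tag_piece[OF assms(2)] i(2) by (intro lab_zero_in) (auto simp: tag_piece_def piece_0)
  qed
qed

lemma finite_tags: "x \<in> LF \<Longrightarrow> finite (tags x)"
  by (auto simp: tags_def Lsp_iff Fsp_iff)

lemma arity_set_lin: "s c 0 = 0 \<Longrightarrow> arity_set (\<lambda>vs. s c (f vs) + g vs) \<subseteq> arity_set f \<union> arity_set g"
  for f g :: "_ \<Rightarrow> 'c::ab_group_add"
  unfolding arity_set_def by auto

lemma Lsp_lin: "f \<in> Lsp sg sh \<Longrightarrow> g \<in> Lsp sg sh \<Longrightarrow> sL c f + g \<in> Lsp sg sh"
  using finite_subset[OF arity_set_lin[of sV c f g]]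
  by (auto simp: Lsp_iff plus_fun_def V.mlin_lin V.skew_lin)

lemma Fsp_lin: "f \<in> Fsp sg sh \<Longrightarrow> g \<in> Fsp sg sh \<Longrightarrow> sF c f + g \<in> Fsp sg sh"
  using finite_subset[OF arity_set_lin[of sh c f g]]
  by (auto simp: Fsp_iff plus_fun_def F.mlin_lin F.skew_lin)

lemma zero_Lsp: "0 \<in> Lsp sg sh" and zero_Fsp: "0 \<in> Fsp sg sh"
  by (simp_all add: Lsp_iff Fsp_iff mlin_def skew_def arity_set_def)

lemma LF_lin: "x \<in> LF \<Longrightarrow> y \<in> LF \<Longrightarrow> sE c x + y \<in> LF"
  by (auto simp: scaleE_def intro: Lsp_lin Fsp_lin)

lemma tag_piece_lin: "tag_piece t (sE c y + z) = (fst t, tagdeg t, scaleP c (piece t y) + piece t z)"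
  by (auto simp: tag_piece_def piece_def scaleE_def scaleP_def restr_def fun_eq_iff)

lemma lbr_slot:
  assumes "length xs = k" "set xs \<subseteq> LF" "i < k" "y \<in> LF" "z \<in> LF"
  shows "lbr sg sh k (xs[i := sE c y + z]) = sE c (lbr sg sh k (xs[i := y])) + lbr sg sh k (xs[i := z])"
proof -
  \<comment> \<open>The tags of the combination may be fewer than those of \<open>y\<close> and
    \<open>z\<close> because of cancellation; one common index set serves all three sums.\<close>
  define A where "A = (\<Union>x\<in>set xs \<union> {y, z, sE c y + z}. tags x)"
  have w: "sE c y + z \<in> LF" using assms(4,5) by (rule LF_lin)
  have "finite A" unfolding A_def using finite_tags assms w by (intro finite_UN_I) auto
  then have l: "lbr sg sh k (xs[i := v]) = (\<Sum>cs | set cs \<subseteq> A \<and> length cs = k. lab (map2 tag_piece cs (xs[i := v])))"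
    if vin: "v \<in> {y, z, sE c y + z}" for v
  proof (intro lbr_superset)
    have v: "set (xs[i := v]) \<subseteq> insert v (set xs)" by (rule set_update_subset_insert)
    moreover have "v \<in> LF" using vin assms(4,5) w by blast
    ultimately show "set (xs[i := v]) \<subseteq> LF" using assms(2) by blast
    show "tags x \<subseteq> A" if "x \<in> set (xs[i := v])" for x
      using v vin that unfolding A_def by blast
  qed (use assms in auto)
  have u: "map2 tag_piece cs (xs[i := v]) = take i (map2 tag_piece cs xs) @ tag_piece (cs ! i) v # drop (Suc i) (map2 tag_piece cs xs)"
    if "length cs = k" for cs v
  proof -
    have "zip cs (xs[i := v]) = (zip cs xs)[i := (cs ! i, v)]"
      using zip_update[of cs i "cs ! i" xs v] by simp
    then show ?thesis using that assms(1,3) by (simp add: upd_conv_take_nth_drop take_map drop_map)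
  qed
  have "lab (map2 tag_piece cs (xs[i := sE c y + z])) = sE c (lab (map2 tag_piece cs (xs[i := y]))) + lab (map2 tag_piece cs (xs[i := z]))"
    if "length cs = k" for cs
    unfolding u[OF that] sE_scaleP tag_piece_lin[unfolded sE_scaleP] tag_piece_def[of _ y] tag_piece_def[of _ z]
  proof (rule lab_slot)
    have "wfs (map2 tag_piece cs xs)" by (rule wfs_tag_piece[OF assms(2)])
    then show "wfs (take i (map2 tag_piece cs xs))" "wfs (drop (Suc i) (map2 tag_piece cs xs))"
      by (meson in_set_takeD in_set_dropD)+
    show "tagged_ok (fst (cs ! i), tagdeg (cs ! i), piece (cs ! i) y)" "tagged_ok (fst (cs ! i), tagdeg (cs ! i), piece (cs ! i) z)"
      using tagged_ok_tag_piece[OF assms(4), of "cs ! i"] tagged_ok_tag_piece[OF assms(5), of "cs ! i"] by (simp_all add: tag_piece_def)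
  qed
  then show ?thesis by (simp add: l E.scale_sum_right sum.distrib)
qed

lemma set_subset_nth: "(\<And>i. i < length xs \<Longrightarrow> xs ! i \<in> A) \<Longrightarrow> set xs \<subseteq> A"
  by (metis in_set_conv_nth subsetI)

lemma arity_set_0 [simp]: "arity_set 0 = {}"
  by (simp add: arity_set_def)

abbreviation lbrs where "lbrs xs \<equiv> lbr sg sh (length xs) xs"

lemma lbrs_slot_add:
  assumes "set as \<subseteq> LF" "set bs \<subseteq> LF" "y \<in> LF" "z \<in> LF"
  shows "lbrs (as @ (y + z) # bs) = lbrs (as @ y # bs) + lbrs (as @ z # bs)"
  using lbr_slot[of "as @ y # bs" _ "length as" y z 1] assms by simp

lemma zero_LF: "0 \<in> LF" using zero_Lsp zero_Fsp by (simp add: zero_prod_def)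

lemma lbrs_zero:
  assumes "set as \<subseteq> LF" "set bs \<subseteq> LF"
  shows "lbrs (as @ 0 # bs) = 0"
  using lbrs_slot_add[OF assms zero_LF zero_LF] by simp

lemma arity_nonzero:
  assumes "f \<noteq> 0" "arity n f"
  shows "arity_set f = {nat n}" "0 \<le> n" "restr (nat n) f = f"
  using assms by (auto simp: arity_set_def arity_def fun_eq_iff restr_def) (metis nat_int)

text \<open>A nonzero pure element has exactly one tag. The shifts 2 and 1 come from arity being
  degree in L or F plus one, together with the desuspension for L.\<close>

lemma tags_wf:
  assumes "tagged_ok (b, d, x)" "x \<noteq> 0"
  shows "tags x = {(b, nat (d + (if b then 2 else 1)))}"
    and "tagdeg (b, nat (d + (if b then 2 else 1))) = d"
    and "piece (b, nat (d + (if b then 2 else 1))) x = x"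
proof -
  obtain f \<theta> where x: "x = (f, \<theta>)" by (cases x)
  have "tags x = {(b, nat (d + (if b then 2 else 1)))} \<and> tagdeg (b, nat (d + (if b then 2 else 1))) = d
      \<and> piece (b, nat (d + (if b then 2 else 1))) x = x"
  proof (cases b)
    case True
    then have "\<theta> = 0" "f \<noteq> 0" "arity (d + 2) f"
      using assms by (simp_all add: x tagged_ok_def Gsp_def zero_prod_def add.assoc)
    then show ?thesis using True arity_nonzero[of f "d + 2"] by (simp add: x tags_def tagdeg_def piece_def)
  next
    case False
    then have "f = 0" "\<theta> \<noteq> 0" "arity (d + 1) \<theta>"
      using assms by (simp_all add: x tagged_ok_def Hsp_def zero_prod_def)
    then show ?thesis using False arity_nonzero[of \<theta> "d + 1"] by (simp add: x tags_def tagdeg_def piece_def)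
  qed
  then show "tags x = {(b, nat (d + (if b then 2 else 1)))}" "tagdeg (b, nat (d + (if b then 2 else 1))) = d"
    "piece (b, nat (d + (if b then 2 else 1))) x = x" by blast+
qed

text \<open>If all entries are nonzero, the sum over tags has a single term; if some entry is zero,
  the sum is empty and \<open>lab\<close> vanishes too.\<close>

lemma lbrs_pure:
  assumes "wfs us"
  shows "lbrs (map (\<lambda>u. snd (snd u)) us) = lab us"
proof -
  define tg :: "(('g, 'h) Lmap, ('g, 'h) Fmap) tagged \<Rightarrow> bool \<times> nat"
    where "tg u = (isL u, nat (dg u + (if isL u then 2 else 1)))" for u
  have tg: "tags (snd (snd u)) = {tg u}" "tagdeg (tg u) = dg u" "piece (tg u) (snd (snd u)) = snd (snd u)"
    if "u \<in> set us" "snd (snd u) \<noteq> 0" for u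
    using tags_wf[of "isL u" "dg u" "snd (snd u)"] that assms by (simp_all add: tg_def)
  show ?thesis
  proof (cases "\<exists>u\<in>set us. snd (snd u) = 0")
    case True
    then obtain u i where u: "u \<in> set us" "snd (snd u) = 0" "i < length us" "u = us ! i"
      by (metis in_set_conv_nth)
    then have "tags (map (\<lambda>u. snd (snd u)) us ! i) = {}" by (simp add: tags_def arity_set_def)
    then have e: "{c. length c = length us \<and> (\<forall>i<length us. c ! i \<in> tags (map (\<lambda>u. snd (snd u)) us ! i))} = {}"
      using u(3) by blast
    show ?thesis unfolding lab_zero_in[OF assms u(1,2)]
      by (subst lbr_lab) (simp_all only: length_map e sum.empty)
  next
    case False
    have "{c. length c = length us \<and> (\<forall>i<length us. c ! i \<in> tags (map (\<lambda>u. snd (snd u)) us ! i))} = {map tg us}"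
      using False tg(1) by (auto intro!: nth_equalityI)
    moreover have "map2 tag_piece (map tg us) (map (\<lambda>u. snd (snd u)) us) = us"
      using False tg(2,3) by (intro nth_equalityI) (auto simp: tag_piece_def tg_def prod_eq_iff)
    ultimately show ?thesis by (subst lbr_lab) simp_all
  qed
qed

section \<open>Degree, closure and symmetry of the brackets\<close>

lemma tagdeg_homE: "homE d x \<Longrightarrow> t \<in> tags x \<Longrightarrow> tagdeg t = d"
  by (auto simp: homE_def tags_def tagdeg_def arity_set_def)

lemma tagged_ok_homE: "tagged_ok (b, d, x) \<Longrightarrow> homE d x"
  by (cases x) (auto simp: tagged_ok_def homE_def Gsp_def Hsp_def arity_def add.assoc split: if_splits)

lemma tagged_ok_LF: "tagged_ok (b, d, x) \<Longrightarrow> x \<in> LF"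
  using zero_Lsp zero_Fsp by (cases x) (auto simp: tagged_ok_def Gsp_Lsp Hsp_Fsp split: if_splits)

lemma homE_0: "homE d 0" by (simp add: homE_def)
lemma homE_add: "homE d x \<Longrightarrow> homE d y \<Longrightarrow> homE d (x + y)"
  for x y :: "('g, 'h) elt"
proof -
  have "fst x vs \<noteq> 0 \<or> fst y vs \<noteq> 0" if "fst (x + y) vs \<noteq> 0" for vs
    using that by (cases "fst x vs = 0") simp_all
  moreover have "snd x vs \<noteq> 0 \<or> snd y vs \<noteq> 0" if "snd (x + y) vs \<noteq> 0" for vs
    using that by (cases "snd x vs = 0") simp_all
  ultimately show "homE d x \<Longrightarrow> homE d y \<Longrightarrow> homE d (x + y)"
    unfolding homE_def by blast
qed

lemma homE_scale: "homE d x \<Longrightarrow> homE d (sE c x)"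
  by (auto simp: homE_def scaleE_def)

lemma sum_closed: "0 \<in> C \<Longrightarrow> (\<And>x y. x \<in> C \<Longrightarrow> y \<in> C \<Longrightarrow> x + y \<in> C) \<Longrightarrow> (\<And>i. i \<in> I \<Longrightarrow> f i \<in> C) \<Longrightarrow> sum f I \<in> C"
  for C :: "'c::comm_monoid_add set"
  by (induction I rule: infinite_finite_induct) auto

lemma dgs_tag_piece:
  assumes "length xs = k" "length c = k" "\<forall>i<k. c ! i \<in> tags (xs ! i)" "\<forall>i<k. homE (d i) (xs ! i)"
  shows "i < k \<Longrightarrow> dg (map2 tag_piece c xs ! i) = d i" and "dgs (map2 tag_piece c xs) = (\<Sum>i<k. d i)"
proof -
  show *: "dg (map2 tag_piece c xs ! i) = d i" if "i < k" for i
    using assms that tagdeg_homE[of "d i" "xs ! i" "c ! i"] by (simp add: tag_piece_def)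
  show "dgs (map2 tag_piece c xs) = (\<Sum>i<k. d i)"
    unfolding sum_list_sum_nth using assms(1,2) * by (auto simp: atLeast0LessThan intro!: sum.cong)
qed

lemma lbr_hom:
  assumes "length xs = k" "\<forall>i<k. xs ! i \<in> LF \<and> homE (d i) (xs ! i)"
  shows "homE ((\<Sum>i<k. d i) + 1) (lbr sg sh k xs)"
proof -
  have "set xs \<subseteq> LF" by (rule set_subset_nth) (use assms in simp)
  then have *: "homE (dgs (map2 tag_piece c xs) + 1) (lab (map2 tag_piece c xs))" for c
    using lab_wf wfs_tag_piece tagged_ok_homE by blast
  have "lab (map2 tag_piece c xs) \<in> {x. homE ((\<Sum>i<k. d i) + 1) x}"
    if "length c = k" "\<forall>i<k. c ! i \<in> tags (xs ! i)" for c
  proof -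
    have "dgs (map2 tag_piece c xs) = (\<Sum>i<k. d i)" using dgs_tag_piece(2)[OF assms(1) that] assms(2) by blast
    then show ?thesis using *[of c] by (simp only: mem_Collect_eq)
  qed
  then have "lbr sg sh k xs \<in> {x. homE ((\<Sum>i<k. d i) + 1) x}"
    unfolding lbr_lab[OF assms(1)] by (intro sum_closed) (auto simp: homE_0 homE_add)
  then show ?thesis by simp
qed

lemma lbr_LF: "length xs = k \<Longrightarrow> set xs \<subseteq> LF \<Longrightarrow> lbr sg sh k xs \<in> LF"
  unfolding lbr_lab
proof (rule sum_closed[OF zero_LF])
  show "x + y \<in> LF" if "x \<in> LF" "y \<in> LF" for x y using LF_lin[OF that, of 1] by simp
  show "lab (map2 tag_piece c xs) \<in> LF" if "set xs \<subseteq> LF" for c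
    by (rule tagged_ok_LF[OF lab_wf[OF wfs_tag_piece[OF that]]])
qed

lemma lbr_sym:
  assumes "length xs = k" "\<forall>i<k. xs ! i \<in> LF \<and> homE (d i) (xs ! i)" "\<sigma> permutes {0..<k}"
  shows "lbr sg sh k (map (\<lambda>i. xs ! \<sigma> i) [0..<k]) = sE (koszul d \<sigma> k) (lbr sg sh k xs)"
proof -
  let ?ys = "map (\<lambda>i. xs ! \<sigma> i) [0..<k]"
  have \<sigma>: "\<sigma> i < k" "inv \<sigma> i < k" if "i < k" for i
    using that permutes_in_image[OF assms(3), of i] permutes_in_image[OF permutes_inv[OF assms(3)], of i] by auto
  note inv = permutes_inverses[OF assms(3)]
  have LF: "set xs \<subseteq> LF" by (rule set_subset_nth) (use assms in simp)
  have lab: "lab (map2 tag_piece (map (\<lambda>i. c ! \<sigma> i) [0..<k]) ?ys) = sE (koszul d \<sigma> k) (lab (map2 tag_piece c xs))"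
    if c: "length c = k" "\<forall>i<k. c ! i \<in> tags (xs ! i)" for c
  proof -
    let ?us = "map2 tag_piece c xs"
    have l: "length ?us = k" using c assms(1) by simp
    have "map2 tag_piece (map (\<lambda>i. c ! \<sigma> i) [0..<k]) ?ys = map (\<lambda>i. ?us ! \<sigma> i) [0..<length ?us]"
      using c assms(1) \<sigma> by (intro nth_equalityI) auto
    also have "lab \<dots> = pm (koszul_exp (\<lambda>i. dg (?us ! i)) \<sigma> (length ?us)) (lab ?us)"
    proof (rule graded_symmetric_permute[where W = "{u. tagged_ok u}"])
      fix us x y vs assume "set (us @ x # y # vs) \<subseteq> {u. tagged_ok u}"
      then show "lab (us @ x # y # vs) = pm (dg x * dg y) (lab (us @ y # x # vs))" by (intro lab_swap) auto
    qed (use wfs_tag_piece[OF LF, of c] l assms(3) in auto)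
    also have "koszul_exp (\<lambda>i. dg (?us ! i)) \<sigma> (length ?us) = koszul_exp d \<sigma> k"
      unfolding l using dgs_tag_piece(1)[OF assms(1) c, of d] assms(2) by (intro koszul_exp_cong[OF assms(3)]) auto
    finally show ?thesis by (simp add: koszul_psgn E.scale_psgn)
  qed
  \<comment> \<open>Permuting the tags along with the arguments is a bijection between the two index
    sets, with inverse \<open>?q\<close>.\<close>
  let ?p = "\<lambda>c. map (\<lambda>i. c ! \<sigma> i) [0..<k]" and ?q = "\<lambda>c. map (\<lambda>i. c ! inv \<sigma> i) [0..<k]"
  have pq: "?q (?p c) = c" "?p (?q c) = c" if "length c = k" for c :: "(bool \<times> nat) list"
    using that \<sigma> inv by (auto intro!: nth_equalityI)
  have "(\<Sum>c | length c = k \<and> (\<forall>i<k. c ! i \<in> tags (xs ! i)). lab (map2 tag_piece (?p c) ?ys))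
    = (\<Sum>c | length c = k \<and> (\<forall>i<k. c ! i \<in> tags (?ys ! i)). lab (map2 tag_piece c ?ys))"
  proof (rule sum.reindex_bij_witness[where j = ?p and i = ?q])
    fix c assume c: "c \<in> {c. length c = k \<and> (\<forall>i<k. c ! i \<in> tags (?ys ! i))}"
    have "?q c ! i \<in> tags (xs ! i)" if "i < k" for i
    proof -
      have "c ! inv \<sigma> i \<in> tags (?ys ! inv \<sigma> i)" using c \<sigma>(2)[OF that] by blast
      then show ?thesis using that \<sigma>(2)[OF that] inv(1) by simp
    qed
    then show "?q c \<in> {c. length c = k \<and> (\<forall>i<k. c ! i \<in> tags (xs ! i))}" by simp
    show "?p (?q c) = c" using c pq by blast
  next
    fix c assume c: "c \<in> {c. length c = k \<and> (\<forall>i<k. c ! i \<in> tags (xs ! i))}"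
    then show "?p c \<in> {c. length c = k \<and> (\<forall>i<k. c ! i \<in> tags (?ys ! i))}" using \<sigma>(1) by simp
    show "?q (?p c) = c" using c pq by blast
  qed simp
  then have "lbr sg sh k ?ys = (\<Sum>c | length c = k \<and> (\<forall>i<k. c ! i \<in> tags (xs ! i)). lab (map2 tag_piece (?p c) ?ys))"
    using lbr_lab[of ?ys k] by simp
  then show ?thesis unfolding lbr_lab[OF assms(1)] by (simp add: lab E.scale_sum_right)
qed

text \<open>The degrees travel with the elements, since a zero entry does not determine its
  degree.\<close>

definition Jac_lbr :: "(int \<times> ('g, 'h) elt) list \<Rightarrow> ('g, 'h) elt" where
  "Jac_lbr zs = ksum fst zs (\<lambda>as bs. lbrs (lbrs (map snd as) # map snd bs))"

lemma Jac_lbr_add: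
  assumes "snd ` set us \<subseteq> LF" "snd ` set vs \<subseteq> LF" "x \<in> LF" "y \<in> LF"
  shows "Jac_lbr (us @ (d, x + y) # vs) = Jac_lbr (us @ (d, x) # vs) + Jac_lbr (us @ (d, y) # vs)"
  unfolding Jac_lbr_def
proof (rule ksum_slot_add, goal_cases)
  case (1 as bs cs)
  then have "set as \<union> set bs \<union> set cs = set us \<union> set vs" by (metis set_mset_mset set_mset_union)
  then have "snd ` (set as \<union> set bs \<union> set cs) \<subseteq> LF" using assms(1,2) by (simp only: image_Un Un_subset_iff)
  then have c: "set (map snd as) \<subseteq> LF" "set (map snd bs) \<subseteq> LF" "set (map snd cs) \<subseteq> LF"
    by (simp_all only: image_Un Un_subset_iff set_map)
  have l: "lbrs (map snd as @ w # map snd bs) \<in> LF" if "w \<in> LF" for w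
    using c that by (intro lbr_LF) auto
  show ?case using lbrs_slot_add[OF c(1,2) assms(3,4)] lbrs_slot_add[of "[]", OF _ c(3) l[OF assms(3)] l[OF assms(4)]]
    by simp
next
  case (2 as bs cs)
  then have "set as \<union> set bs \<union> set cs = set us \<union> set vs" by (metis set_mset_mset set_mset_union)
  then have "snd ` (set as \<union> set bs \<union> set cs) \<subseteq> LF" using assms(1,2) by (simp only: image_Un Un_subset_iff)
  then have c: "set (map snd as) \<subseteq> LF" "set (map snd bs) \<subseteq> LF" "set (map snd cs) \<subseteq> LF"
    by (simp_all only: image_Un Un_subset_iff set_map)
  have "set (lbrs (map snd cs) # map snd as) \<subseteq> LF" using c lbr_LF[OF refl c(3)] by simp
  from lbrs_slot_add[OF this c(2) assms(3,4)] show ?case by simp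
qed auto

lemma Jac_lbr_pure:
  assumes "wfs us"
  shows "Jac_lbr (map (\<lambda>u. (dg u, snd (snd u))) us) = 0"
proof -
  have "Jac_lbr (map (\<lambda>u. (dg u, snd (snd u))) us)
    = ksum dg us (\<lambda>as bs. lbrs (lbrs (map (\<lambda>u. snd (snd u)) as) # map (\<lambda>u. snd (snd u)) bs))"
    by (simp add: Jac_lbr_def ksum_map comp_def)
  also have "\<dots> = Jac us" unfolding Jac_def
  proof (rule ksum_cong)
    fix as bs assume *: "mset as + mset bs = mset us"
    have w: "wfs as" "wfs bs" using set_of_split[OF *] assms by auto
    have "wfs (inner as # bs)" using lab_wf[OF w(1)] w(2) by (simp add: inner_def)
    from lbrs_pure[OF this] show "lbrs (lbrs (map (\<lambda>u. snd (snd u)) as) # map (\<lambda>u. snd (snd u)) bs) = lab (inner as # bs)"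
      using lbrs_pure[OF w(1)] by (simp add: inner_def)
  qed
  finally show ?thesis by (simp add: Jac_0[OF assms])
qed

text \<open>Each homogeneous entry is the sum of its L-part and its F-part, both pure of the same
  degree, so additivity reduces the claim to pure entries.\<close>

lemma Jac_lbr_0:
  assumes "\<forall>(d, x)\<in>set zs. x \<in> LF \<and> homE d x"
  shows "Jac_lbr zs = 0"
proof -
  \<comment> \<open>The prefix from \<open>us\<close> holds the entries already replaced by pure
    ones.\<close>
  have "Jac_lbr (map (\<lambda>u. (dg u, snd (snd u))) us @ zs) = 0" if "wfs us" for us
    using assms that
  proof (induction zs arbitrary: us)
    case Nil
    then show ?case using Jac_lbr_pure by simp
  next
    case (Cons z zs)
    obtain d f \<theta> where z: "z = (d, f, \<theta>)" by (cases z) auto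
    have LF: "(f, \<theta>) \<in> LF" "homE d (f, \<theta>)" using Cons.prems(1) z by auto
    have "tagged_ok (True, d, f, 0)" "tagged_ok (False, d, 0, \<theta>)"
      using LF by (auto simp: tagged_ok_def Gsp_Lsp Hsp_Fsp homE_def arity_def)
    then have w: "wfs (us @ [(True, d, f, 0)])" "wfs (us @ [(False, d, 0, \<theta>)])" using Cons.prems(2) by auto
    have u: "snd ` set (map (\<lambda>u. (dg u, snd (snd u))) us) \<subseteq> LF"
      using Cons.prems(2) tagged_ok_LF[of "isL u" "dg u" "snd (snd u)" for u] by (simp add: image_subset_iff)
    have "Jac_lbr (map (\<lambda>u. (dg u, snd (snd u))) us @ (d, (f, 0) + (0, \<theta>)) # zs) = 0"
      using Jac_lbr_add[OF u, of zs "(f, 0)" "(0, \<theta>)" d] Cons.IH[OF _ w(1)] Cons.IH[OF _ w(2)] Cons.prems(1) LF zero_Lsp zero_Fsp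
      by (auto simp: image_subset_iff case_prod_unfold)
    then show ?case by (simp add: z)
  qed
  from this[of "[]"] show ?thesis by simp
qed

lemma lbr_jacobi:
  assumes "length xs = n" "\<forall>i<n. xs ! i \<in> LF \<and> homE (d i) (xs ! i)"
  shows "(\<Sum>i\<in>{1..n}. \<Sum>\<sigma>\<in>shuffles i (n - i).
      sE (koszul d \<sigma> n) (lbr sg sh (n - i + 1) (lbr sg sh i (pick \<sigma> xs 0 i) # pick \<sigma> xs i n))) = 0"
proof -
  define zs where "zs = map (\<lambda>i. (d i, xs ! i)) [0..<n]"
  let ?\<Phi> = "\<lambda>as bs. lbrs (lbrs (map snd as) # map snd bs)"
  have LF: "set xs \<subseteq> LF" by (rule set_subset_nth) (use assms in simp)
  have len: "length zs = n" by (simp add: zs_def)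
  have "sE (koszul d \<sigma> n) (lbr sg sh (n - i + 1) (lbr sg sh i (pick \<sigma> xs 0 i) # pick \<sigma> xs i n))
    = pm (koszul_exp (\<lambda>i. fst (zs ! i)) \<sigma> n) (?\<Phi> (pick \<sigma> zs 0 i) (pick \<sigma> zs i n))"
    if "\<sigma> \<in> shuffles i (n - i)" "i \<in> {1..n}" for \<sigma> i
  proof -
    have \<sigma>: "\<sigma> permutes {0..<n}" using that by (simp add: shuffles_def)
    then have "\<sigma> j < n" if "j < n" for j using permutes_in_image[OF \<sigma>, of j] that by simp
    then have "map snd (pick \<sigma> zs a b) = pick \<sigma> xs a b" if "b \<le> n" for a b
      using that by (auto simp: pick_def zs_def)
    moreover have "length (pick \<sigma> xs a b) = b - a" for a b by (simp add: pick_def)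
    moreover have "koszul_exp (\<lambda>i. fst (zs ! i)) \<sigma> n = koszul_exp d \<sigma> n"
      by (rule koszul_exp_cong[OF \<sigma>]) (simp add: zs_def)
    ultimately show ?thesis using that by (simp add: koszul_psgn E.scale_psgn)
  qed
  then have "(\<Sum>i\<in>{1..n}. \<Sum>\<sigma>\<in>shuffles i (n - i).
      sE (koszul d \<sigma> n) (lbr sg sh (n - i + 1) (lbr sg sh i (pick \<sigma> xs 0 i) # pick \<sigma> xs i n)))
    = (\<Sum>i\<in>{1..n}. \<Sum>\<sigma>\<in>shuffles i (n - i).
      pm (koszul_exp (\<lambda>i. fst (zs ! i)) \<sigma> n) (?\<Phi> (pick \<sigma> zs 0 i) (pick \<sigma> zs i n)))"
    by (intro sum.cong refl)
  also have "\<dots> = Jac_lbr zs"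
    unfolding Jac_lbr_def
  proof (rule sum_all_shuffles[OF len])
    fix bs assume "set bs = set zs"
    then have "set (map snd bs) \<subseteq> LF" using assms by (auto simp: zs_def)
    moreover have "lbrs [] = 0" using lbrs_pure[of "[]"] by (simp add: lab_none)
    ultimately show "lbrs (lbrs (map snd []) # map snd bs) = 0"
      using lbrs_zero[of "[]" "map snd bs"] by simp
  qed
  also have "\<dots> = 0" by (rule Jac_lbr_0) (use assms in \<open>auto simp: zs_def\<close>)
  finally show ?thesis .
qed

end

section \<open>The subalgebra and its Maurer--Cartan elements\<close>

lemma sum_fun_apply: "(\<Sum>i\<in>I. F i) x = (\<Sum>i\<in>I. F i x)"
  for F :: "'i \<Rightarrow> 'a \<Rightarrow> 'b::comm_monoid_add"
  by (induction I rule: infinite_finite_induct) auto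

context two_spaces
begin

section \<open>The subspace M and its closure under the brackets\<close>

definition pg :: "'g \<times> 'h \<Rightarrow> 'g \<times> 'h" where
  "pg v = (fst v, 0)"

lemma pg_simps [simp]: "pg (pg v) = pg v" "pg (v + w) = pg v + pg w" "pg (- v) = - pg v" "pg 0 = 0"
  "pg (sV c v) = sV c (pg v)"
  by (simp_all add: pg_def scaleV_def zero_prod_def)

lemma mlin_zero_entry: "mlin sV sV f \<Longrightarrow> i < length vs \<Longrightarrow> vs ! i = 0 \<Longrightarrow> f vs = 0"
  using V.mlin_0[of f "take i vs" "drop (Suc i) vs"] id_take_nth_drop[of i vs] by metis

text \<open>By multilinearity it suffices to test entries lying in g or in h. If all lie in g, both
  conditions say that the value is in g. If some entry lies in h, its projection is zero, so both
  say that the value has no g-component.\<close>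

lemma Msp_iff: "f \<in> Msp sg sh \<longleftrightarrow> f \<in> Lsp sg sh \<and> (\<forall>vs. pg (f vs) = f (map pg vs))"
proof (intro iffI conjI allI)
  assume f: "f \<in> Msp sg sh"
  then have L: "f \<in> Lsp sg sh" by (simp add: Msp_def)
  then have ml: "mlin sV sV f" by (simp add: Lsp_iff)
  show "f \<in> Lsp sg sh" by (rule L)
  have "pg (f (us @ vs)) = f (map pg (us @ vs))" if "\<forall>v\<in>set us. fst v = 0 \<or> snd v = 0" for us vs
    using that
  proof (induction vs arbitrary: us)
    case Nil
    \<comment> \<open>A zero entry is counted as an h-entry, which is consistent: the remaining
      entries have nonzero g-part, hence zero h-part.\<close>
    let ?T = "{i. i < length us \<and> fst (us ! i) = 0}"
    have "split_in ?T us = us"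
      using Nil nth_mem[of _ us] by (intro nth_equalityI) (auto simp: split_in_def prod_eq_iff)
    moreover have "?T \<subseteq> {0..<length us}" by auto
    ultimately have *: "?T \<noteq> {} \<longrightarrow> fst (f us) = 0" "?T = {} \<longrightarrow> snd (f us) = 0"
      using f unfolding Msp_def by (metis (mono_tags, lifting) mem_Collect_eq)+
    show ?case
    proof (cases "?T = {}")
      case True
      then have "map pg us = us" using Nil by (intro nth_equalityI) (force simp: pg_def prod_eq_iff)+
      moreover have "pg (f us) = f us" using *(2) True by (simp add: pg_def prod_eq_iff)
      ultimately show ?thesis by simp
    next
      case False
      then obtain i where "i < length us" "fst (us ! i) = 0" by blast
      then have "f (map pg us) = 0" by (intro mlin_zero_entry[OF ml, of i]) (simp_all add: pg_def zero_prod_def)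
      moreover have "pg (f us) = 0" using *(1) False by (simp add: pg_def zero_prod_def)
      ultimately show ?thesis by simp
    qed
  next
    case (Cons v vs)
    let ?g = "(fst v, 0)" and ?h = "(0, snd v)"
    have v: "v = ?g + ?h" by simp
    have IH: "pg (f (us @ w # vs)) = f (map pg (us @ w # vs))" if "w = ?g \<or> w = ?h" for w
      using Cons.IH[of "us @ [w]"] Cons.prems that by auto
    have "f (us @ v # vs) = f (us @ ?g # vs) + f (us @ ?h # vs)"
      by (subst v, rule V.mlin_add[OF ml])
    moreover have "f (map pg us @ pg v # map pg vs) = f (map pg us @ pg ?g # map pg vs) + f (map pg us @ pg ?h # map pg vs)"
      by (subst v, subst pg_simps(2), rule V.mlin_add[OF ml])
    ultimately show ?case using IH by simp
  qed
  from this[of "[]"] show "pg (f vs) = f (map pg vs)" for vs by simp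
next
  assume "f \<in> Lsp sg sh \<and> (\<forall>vs. pg (f vs) = f (map pg vs))"
  then have L: "f \<in> Lsp sg sh" and ml: "mlin sV sV f" and pg: "pg (f vs) = f (map pg vs)" for vs
    by (auto simp: Lsp_iff)
  have "fst (f (split_in T vs)) = 0" if T: "T \<subseteq> {0..<length vs}" "T \<noteq> {}" for T vs
  proof -
    obtain i where "i \<in> T" "i < length vs" using T by fastforce
    then have "f (map pg (split_in T vs)) = 0"
      by (intro mlin_zero_entry[OF ml, of i]) (simp_all add: split_in_def pg_def zero_prod_def)
    then show ?thesis using pg[of "split_in T vs"] by (simp add: pg_def prod_eq_iff)
  qed
  moreover have "snd (f (split_in {} vs)) = 0" for vs
  proof -
    have "map pg (split_in {} vs) = split_in {} vs" by (simp add: split_in_def pg_def)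
    then have "pg (f (split_in {} vs)) = f (split_in {} vs)" using pg[of "split_in {} vs"] by simp
    then show ?thesis by (metis pg_def snd_conv)
  qed
  ultimately show "f \<in> Msp sg sh" using L by (auto simp: Msp_def)
qed

lemma Msp_Lsp: "f \<in> Msp sg sh \<Longrightarrow> f \<in> Lsp sg sh"
  by (simp add: Msp_iff)

lemma Msp_0: "0 \<in> Msp sg sh" using zero_Lsp by (simp add: Msp_iff)

lemma Msp_lin: "f \<in> Msp sg sh \<Longrightarrow> g \<in> Msp sg sh \<Longrightarrow> sL c f + g \<in> Msp sg sh"
  using Lsp_lin[of f g c] by (auto simp: Msp_iff)

lemma Msp_pm: "f \<in> Msp sg sh \<Longrightarrow> pm d f \<in> Msp sg sh"
  unfolding pm_scale using Msp_lin[of f 0] Msp_0 by simp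

lemma Msp_restr: "f \<in> Msp sg sh \<Longrightarrow> restr n f \<in> Msp sg sh"
  using restr_Gsp[of f n] by (auto simp: Msp_iff Gsp_Lsp restr_def)

text \<open>Maps commuting with the additive map \<open>pg\<close> are closed under composition, and
  \<open>pg\<close> passes through the signed sum.\<close>

lemma Msp_bracket:
  assumes f: "f \<in> Msp sg sh" "f \<in> Gsp d" and g: "g \<in> Msp sg sh" "g \<in> Gsp e"
  shows "nr_bracket sV f g \<in> Msp sg sh"
proof -
  have c: "pg (circ f g vs) = circ f g (map pg vs)" if "f \<in> Msp sg sh" "g \<in> Msp sg sh" for f g vs
  proof -
    have "pg (circ f g vs) = ksum (\<lambda>_. 1) vs (\<lambda>as bs. pg (f (g as # bs)))"
      unfolding circ_def by (rule additive_ksum) simp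
    also have "\<dots> = circ f g (map pg vs)"
      using that by (simp add: circ_def ksum_map Msp_iff comp_def)
    finally show ?thesis .
  qed
  have "pg (v - w) = pg v - pg w" "pg (pm k v) = pm k (pg v)" for v w k by (simp_all add: pg_def pm_def)
  then have "pg (nr_bracket sV f g vs) = nr_bracket sV f g (map pg vs)" for vs
    using c f(1) g(1) by (simp add: brk_Gsp[OF f(2) g(2)] V.brk_def)
  then show ?thesis using brk_Gsp_closed[OF f(2) g(2)] by (simp add: Msp_iff Gsp_Lsp)
qed

abbreviation MF where "MF \<equiv> Msp sg sh \<times> Fsp sg sh"

lemma MF_LF: "x \<in> MF \<Longrightarrow> x \<in> LF" by (auto simp: Msp_Lsp)

text \<open>The F-component is unrestricted, and the binary bracket of two L-entries is the only one
  with an L-component.\<close>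

lemma lab_MF:
  assumes "wfs us" "\<forall>u\<in>set us. vL u \<in> Msp sg sh"
  shows "lab us \<in> MF"
proof -
  have "fst (lab us) \<in> Msp sg sh"
  proof (cases us rule: lab_cases)
    case (3 u v)
    then show ?thesis using assms Msp_bracket[of "vL u" "dg u + 1" "vL v" "dg v + 1"]
      by (simp add: lab_LL tagged_ok_def Msp_pm)
  qed (simp_all add: lab_none lab_one lab_many Msp_0)
  moreover have "lab us \<in> LF" by (rule tagged_ok_LF[OF lab_wf[OF assms(1)]])
  ultimately show ?thesis by (simp add: mem_Times_iff)
qed

lemma MF_lin: "x \<in> MF \<Longrightarrow> y \<in> MF \<Longrightarrow> sE c x + y \<in> MF"
  by (auto simp: scaleE_def intro: Msp_lin Fsp_lin)

lemma zero_MF: "0 \<in> MF" using Msp_0 zero_Fsp by (simp add: zero_prod_def)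

lemma MF_add: "x \<in> MF \<Longrightarrow> y \<in> MF \<Longrightarrow> x + y \<in> MF"
  using MF_lin[of x y 1] by simp

lemma lbr_MF:
  assumes "length xs = k" "set xs \<subseteq> MF"
  shows "lbr sg sh k xs \<in> MF"
  unfolding lbr_lab[OF assms(1)]
proof (rule sum_closed[OF zero_MF MF_add])
  fix c
  have "set xs \<subseteq> LF" using assms(2) MF_LF by blast
  then have "wfs (map2 tag_piece c xs)" by (rule wfs_tag_piece)
  moreover have "vL u \<in> Msp sg sh" if "u \<in> set (map2 tag_piece c xs)" for u
  proof -
    obtain t x where u: "u = tag_piece t x" "x \<in> set xs" using \<open>u \<in> _\<close> by (auto dest: set_zip_rightD)
    then have "fst x \<in> Msp sg sh" using assms(2) by auto
    then show ?thesis by (simp add: u tag_piece_def piece_def Msp_restr Msp_0)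
  qed
  ultimately show "lab (map2 tag_piece c xs) \<in> MF" by (intro lab_MF) auto
qed

section \<open>Grading and L-infinity structure on the subspace\<close>

lemma graded_space_MF: "graded_space sE homE MF"
  unfolding graded_space_def
proof (intro conjI allI ballI impI)
  show "vector_space sE" by (rule vector_space_sE)
  show "0 \<in> MF" by (rule zero_MF)
  show "x + y \<in> MF" if "x \<in> MF" "y \<in> MF" for x y using that by (rule MF_add)
  show "sE c x \<in> MF" if "x \<in> MF" for c x using MF_lin[OF that zero_MF, of c] by simp
  show "homE d (0 :: ('g, 'h) elt)" for d by (rule homE_0)
  show "homE d (x + y)" if "homE d x \<and> homE d y" for d and x y :: "('g, 'h) elt" using that homE_add by blast
  show "homE d (sE c x)" if "homE d x" for d c x using that by (rule homE_scale)
next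
  fix x assume x: "x \<in> MF"
  define D where "D = (\<lambda>n. int n - 2) ` arity_set (fst x) \<union> (\<lambda>n. int n - 1) ` arity_set (snd x)"
  define cmp where "cmp d = (restr (nat (d + 2)) (fst x), restr (nat (d + 1)) (snd x))" for d
  have "finite D" using x by (auto simp: D_def Msp_iff Lsp_iff Fsp_iff)
  have "0 \<notin> arity_set (fst x)" "0 \<notin> arity_set (snd x)"
    using x by (auto simp: Msp_iff Lsp_iff Fsp_iff arity_set_def)
  \<comment> \<open>Components of arity 0 vanish, so no degree is below -1 and \<open>nat\<close>
    truncates nothing in the definition of \<open>cmp\<close>.\<close>
  then have D: "- 1 \<le> d" if "d \<in> D" for d
    using that by (auto simp: D_def image_iff) (metis Suc_leI gr0I of_nat_1 of_nat_le_iff One_nat_def)+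
  have hom: "cmp d \<in> MF \<and> homE d (cmp d)" if "d \<in> D" for d
  proof
    show "cmp d \<in> MF" using x restr_Hsp[of "snd x" "nat (d + 1)"] by (auto simp: cmp_def Msp_restr Hsp_Fsp)
    show "homE d (cmp d)" using D[OF that] by (auto simp: homE_def cmp_def restr_def split: if_splits)
  qed
  have "x = (\<Sum>d\<in>D. cmp d)"
  proof -
    have 1: "(\<Sum>d\<in>D. if length vs = nat (d + k) then y else 0) = y"
      if "y \<noteq> 0 \<longrightarrow> int (length vs) - k \<in> D" "0 < k" for y :: "'c::comm_monoid_add" and vs :: "'d list" and k
    proof (cases "y = 0")
      case False
      have "(\<Sum>d\<in>D. if length vs = nat (d + k) then y else 0) = (\<Sum>d\<in>D. if d = int (length vs) - k then y else 0)"
        using D that(2) by (intro sum.cong refl) force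
      then show ?thesis using that False \<open>finite D\<close> by simp
    next
      case True
      then show ?thesis by (simp only: if_cancel sum.neutral_const)
    qed
    have "fst x vs = fst (\<Sum>d\<in>D. cmp d) vs" for vs
    proof -
      have "fst x vs \<noteq> 0 \<longrightarrow> int (length vs) - 2 \<in> D" by (auto simp: D_def arity_set_def)
      from 1[OF this] show ?thesis by (simp add: fst_sum sum_fun_apply cmp_def restr_def)
    qed
    moreover have "snd x vs = snd (\<Sum>d\<in>D. cmp d) vs" for vs
    proof -
      have "snd x vs \<noteq> 0 \<longrightarrow> int (length vs) - 1 \<in> D" by (auto simp: D_def arity_set_def)
      from 1[OF this] show ?thesis by (simp add: snd_sum sum_fun_apply cmp_def restr_def)
    qed
    ultimately show ?thesis by (auto simp: prod_eq_iff fun_eq_iff)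
  qed
  then show "\<exists>D cmp. finite D \<and> (\<forall>d\<in>D. cmp d \<in> MF \<and> homE d (cmp d)) \<and> x = (\<Sum>d\<in>D. cmp d)"
    using \<open>finite D\<close> hom by blast
next
  fix D cmp d assume *: "finite D \<and> (\<forall>d\<in>D. cmp d \<in> MF \<and> homE d (cmp d)) \<and> (\<Sum>d\<in>D. cmp d) = 0" and d: "d \<in> D"
  have "fst (cmp d) vs = 0" for vs
  proof (rule ccontr)
    assume n: "fst (cmp d) vs \<noteq> 0"
    then have "int (length vs) = d + 2" using * d by (auto simp: homE_def)
    then have "fst (cmp e) vs = 0" if "e \<in> D - {d}" for e using * that by (force simp: homE_def)
    then have "(\<Sum>e\<in>D. fst (cmp e) vs) = fst (cmp d) vs" using * d by (subst sum.remove[of _ d]) auto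
    moreover have "(\<Sum>e\<in>D. fst (cmp e) vs) = fst (\<Sum>d\<in>D. cmp d) vs" by (simp add: fst_sum sum_fun_apply)
    ultimately show False using * n by simp
  qed
  moreover have "snd (cmp d) vs = 0" for vs
  proof (rule ccontr)
    assume n: "snd (cmp d) vs \<noteq> 0"
    then have "int (length vs) = d + 1" using * d by (auto simp: homE_def)
    then have "snd (cmp e) vs = 0" if "e \<in> D - {d}" for e using * that by (force simp: homE_def)
    then have "(\<Sum>e\<in>D. snd (cmp e) vs) = snd (cmp d) vs" using * d by (subst sum.remove[of _ d]) auto
    moreover have "(\<Sum>e\<in>D. snd (cmp e) vs) = snd (\<Sum>d\<in>D. cmp d) vs" by (simp add: snd_sum sum_fun_apply)
    ultimately show False using * n by simp
  qed
  ultimately show "cmp d = 0" by (simp add: prod_eq_iff fun_eq_iff)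
qed

lemma Linf_subalgebra_MF: "Linf_subalgebra sE homE MF LF (lbr sg sh)"
  unfolding Linf_subalgebra_def Linf_algebra_def
proof (intro conjI allI impI)
  show "MF \<subseteq> LF" using MF_LF by blast
  show "lbr sg sh k xs \<in> MF" if "length xs = k \<and> set xs \<subseteq> MF" for k xs using that lbr_MF by blast
  show "graded_space sE homE MF" by (rule graded_space_MF)
  show "lbr sg sh k xs \<in> MF" if "length xs = k \<and> set xs \<subseteq> MF" for k xs using that lbr_MF by blast
  show "lbr sg sh k (xs[i := sE c y + z]) = sE c (lbr sg sh k (xs[i := y])) + lbr sg sh k (xs[i := z])"
    if *: "length xs = k \<and> set xs \<subseteq> MF \<and> i < k \<and> y \<in> MF \<and> z \<in> MF" for k xs i c y z
  proof (rule lbr_slot)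
    show "set xs \<subseteq> LF" "y \<in> LF" "z \<in> LF" using * MF_LF by blast+
  qed (use * in auto)
  show "homE ((\<Sum>i<k. d i) + 1) (lbr sg sh k xs)"
    if "length xs = k \<and> (\<forall>i<k. xs ! i \<in> MF \<and> homE (d i) (xs ! i))" for k xs d
    using that MF_LF by (intro lbr_hom) blast+
  show "lbr sg sh k (map (\<lambda>i. xs ! \<sigma> i) [0..<k]) = sE (koszul d \<sigma> k) (lbr sg sh k xs)"
    if "length xs = k \<and> (\<forall>i<k. xs ! i \<in> MF \<and> homE (d i) (xs ! i)) \<and> \<sigma> permutes {0..<k}" for k xs d \<sigma>
    using that MF_LF by (intro lbr_sym) blast+
  show "(\<Sum>i\<in>{1..n}. \<Sum>\<sigma>\<in>shuffles i (n - i).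
      sE (koszul d \<sigma> n) (lbr sg sh (n - i + 1) (lbr sg sh i (pick \<sigma> xs 0 i) # pick \<sigma> xs i n))) = 0"
    if "1 \<le> n \<and> length xs = n \<and> (\<forall>i<n. xs ! i \<in> MF \<and> homE (d i) (xs ! i))" for n xs d
    using that MF_LF by (intro lbr_jacobi) blast+
qed

end

section \<open>Maurer--Cartan elements and relative difference Lie algebras\<close>

lemma (in vector_space) lift_ksum:
  fixes \<kappa> :: "'g list \<Rightarrow> 'h list \<Rightarrow> 'b"
  assumes "length vs = p + q"
  shows "lift scale p q \<kappa> vs = ksum (\<lambda>_. 1) vs (\<lambda>as bs. if length as = p then \<kappa> (map fst as) (map snd bs) else 0)"
proof -
  have "scale (of_int (sign \<sigma>)) x = pm (koszul_exp (\<lambda>_. 1) \<sigma> (p + q)) x" if "\<sigma> \<in> shuffles p q" for \<sigma> x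
    using that by (subst sign_psgn[of _ "p + q"]) (auto simp: shuffles_def scale_psgn)
  then have "lift scale p q \<kappa> vs = (\<Sum>\<sigma>\<in>shuffles p q. pm (koszul_exp (\<lambda>_. 1) \<sigma> (p + q))
      (\<kappa> (map fst (pick \<sigma> vs 0 p)) (map snd (pick \<sigma> vs p (p + q)))))"
    unfolding lift_def using assms by simp
  then show ?thesis using sum_shuffles[OF assms, of "\<lambda>_. 1" "\<lambda>as bs. \<kappa> (map fst as) (map snd bs)"] by simp
qed

lemma length_2E:
  assumes "length xs = 2" obtains a b where "xs = [a, b]"
  using assms by (auto simp: length_Suc_conv numeral_2_eq_2)

lemma additive_simps:
  fixes h :: "'a::ab_group_add \<Rightarrow> 'b::ab_group_add"
  assumes "\<And>x y. h (x + y) = h x + h y"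
  shows "h 0 = 0" and "h (- x) = - h x" and "h (x - y) = h x - h y"
proof -
  show z: "h 0 = 0" using assms[of 0 0] by simp
  show m: "h (- x) = - h x" for x using assms[of x "- x"] z by (simp add: eq_neg_iff_add_eq_0 add.commute)
  show "h (x - y) = h x - h y" using assms[of x "- y"] m by simp
qed

lemma bilinear_mapD:
  assumes "bilinear_map sa sb sc b"
  shows "b (x + y) w = b x w + b y w" "b z (u + v) = b z u + b z v"
    "b (sa c x) w = sc c (b x w)" "b z (sb c u) = sc c (b z u)"
proof -
  have 1: "module_hom sb sc (b z)" and 2: "module_hom sa sc (\<lambda>x. b x w)" for z w
    using assms by (simp_all add: bilinear_map_def)
  show "b (x + y) w = b x w + b y w" "b z (u + v) = b z u + b z v"
    "b (sa c x) w = sc c (b x w)" "b z (sb c u) = sc c (b z u)"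
    by (rule module_hom.add[OF 1] module_hom.add[OF 2] module_hom.scale[OF 1] module_hom.scale[OF 2])+
qed

locale rdl_data = two_spaces sg sh
  for sg :: "'k::field_char_0 \<Rightarrow> 'g::ab_group_add \<Rightarrow> 'g" and sh :: "'k \<Rightarrow> 'h::ab_group_add \<Rightarrow> 'h" +
  fixes \<pi> :: "'g \<Rightarrow> 'g \<Rightarrow> 'g" and \<mu> :: "'h \<Rightarrow> 'h \<Rightarrow> 'h" and \<rho> :: "'g \<Rightarrow> 'h \<Rightarrow> 'h" and D :: "'g \<Rightarrow> 'h"
  assumes pi: "alt_bilinear sg sg \<pi>" and mu: "alt_bilinear sh sh \<mu>"
    and rho: "bilinear_map sg sh sh \<rho>" and D: "module_hom sg sh D"
begin

lemma pi_lin: "\<pi> (x + y) z = \<pi> x z + \<pi> y z" "\<pi> z (x + y) = \<pi> z x + \<pi> z y"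
    "\<pi> (sg c x) z = sg c (\<pi> x z)" "\<pi> z (sg c x) = sg c (\<pi> z x)" "\<pi> x x = 0"
  and mu_lin: "\<mu> (u + v) w = \<mu> u w + \<mu> v w" "\<mu> w (u + v) = \<mu> w u + \<mu> w v"
    "\<mu> (sh c u) w = sh c (\<mu> u w)" "\<mu> w (sh c u) = sh c (\<mu> w u)" "\<mu> u u = 0"
  and rho_lin: "\<rho> (x + y) w = \<rho> x w + \<rho> y w" "\<rho> z (u + v) = \<rho> z u + \<rho> z v"
    "\<rho> (sg c x) w = sh c (\<rho> x w)" "\<rho> z (sh c u) = sh c (\<rho> z u)"
  and D_lin: "D (x + y) = D x + D y" "D (sg c x) = sh c (D x)"
  using pi mu rho D unfolding alt_bilinear_def
  by (simp_all add: bilinear_mapD[of sg sg sg \<pi>] bilinear_mapD[of sh sh sh \<mu>] bilinear_mapD[of sg sh sh \<rho>]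
      module_hom.add module_hom.scale)

lemmas more_lin [simp] =
  additive_simps[of "\<lambda>x. \<pi> x z" for z, OF pi_lin(1)] additive_simps[of "\<pi> z" for z, OF pi_lin(2)]
  additive_simps[of "\<lambda>x. \<mu> x z" for z, OF mu_lin(1)] additive_simps[of "\<mu> z" for z, OF mu_lin(2)]
  additive_simps[of "\<lambda>x. \<rho> x z" for z, OF rho_lin(1)] additive_simps[of "\<rho> z" for z, OF rho_lin(2)]
  additive_simps[of D, OF D_lin(1)] pi_lin mu_lin rho_lin D_lin

lemma pi_skew: "\<pi> x y = - \<pi> y x"
  using pi_lin(5)[of "x + y"] unfolding pi_lin(1,2) pi_lin(5)[of x] pi_lin(5)[of y]
  by (simp add: eq_neg_iff_add_eq_0 add.commute)

lemma mu_skew: "\<mu> u v = - \<mu> v u"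
  using mu_lin(5)[of "u + v"] unfolding mu_lin(1,2) mu_lin(5)[of u] mu_lin(5)[of v]
  by (simp add: eq_neg_iff_add_eq_0 add.commute)

definition \<Omega> :: "('g, 'h) Lmap" where "\<Omega> = fst (mc_candidate sg sh \<pi> \<mu> \<rho> D)"
definition \<delta> :: "('g, 'h) Fmap" where "\<delta> = snd (mc_candidate sg sh \<pi> \<mu> \<rho> D)"

text \<open>This is the bracket of the semidirect product of g and h; hence its Jacobi identity
  encodes the Lie and action axioms.\<close>

lemma Omega_2: "\<Omega> [v, w] = (\<pi> (fst v) (fst w), \<mu> (snd v) (snd w) + \<rho> (fst v) (snd w) - \<rho> (fst w) (snd v))"
  by (simp add: \<Omega>_def mc_candidate_def g.lift_ksum h.lift_ksum)

lemma Omega_other: "length vs \<noteq> 2 \<Longrightarrow> \<Omega> vs = 0"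
  by (simp add: \<Omega>_def mc_candidate_def lift_def zero_prod_def)

lemma delta_simps: "\<delta> [x] = D x" "length xs \<noteq> 1 \<Longrightarrow> \<delta> xs = 0"
  by (simp_all add: \<delta>_def mc_candidate_def)

lemma Omega_Gsp: "\<Omega> \<in> Gsp 1"
proof -
  have "\<Omega> (us @ (sV c y + z) # vs) = sV c (\<Omega> (us @ y # vs)) + \<Omega> (us @ z # vs)" for us c y z vs
  proof (cases "length us + length vs = 1")
    case True
    then consider w where "us = []" "vs = [w]" | w where "us = [w]" "vs = []"
      by (cases us; cases vs) auto
    then show ?thesis
      by cases (auto simp: Omega_2 scaleV_def h.scale_right_distrib h.scale_right_diff_distrib algebra_simps)
  qed (simp add: Omega_other)
  moreover have "\<Omega> (us @ x # y # vs) = - \<Omega> (us @ y # x # vs)" for us x y vs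
  proof (cases "us = [] \<and> vs = []")
    case True
    then show ?thesis using pi_skew[of "fst x" "fst y"] mu_skew[of "snd x" "snd y"] by (simp add: Omega_2)
  next
    case False
    then show ?thesis by (subst (1 2) Omega_other) auto
  qed
  moreover have "arity 2 \<Omega>" using Omega_other by (auto simp: arity_def)
  ultimately have "mlin sV sV \<Omega>" "skew \<Omega>" "arity 2 \<Omega>" unfolding mlin_def skew_def by blast+
  then show ?thesis by (simp add: Gsp_def Omega_other)
qed

lemma Omega_Msp: "\<Omega> \<in> Msp sg sh"
proof -
  have "pg (\<Omega> vs) = \<Omega> (map pg vs)" for vs
  proof (cases "length vs = 2")
    case True
    then show ?thesis by (elim length_2E) (simp add: Omega_2 pg_def)
  qed (simp add: Omega_other)
  then show ?thesis using Omega_Gsp by (simp add: Msp_iff Gsp_Lsp)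
qed

lemma delta_Hsp: "\<delta> \<in> Hsp 0"
proof -
  have "\<delta> (us @ (sg c y + z) # vs) = sh c (\<delta> (us @ y # vs)) + \<delta> (us @ z # vs)" for us c y z vs
    by (cases "us = [] \<and> vs = []") (auto simp: delta_simps)
  moreover have "\<delta> (us @ x # y # vs) = - \<delta> (us @ y # x # vs)" for us x y vs
    by (simp add: delta_simps)
  moreover have "arity 1 \<delta>" using delta_simps(2) by (auto simp: arity_def)
  ultimately have "mlin sg sh \<delta>" "skew \<delta>" "arity 1 \<delta>" unfolding mlin_def skew_def by blast+
  then show ?thesis by (simp add: Hsp_def delta_simps)
qed

abbreviation \<alpha> where "\<alpha> \<equiv> mc_candidate sg sh \<pi> \<mu> \<rho> D"

lemma alpha_eq: "\<alpha> = (\<Omega>, \<delta>)" by (simp add: \<Omega>_def \<delta>_def)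

lemma alpha_MF: "\<alpha> \<in> MF" using Omega_Msp delta_Hsp by (simp add: alpha_eq Hsp_Fsp)

lemma alpha_hom: "homE 0 \<alpha>"
  using Omega_other delta_simps(2) by (auto simp: alpha_eq homE_def)

definition emb_D :: "('g, 'h) Lmap" where "emb_D = emb sh \<delta>"

lemma emb_D_Gsp: "emb_D \<in> Gsp 0" unfolding emb_D_def by (rule emb_Gsp[OF delta_Hsp])

lemma emb_D_simps: "emb_D [v] = (0, D (fst v))" "length vs \<noteq> 1 \<Longrightarrow> emb_D vs = 0"
  by (simp_all add: emb_D_def emb_eq delta_simps zero_prod_def)

text \<open>As \<open>emb_D\<close> has degree 0, the bracket is the plain commutator of
  \<open>X\<close> and \<open>emb_D\<close> with respect to \<open>circ\<close>.\<close>

lemma bracket_emb_D: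
  assumes "X \<in> Gsp 1"
  shows "nr_bracket sV X emb_D [v, w] = X [(0, D (fst v)), w] - X [(0, D (fst w)), v] - (0, D (fst (X [v, w])))"
    and "length vs \<noteq> 2 \<Longrightarrow> nr_bracket sV X emb_D vs = 0"
proof -
  have X: "X vs = 0" if "length vs \<noteq> 2" for vs using assms that by (auto simp: Gsp_def arity_def)
  show "nr_bracket sV X emb_D [v, w] = X [(0, D (fst v)), w] - X [(0, D (fst w)), v] - (0, D (fst (X [v, w])))"
    by (simp add: brk_Gsp[OF assms emb_D_Gsp] V.brk_def circ_def emb_D_simps X)
  show "nr_bracket sV X emb_D vs = 0" if "length vs \<noteq> 2"
    using brk_Gsp_closed[OF assms emb_D_Gsp] that by (auto simp: Gsp_def arity_def)
qed

definition Q :: "('g, 'h) Lmap" where "Q = nr_bracket sV \<Omega> emb_D"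
definition R :: "('g, 'h) Lmap" where "R = nr_bracket sV Q emb_D"

lemma Q_Gsp: "Q \<in> Gsp 1" and R_Gsp: "R \<in> Gsp 1"
  using brk_Gsp_closed[OF Omega_Gsp emb_D_Gsp] brk_Gsp_closed[OF _ emb_D_Gsp, of Q 1] by (simp_all add: Q_def R_def)

lemma Q_2: "Q [v, w] = (0, \<mu> (D (fst v)) (snd w) - \<rho> (fst w) (D (fst v)) - \<mu> (D (fst w)) (snd v)
    + \<rho> (fst v) (D (fst w)) - D (\<pi> (fst v) (fst w)))"
  by (simp add: Q_def bracket_emb_D[OF Omega_Gsp] Omega_2 algebra_simps)

text \<open>\<open>Q\<close> is h-valued and only its \<mu>-terms depend on h-components. Inserting
  \<open>D\<close> there gives the same term from both slots, by skew symmetry of \<mu>.\<close>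

lemma R_2: "R [v, w] = (0, \<mu> (D (fst v)) (D (fst w)) + \<mu> (D (fst v)) (D (fst w)))"
  using mu_skew[of "D (fst w)" "D (fst v)"] by (simp add: R_def bracket_emb_D[OF Q_Gsp] Q_2)

text \<open>\<open>R\<close> is h-valued and depends only on g-components, so inserting
  \<open>emb_D\<close> before or after it gives zero.\<close>

lemma bracket_R: "nr_bracket sV R emb_D = 0"
proof
  fix vs show "nr_bracket sV R emb_D vs = 0 vs"
  proof (cases "length vs = 2")
    case True
    then show ?thesis by (elim length_2E) (simp add: bracket_emb_D[OF R_Gsp] R_2 zero_prod_def)
  qed (simp add: bracket_emb_D[OF R_Gsp])
qed

abbreviation uL where "uL \<equiv> (True, 0, \<Omega>, 0) :: (('g, 'h) Lmap, ('g, 'h) Fmap) tagged"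
abbreviation uF where "uF \<equiv> (False, 0, 0, \<delta>) :: (('g, 'h) Lmap, ('g, 'h) Fmap) tagged"

text \<open>The candidate has at most two pure pieces, so its \<open>k\<close>-fold bracket is a sum
  over words of length \<open>k\<close> in two letters.\<close>

lemma lbr_alpha:
  "lbr sg sh k (replicate k \<alpha>) = (\<Sum>c | set c \<subseteq> {(True, 2 :: nat), (False, 1)} \<and> length c = k.
     lab (map (\<lambda>t. if fst t then uL else uF) c))"
proof -
  have t: "tags \<alpha> \<subseteq> {(True, 2), (False, 1)}"
    using Omega_other delta_simps(2) by (auto simp: tags_def alpha_eq arity_set_def)
  have r: "restr 2 \<Omega> = \<Omega>" "restr (Suc 0) \<delta> = \<delta>"
    using Omega_other delta_simps(2) by (auto simp: restr_def fun_eq_iff)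
  have "lbr sg sh k (replicate k \<alpha>) = (\<Sum>c | set c \<subseteq> {(True, 2), (False, 1)} \<and> length c = k. lab (map2 tag_piece c (replicate k \<alpha>)))"
    using t alpha_MF MF_LF by (intro lbr_superset) auto
  also have "\<dots> = (\<Sum>c | set c \<subseteq> {(True, 2 :: nat), (False, 1)} \<and> length c = k. lab (map (\<lambda>t. if fst t then uL else uF) c))"
  proof (intro sum.cong refl arg_cong[where f = lab])
    fix c :: "(bool \<times> nat) list" assume c: "c \<in> {c. set c \<subseteq> {(True, 2), (False, 1)} \<and> length c = k}"
    show "map2 tag_piece c (replicate k \<alpha>) = map (\<lambda>t. if fst t then uL else uF) c"
    proof (rule nth_equalityI)
      fix i assume "i < length (map2 tag_piece c (replicate k \<alpha>))"
      then have i: "i < k" "i < length c" by simp_all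
      then have "c ! i = (True, 2) \<or> c ! i = (False, 1)" using nth_mem[of i c] c by blast
      then have "tag_piece (c ! i) \<alpha> = (if fst (c ! i) then uL else uF)"
        by (auto simp: tag_piece_def piece_def tagdeg_def alpha_eq r)
      then show "map2 tag_piece c (replicate k \<alpha>) ! i = map (\<lambda>t. if fst t then uL else uF) c ! i"
        using i by simp
    qed (use c in simp)
  qed
  finally show ?thesis .
qed

text \<open>Both pieces have degree 0, so no signs occur and the position of the L-entry is
  irrelevant.\<close>

lemma lab_L_Fs:
  assumes "\<forall>u\<in>set as. u = uF" "\<forall>u\<in>set bs. u = uF"
  shows "lab (as @ uL # bs) = (0, projF (((\<lambda>X. nr_bracket sV X emb_D) ^^ (length as + length bs)) \<Omega>))"
proof -
  have "ad X us = ((\<lambda>X. nr_bracket sV X emb_D) ^^ length us) X" if "\<forall>u\<in>set us. u = uF" for X us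
    using that by (induction us arbitrary: X) (simp_all add: emb_D_def funpow_Suc_right del: funpow.simps(2))
  moreover have "dgs as = 0" using assms(1) by (induction as) auto
  moreover have "noL as" "noL bs" using assms by auto
  moreover have "\<forall>u\<in>set (as @ bs). u = uF" using assms by auto
  ultimately show ?thesis by (simp add: lab_one del: ad_append)
qed

lemma iterate_bracket_emb_D:
  assumes "3 \<le> n"
  shows "((\<lambda>X. nr_bracket sV X emb_D) ^^ n) \<Omega> = 0"
proof -
  let ?b = "\<lambda>X. nr_bracket sV X emb_D"
  have "n = (n - 3) + 3" using assms by simp
  then have "(?b ^^ n) \<Omega> = (?b ^^ (n - 3)) ((?b ^^ 3) \<Omega>)" by (metis comp_apply funpow_add)
  also have "(?b ^^ 3) \<Omega> = 0" by (simp add: numeral_3_eq_3 bracket_R flip: Q_def R_def)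
  also have "(?b ^^ m) 0 = 0" for m
    using br_0[OF emb_D_Gsp] by (induction m) simp_all
  finally show ?thesis .
qed

text \<open>A word with exactly one L-entry now has at least three F-entries, and words with two or
  more L-entries contribute only for \<open>k = 2\<close>.\<close>

lemma lbr_alpha_large:
  assumes "4 \<le> k"
  shows "lbr sg sh k (replicate k \<alpha>) = 0"
  unfolding lbr_alpha
proof (rule sum.neutral, intro ballI)
  fix c :: "(bool \<times> nat) list" assume c: "c \<in> {c. set c \<subseteq> {(True, 2), (False, 1)} \<and> length c = k}"
  define us where "us = map (\<lambda>t. if fst t then uL else uF) c"
  have us: "u = uL \<or> u = uF" if "u \<in> set us" for u using that by (auto simp: us_def)
  have k: "length us = k" using c by (simp add: us_def)
  have "lab us = 0"
  proof (cases us rule: lab_cases)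
    case (2 as t bs)
    have L: "u = uL" if "u \<in> set us" "isL u" for u using us[OF that(1)] that(2) by (elim disjE) simp_all
    have F: "u = uF" if "u \<in> set us" "\<not> isL u" for u using us[OF that(1)] that(2) by (elim disjE) simp_all
    have "t = uL" by (rule L) (simp_all add: 2)
    moreover have "\<forall>u\<in>set as. u = uF" by (intro ballI F) (simp_all add: 2)
    moreover have "\<forall>u\<in>set bs. u = uF" by (intro ballI F) (simp_all add: 2)
    moreover have "3 \<le> length as + length bs" using k assms 2(1) by simp
    ultimately show ?thesis unfolding 2(1)
      by (simp add: lab_L_Fs iterate_bracket_emb_D P_0 zero_prod_def)
  next
    case (3 u v)
    then show ?thesis using k assms by simp
  qed (simp_all add: lab_none lab_many)
  then show "lab (map (\<lambda>t. if fst t then uL else uF) c) = 0" by (simp add: us_def)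
qed

lemma lists_of_length:
  "{c. set c \<subseteq> {a, b} \<and> length c = 1} = {[a], [b]}"
  "{c. set c \<subseteq> {a, b} \<and> length c = 2} = {[a, a], [a, b], [b, a], [b, b]}"
  "{c. set c \<subseteq> {a, b} \<and> length c = 3} =
     {[a, a, a], [a, a, b], [a, b, a], [a, b, b], [b, a, a], [b, a, b], [b, b, a], [b, b, b]}"
proof -
  let ?L = "\<lambda>n. {c. set c \<subseteq> {a, b} \<and> length c = n}"
  have S: "?L (Suc n) = (#) a ` ?L n \<union> (#) b ` ?L n" for n
    by (auto simp: length_Suc_conv)
  have L0: "?L 0 = {[]}" by auto
  have 1: "?L (Suc 0) = {[a], [b]}" unfolding S L0 by auto
  have 2: "?L (Suc (Suc 0)) = {[a, a], [a, b], [b, a], [b, b]}" unfolding S[of "Suc 0"] 1 by auto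
  have 3: "?L (Suc (Suc (Suc 0))) = {[a, a, a], [a, a, b], [a, b, a], [a, b, b], [b, a, a], [b, a, b], [b, b, a], [b, b, b]}"
    unfolding S[of "Suc (Suc 0)"] 2 by auto
  show "?L 1 = {[a], [b]}" "?L 2 = {[a, a], [a, b], [b, a], [b, b]}"
    "?L 3 = {[a, a, a], [a, a, b], [a, b, a], [a, b, b], [b, a, a], [b, a, b], [b, b, a], [b, b, b]}"
    using 1 2 3 by (simp_all only: numeral_2_eq_2 numeral_3_eq_3 One_nat_def)
qed

lemma projF_Omega: "projF \<Omega> = 0"
proof
  fix xs show "projF \<Omega> xs = 0 xs"
  proof (cases "length xs = 2")
    case True
    then show ?thesis by (elim length_2E) (simp add: projF_def Omega_2)
  qed (simp add: projF_def Omega_other)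
qed

lemma lbr_alpha_1: "lbr sg sh 1 (replicate 1 \<alpha>) = 0"
  unfolding lbr_alpha lists_of_length
  using lab_L_Fs[of "[]" "[]"] by (simp add: lab_none projF_Omega zero_prod_def)

text \<open>The map \<Omega> has degree 1 in L: this gives the minus sign of the binary bracket, and
  it makes the bracket of \<Omega> with itself twice \<open>circ \<Omega> \<Omega>\<close>. The two
  copies of \<open>projF Q\<close> come from the two mixed words.\<close>

lemma lbr_alpha_2: "lbr sg sh 2 (replicate 2 \<alpha>) = (- (circ \<Omega> \<Omega> + circ \<Omega> \<Omega>), projF Q + projF Q)"
proof -
  have "nr_bracket sV \<Omega> \<Omega> = circ \<Omega> \<Omega> + circ \<Omega> \<Omega>"
    by (simp add: brk_Gsp[OF Omega_Gsp Omega_Gsp] V.brk_def fun_eq_iff)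
  then have "lab [uL, uL] = (- (circ \<Omega> \<Omega> + circ \<Omega> \<Omega>), 0)" by (simp add: lab_LL)
  moreover have "lab [uL, uF] = (0, projF Q)" "lab [uF, uL] = (0, projF Q)" "lab [uF, uF] = 0"
    using lab_L_Fs[of "[]" "[uF]"] lab_L_Fs[of "[uF]" "[]"] by (simp_all add: lab_none Q_def)
  ultimately show ?thesis unfolding lbr_alpha lists_of_length by (simp add: zero_prod_def)
qed

lemma lbr_alpha_3: "lbr sg sh 3 (replicate 3 \<alpha>) = (0, projF R + projF R + projF R)"
proof -
  have "lab [uL, uF, uF] = (0, projF R)" "lab [uF, uL, uF] = (0, projF R)" "lab [uF, uF, uL] = (0, projF R)"
    using lab_L_Fs[of "[]" "[uF, uF]"] lab_L_Fs[of "[uF]" "[uF]"] lab_L_Fs[of "[uF, uF]" "[]"]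
    by (simp_all add: Q_def R_def)
  moreover have "lab [uF, uF, uF] = 0" by (simp add: lab_none)
  moreover have "lab [uL, uL, u] = 0" "lab [uL, u, uL] = 0" "lab [u, uL, uL] = 0" for u
    by (simp_all add: lab_many)
  ultimately show ?thesis unfolding lbr_alpha lists_of_length by (simp add: zero_prod_def)
qed

definition defect :: "'g \<Rightarrow> 'g \<Rightarrow> 'h" where
  "defect x y = \<rho> x (D y) - \<rho> y (D x) - D (\<pi> x y) + \<mu> (D x) (D y)"

lemma MC_sum:
  "(\<Sum>k\<in>{k. 1 \<le> k \<and> lbr sg sh k (replicate k \<alpha>) \<noteq> 0}. sE (inverse (fact k)) (lbr sg sh k (replicate k \<alpha>)))
    = (- circ \<Omega> \<Omega>, \<lambda>xs. if length xs = 2 then defect (xs ! 0) (xs ! 1) else 0)"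
  and MC_finite: "finite {k. 1 \<le> k \<and> lbr sg sh k (replicate k \<alpha>) \<noteq> 0}"
proof -
  let ?K = "{k. 1 \<le> k \<and> lbr sg sh k (replicate k \<alpha>) \<noteq> 0}"
  have K: "?K \<subseteq> {2, 3}"
  proof
    fix k assume k: "k \<in> ?K"
    then have "k \<noteq> 1" "\<not> 4 \<le> k" using lbr_alpha_1 lbr_alpha_large by auto
    with k have "k = 2 \<or> k = 3" by auto
    then show "k \<in> {2, 3}" by simp
  qed
  then show "finite ?K" by (rule finite_subset) simp
  have "(\<Sum>k\<in>?K. sE (inverse (fact k)) (lbr sg sh k (replicate k \<alpha>)))
      = (\<Sum>k\<in>{2, 3}. sE (inverse (fact k)) (lbr sg sh k (replicate k \<alpha>)))"
    using K by (intro sum.mono_neutral_left) auto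
  also have "\<dots> = sE (inverse 2) (- (circ \<Omega> \<Omega> + circ \<Omega> \<Omega>), projF Q + projF Q)
      + sE (inverse 6) (0, projF R + projF R + projF R)"
    by (simp add: lbr_alpha_2 lbr_alpha_3 fact_numeral)
  also have "\<dots> = (- circ \<Omega> \<Omega>, \<lambda>xs. if length xs = 2 then defect (xs ! 0) (xs ! 1) else 0)"
  proof -
    have half: "sV (inverse 2) (v + v) = v" for v
      using V.A.scale_left_distrib[of "inverse 2" "inverse 2" v] by (simp add: V.A.scale_right_distrib)
    have halfh: "sh (inverse 2) (u + u) = u" for u
      using h.scale_left_distrib[of "inverse 2" "inverse 2" u] by (simp add: h.scale_right_distrib)
    \<comment> \<open>The coefficient 1/3! meets three positions of the L-entry and the factor 2 in
      \<open>R_2\<close>.\<close>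
    have sixth: "sh (inverse 6) ((u + u) + (u + u) + (u + u)) = u" for u
    proof -
      have "(u + u) + (u + u) + (u + u) = sh 6 u"
        using h.scale_left_distrib[of 1 1 u] h.scale_left_distrib[of 2 2 u] h.scale_left_distrib[of 4 2 u] by simp
      then show ?thesis by simp
    qed
    have "sV (inverse 2) (- (circ \<Omega> \<Omega> vs + circ \<Omega> \<Omega> vs)) = - circ \<Omega> \<Omega> vs" for vs
      by (simp only: V.A.scale_minus_right half)
    moreover have "sh (inverse 2) (projF Q xs + projF Q xs) + sh (inverse 6) (projF R xs + projF R xs + projF R xs)
        = (if length xs = 2 then defect (xs ! 0) (xs ! 1) else 0)" for xs
    proof (cases "length xs = 2")
      case True
      then obtain x y where xs: "xs = [x, y]" by (elim length_2E)
      have "projF R xs = \<mu> (D x) (D y) + \<mu> (D x) (D y)" "projF Q xs = \<rho> x (D y) - \<rho> y (D x) - D (\<pi> x y)"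
        by (simp_all add: xs projF_def R_2 Q_2)
      then show ?thesis unfolding halfh by (simp only: sixth) (simp add: xs defect_def)
    next
      case False
      then have "projF Q xs = 0" "projF R xs = 0"
        using Q_Gsp R_Gsp by (auto simp: projF_def Gsp_def arity_def) (metis length_map nat_int nat_numeral snd_zero)+
      then show ?thesis using False by simp
    qed
    ultimately show ?thesis by (auto simp: scaleE_def fun_eq_iff)
  qed
  finally show "(\<Sum>k\<in>?K. sE (inverse (fact k)) (lbr sg sh k (replicate k \<alpha>)))
    = (- circ \<Omega> \<Omega>, \<lambda>xs. if length xs = 2 then defect (xs ! 0) (xs ! 1) else 0)" .
qed

lemma MC_iff: "MC_element sE homE MF (lbr sg sh) \<alpha> \<longleftrightarrow> circ \<Omega> \<Omega> = 0 \<and> (\<forall>x y. defect x y = 0)"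
proof -
  have "(\<lambda>xs. if length xs = 2 then defect (xs ! 0) (xs ! 1) else 0) = 0 \<longleftrightarrow> (\<forall>x y. defect x y = 0)"
  proof
    assume *: "(\<lambda>xs. if length xs = 2 then defect (xs ! 0) (xs ! 1) else 0) = 0"
    have "defect x y = 0" for x y using fun_cong[OF *, of "[x, y]"] by simp
    then show "\<forall>x y. defect x y = 0" by blast
  qed (simp add: fun_eq_iff)
  then show ?thesis unfolding MC_element_def MC_sum
    using MC_finite alpha_MF alpha_hom by (simp add: zero_prod_def)
qed

lemma circ_Omega_3: "circ \<Omega> \<Omega> [u, v, w] = \<Omega> [\<Omega> [u, v], w] - \<Omega> [\<Omega> [u, w], v] + \<Omega> [\<Omega> [v, w], u]"
  by (simp add: circ_def Omega_other pm_def)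

lemma circ_Omega_other: "length vs \<noteq> 3 \<Longrightarrow> circ \<Omega> \<Omega> vs = 0"
  using V.arity_circ[of \<Omega> 2 2 \<Omega>] Omega_Gsp by (auto simp: Gsp_def arity_def)

lemma circ_Omega_0_iff: "circ \<Omega> \<Omega> = 0 \<longleftrightarrow> Lie_bracket sg \<pi> \<and> Lie_bracket sh \<mu> \<and> is_action sg sh \<pi> \<mu> \<rho>"
proof
  assume 0: "circ \<Omega> \<Omega> = 0"
  have z: "\<Omega> [\<Omega> [u, v], w] - \<Omega> [\<Omega> [u, w], v] + \<Omega> [\<Omega> [v, w], u] = 0" for u v w
    using fun_cong[OF 0, of "[u, v, w]"] by (simp add: circ_Omega_3)
  \<comment> \<open>Evaluation on pure triples separates the axioms: three entries in g, three in h,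
    one in g and two in h (derivation), two in g and one in h (homomorphism).\<close>
  have "\<pi> x (\<pi> y w) + \<pi> y (\<pi> w x) + \<pi> w (\<pi> x y) = 0" for x y w
    using z[of "(x, 0)" "(y, 0)" "(w, 0)"] pi_skew[of "\<pi> x y" w] pi_skew[of "\<pi> x w" y] pi_skew[of "\<pi> y w" x]
      pi_skew[of w x] by (simp add: Omega_2 zero_prod_def algebra_simps)
  moreover have "\<mu> u (\<mu> v w) + \<mu> v (\<mu> w u) + \<mu> w (\<mu> u v) = 0" for u v w
    using z[of "(0, u)" "(0, v)" "(0, w)"] mu_skew[of "\<mu> u v" w] mu_skew[of "\<mu> u w" v] mu_skew[of "\<mu> v w" u]
      mu_skew[of w u] by (simp add: Omega_2 zero_prod_def algebra_simps)
  moreover have "\<rho> x (\<mu> u v) = \<mu> (\<rho> x u) v + \<mu> u (\<rho> x v)" for x u v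
    using z[of "(x, 0)" "(0, u)" "(0, v)"] mu_skew[of "\<rho> x v" u] by (simp add: Omega_2 zero_prod_def algebra_simps)
  moreover have "\<rho> (\<pi> x y) u = \<rho> x (\<rho> y u) - \<rho> y (\<rho> x u)" for x y u
    using z[of "(x, 0)" "(y, 0)" "(0, u)"] by (simp add: Omega_2 zero_prod_def algebra_simps)
  ultimately show "Lie_bracket sg \<pi> \<and> Lie_bracket sh \<mu> \<and> is_action sg sh \<pi> \<mu> \<rho>"
    using pi mu rho unfolding Lie_bracket_def is_action_def by blast
next
  assume *: "Lie_bracket sg \<pi> \<and> Lie_bracket sh \<mu> \<and> is_action sg sh \<pi> \<mu> \<rho>"
  \<comment> \<open>The Jacobi identity in the form produced by the three (2,1)-shuffles in
    \<open>circ_Omega_3\<close>.\<close>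
  have J: "\<pi> (\<pi> x y) w - \<pi> (\<pi> x w) y + \<pi> (\<pi> y w) x = 0" for x y w
  proof -
    have "\<pi> x (\<pi> y w) + \<pi> y (\<pi> w x) + \<pi> w (\<pi> x y) = 0" using * by (simp add: Lie_bracket_def)
    then show ?thesis using pi_skew[of "\<pi> x y" w] pi_skew[of "\<pi> x w" y] pi_skew[of "\<pi> y w" x]
      pi_skew[of w x] by (simp add: algebra_simps)
  qed
  have K: "\<mu> (\<mu> x y) w - \<mu> (\<mu> x w) y + \<mu> (\<mu> y w) x = 0" for x y w
  proof -
    have "\<mu> x (\<mu> y w) + \<mu> y (\<mu> w x) + \<mu> w (\<mu> x y) = 0" using * by (simp add: Lie_bracket_def)
    then show ?thesis using mu_skew[of "\<mu> x y" w] mu_skew[of "\<mu> x w" y] mu_skew[of "\<mu> y w" x]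
      mu_skew[of w x] by (simp add: algebra_simps)
  qed
  have A: "\<rho> x (\<mu> u v) = \<mu> (\<rho> x u) v + \<mu> u (\<rho> x v)" "\<rho> (\<pi> x y) u = \<rho> x (\<rho> y u) - \<rho> y (\<rho> x u)" for x y u v
    using * by (simp_all add: is_action_def)
  have "circ \<Omega> \<Omega> [u, v, w] = 0" for u v w
  proof -
    obtain x1 u1 x2 u2 x3 u3 where "u = (x1, u1)" "v = (x2, u2)" "w = (x3, u3)"
      by (cases u; cases v; cases w) auto
    then show ?thesis
      using J[of x1 x2 x3] K[of u1 u2 u3] mu_skew[of u2 "\<rho> x1 u3"] mu_skew[of u1 "\<rho> x2 u3"] mu_skew[of u1 "\<rho> x3 u2"]
        mu_skew[of u3 "\<rho> x1 u2"] mu_skew[of u3 "\<rho> x2 u1"] mu_skew[of u2 "\<rho> x3 u1"]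
      by (simp add: circ_Omega_3 Omega_2 zero_prod_def A algebra_simps)
  qed
  then show "circ \<Omega> \<Omega> = 0"
  proof -
    have "circ \<Omega> \<Omega> vs = 0" for vs
    proof (cases "length vs = 3")
      case True
      then obtain u v w where "vs = [u, v, w]" by (auto simp: length_Suc_conv numeral_3_eq_3)
      then show ?thesis using \<open>\<And>u v w. circ \<Omega> \<Omega> [u, v, w] = 0\<close> by simp
    qed (rule circ_Omega_other)
    then show ?thesis by (simp add: fun_eq_iff)
  qed
qed

lemma MC_iff_rel_diff_Lie: "MC_element sE homE MF (lbr sg sh) \<alpha> \<longleftrightarrow> rel_diff_Lie sg sh \<pi> \<mu> \<rho> D"
proof -
  have "(\<forall>x y. defect x y = 0) \<longleftrightarrow> rel_diff_operator \<pi> \<mu> \<rho> D"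
    unfolding rel_diff_operator_def defect_def by (simp add: algebra_simps) (metis (no_types))
  then show ?thesis unfolding MC_iff circ_Omega_0_iff rel_diff_Lie_def using D by blast
qed

end

theorem theorem3p8:
  fixes sg :: "'k::field_char_0 \<Rightarrow> 'g::ab_group_add \<Rightarrow> 'g"
    and sh :: "'k \<Rightarrow> 'h::ab_group_add \<Rightarrow> 'h"
  assumes "vector_space sg" and "vector_space sh"
  shows "Linf_subalgebra (scaleE sg sh) homE (Msp sg sh \<times> Fsp sg sh) (Lsp sg sh \<times> Fsp sg sh) (lbr sg sh)
    \<and> (\<forall>\<pi> \<mu> \<rho> D. alt_bilinear sg sg \<pi> \<and> alt_bilinear sh sh \<mu> \<and> bilinear_map sg sh sh \<rho>
          \<and> module_hom sg sh D \<longrightarrow>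
         (MC_element (scaleE sg sh) homE (Msp sg sh \<times> Fsp sg sh) (lbr sg sh) (mc_candidate sg sh \<pi> \<mu> \<rho> D)
          \<longleftrightarrow> rel_diff_Lie sg sh \<pi> \<mu> \<rho> D))"
proof (intro conjI allI impI)
  interpret two_spaces sg sh using assms by (simp add: two_spaces_def)
  show "Linf_subalgebra (scaleE sg sh) homE (Msp sg sh \<times> Fsp sg sh) (Lsp sg sh \<times> Fsp sg sh) (lbr sg sh)"
    by (rule Linf_subalgebra_MF)
  fix \<pi> \<mu> \<rho> D
  assume *: "alt_bilinear sg sg \<pi> \<and> alt_bilinear sh sh \<mu> \<and> bilinear_map sg sh sh \<rho> \<and> module_hom sg sh D"
  interpret rdl_data sg sh \<pi> \<mu> \<rho> D
    using * by (intro rdl_data.intro rdl_data_axioms.intro two_spaces_axioms) simp_all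
  show "MC_element (scaleE sg sh) homE (Msp sg sh \<times> Fsp sg sh) (lbr sg sh) (mc_candidate sg sh \<pi> \<mu> \<rho> D)
      \<longleftrightarrow> rel_diff_Lie sg sh \<pi> \<mu> \<rho> D"
    by (rule MC_iff_rel_diff_Lie)
qed

end
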